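(* Let $Q$ be a smooth finite-dimensional manifold and let $L:TQ\to\mathbb{R}$ be a $C^k$ Lagrangian, $k\ge 2$. Then there exist a unique $C^{k-2}$ mapping $D_{EL}L:\ddot Q\to T^*Q$ and a unique $C^{k-1}$ one-form $\theta_L$ on $TQ$ such that, for all $C^2$ variations $q_\epsilon(t)$, $t\in[a,b]$, of a curve $q=q_0$ (with endpoints not required to be fixed), $$dS\bigl(q(t)\bigr)\cdot\delta q(t)=\int_a^b D_{EL}L\left(\frac{d^2q}{dt^2}\right)\cdot\delta q\,dt+\left.\theta_L\left(\frac{dq}{dt}\right)\cdot\widehat{\delta q}\,\right|_a^b ,$$ where $$\delta q(t)=\left.\frac{d}{d\epsilon}\right|_{\epsilon=0}q_\epsilon(t),\qquad \widehat{\delta q}(t)=\left.\frac{d}{d\epsilon}\right|_{\epsilon=0}\frac{d}{dt}q_\epsilon(t).$$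
   Context: For a $C^2$ curve $q:[a,b]\to Q$ the action is $S(q)=\int_a^b L\left(\frac{dq}{dt}(t)\right)dt$, where $\frac{dq}{dt}(t)\in TQ$ is the tangent vector of the curve. A variation of $q$ is a family of curves $q_\epsilon$ with $q_0=q$, and $dS(q)\cdot\delta q:=\frac{d}{d\epsilon}\big|_{\epsilon=0}S(q_\epsilon)$. The second order submanifold of $TTQ$ is $\ddot Q=\left\{\frac{d^2q}{dt^2}(0)\;\middle|\; q \text{ a } C^2 \text{ curve in } Q\right\}$, where $\frac{d^2q}{dt^2}$ denotes the tangent vector in $TTQ$ of the curve $t\mapsto \frac{dq}{dt}(t)$ in $TQ$. The map $D_{EL}L$ covers the identity of $Q$, i.e. $D_{EL}L\left(\frac{d^2q}{dt^2}(t)\right)\in T^*_{q(t)}Q$, so that it can be paired with $\delta q(t)\in T_{q(t)}Q$. The vector $\widehat{\delta q}(t)$ lies in $T_{\dot q(t)}TQ$. *)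

theory Defs
  imports "HOL-Analysis.Analysis" "HOL-Library.Extended_Nat"
begin

section \<open>Maps of class \<open>C\<^sup>r\<close> on open subsets of normed spaces\<close>

primrec C_nat_on :: "nat \<Rightarrow> 'a::real_normed_vector set \<Rightarrow> ('a \<Rightarrow> 'b::real_normed_vector) \<Rightarrow> bool" where
  "C_nat_on 0 W g \<longleftrightarrow> continuous_on W g"
| "C_nat_on (Suc n) W g \<longleftrightarrow>
     (\<forall>x\<in>W. g differentiable (at x)) \<and>
     (\<forall>v. C_nat_on n W (\<lambda>x. frechet_derivative g (at x) v))"

text \<open>The order is an extended natural number; order \<open>\<infinity>\<close> means smooth.\<close>

definition C_on :: "enat \<Rightarrow> 'a::real_normed_vector set \<Rightarrow> ('a \<Rightarrow> 'b::real_normed_vector) \<Rightarrow> bool" where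
  "C_on r W g \<longleftrightarrow> (\<forall>n. enat n \<le> r \<longrightarrow> C_nat_on n W g)"


section \<open>Smooth manifolds\<close>

text \<open>Only the values of \<open>chart_map\<close> on \<open>chart_dom\<close> are meaningful.\<close>

datatype ('q, 'e) chart = Chart (chart_dom: "'q set") (chart_map: "'q \<Rightarrow> 'e")

definition chart_inv :: "('q, 'e) chart \<Rightarrow> 'e \<Rightarrow> 'q" where
  "chart_inv \<phi> = inv_into (chart_dom \<phi>) (chart_map \<phi>)"

definition transition :: "('q, 'e) chart \<Rightarrow> ('q, 'e) chart \<Rightarrow> 'e \<Rightarrow> 'e" where
  "transition \<phi> \<psi> = chart_map \<psi> \<circ> chart_inv \<phi>"

definition carrier :: "('q, 'e) chart set \<Rightarrow> 'q set" where
  "carrier A = (\<Union>\<phi>\<in>A. chart_dom \<phi>)"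

definition smooth_manifold :: "'q topology \<Rightarrow> ('q, 'e::euclidean_space) chart set \<Rightarrow> bool" where
  "smooth_manifold X A \<longleftrightarrow>
     Hausdorff_space X \<and> second_countable X \<and> carrier A = topspace X \<and>
     (\<forall>\<phi>\<in>A. openin X (chart_dom \<phi>) \<and> open (chart_map \<phi> ` chart_dom \<phi>) \<and>
        homeomorphic_map (subtopology X (chart_dom \<phi>))
          (top_of_set (chart_map \<phi> ` chart_dom \<phi>)) (chart_map \<phi>)) \<and>
     (\<forall>\<phi>\<in>A. \<forall>\<psi>\<in>A.
        C_on \<infinity> (chart_map \<phi> ` (chart_dom \<phi> \<inter> chart_dom \<psi>)) (transition \<phi> \<psi>))"

text \<open>The standard atlas of a vector space, used for \<open>\<real>\<close> and \<open>\<real> \<times> \<real>\<close>.\<close>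

definition std_atlas :: "('e, 'e) chart set" where
  "std_atlas = {Chart UNIV (\<lambda>x. x)}"

text \<open>
  Maps of class \<open>C\<^sup>r\<close> defined on an arbitrary subset \<open>S\<close> of the manifold with atlas \<open>A\<close>, with
  values in the manifold with atlas \<open>B\<close>: near each point of \<open>S\<close> the local representative is the
  restriction of a \<open>C\<^sup>r\<close> map defined on an open set of the model space. For open \<open>S\<close> this is the
  usual notion; for an embedded submanifold \<open>S\<close> it agrees with the notion given by the induced
  structure, and for a compact interval or a strip it is the usual notion with one-sided
  derivatives at the boundary.
\<close>

definition C_map_on ::
  "enat \<Rightarrow> ('p, 'e::real_normed_vector) chart set \<Rightarrow> 'p set \<Rightarrow>
   ('q, 'f::real_normed_vector) chart set \<Rightarrow> ('p \<Rightarrow> 'q) \<Rightarrow> bool" where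
  "C_map_on r A S B f \<longleftrightarrow>
     (\<forall>p\<in>S. \<exists>\<phi>\<in>A. \<exists>\<psi>\<in>B. \<exists>W g.
        p \<in> chart_dom \<phi> \<and> f p \<in> chart_dom \<psi> \<and>
        open W \<and> chart_map \<phi> p \<in> W \<and> C_on r W g \<and>
        (\<forall>x \<in> S \<inter> chart_dom \<phi>. chart_map \<phi> x \<in> W \<longrightarrow>
           f x \<in> chart_dom \<psi> \<and> chart_map \<psi> (f x) = g (chart_map \<phi> x)))"


section \<open>The tangent bundle\<close>

text \<open>
  A tangent vector consists of its base point and of its components in all charts around the base
  point, related by the derivatives of the transition maps. Components in irrelevant charts are
  normalised to 0.
\<close>

datatype ('q, 'e) tvec = TVec (base: 'q) (component: "('q, 'e) chart \<Rightarrow> 'e")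

definition tangent_space ::
  "('q, 'e::real_normed_vector) chart set \<Rightarrow> 'q \<Rightarrow> ('q, 'e) tvec set" where
  "tangent_space A p =
     {v. base v = p \<and>
         (\<forall>\<phi>. \<not> (\<phi> \<in> A \<and> p \<in> chart_dom \<phi>) \<longrightarrow> component v \<phi> = 0) \<and>
         (\<forall>\<phi>\<in>A. \<forall>\<psi>\<in>A. p \<in> chart_dom \<phi> \<longrightarrow> p \<in> chart_dom \<psi> \<longrightarrow>
            component v \<psi> = frechet_derivative (transition \<phi> \<psi>) (at (chart_map \<phi> p)) (component v \<phi>))}"

definition tangent_bundle ::
  "('q, 'e::real_normed_vector) chart set \<Rightarrow> ('q, 'e) tvec set" where
  "tangent_bundle A = (\<Union>p\<in>carrier A. tangent_space A p)"

definition tangent_chart ::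
  "('q, 'e::real_normed_vector) chart set \<Rightarrow> ('q, 'e) chart \<Rightarrow> (('q, 'e) tvec, 'e \<times> 'e) chart" where
  "tangent_chart A \<phi> =
     Chart {v \<in> tangent_bundle A. base v \<in> chart_dom \<phi>}
           (\<lambda>v. (chart_map \<phi> (base v), component v \<phi>))"

definition tangent_atlas ::
  "('q, 'e::real_normed_vector) chart set \<Rightarrow> (('q, 'e) tvec, 'e \<times> 'e) chart set" where
  "tangent_atlas A = tangent_chart A ` A"

definition tvec_add ::
  "('q, 'e::real_normed_vector) tvec \<Rightarrow> ('q, 'e) tvec \<Rightarrow> ('q, 'e) tvec" where
  "tvec_add v w = TVec (base v) (\<lambda>\<phi>. component v \<phi> + component w \<phi>)"

definition tvec_scale :: "real \<Rightarrow> ('q, 'e::real_normed_vector) tvec \<Rightarrow> ('q, 'e) tvec" where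
  "tvec_scale c v = TVec (base v) (\<lambda>\<phi>. c *\<^sub>R component v \<phi>)"

text \<open>The tangent vector at \<open>p\<close> whose component in the chart \<open>\<phi>\<close> is \<open>e\<close>.\<close>

definition chart_vec ::
  "('q, 'e::real_normed_vector) chart set \<Rightarrow> ('q, 'e) chart \<Rightarrow> 'q \<Rightarrow> 'e \<Rightarrow> ('q, 'e) tvec" where
  "chart_vec A \<phi> p e =
     TVec p (\<lambda>\<psi>. if \<psi> \<in> A \<and> p \<in> chart_dom \<psi>
                 then frechet_derivative (transition \<phi> \<psi>) (at (chart_map \<phi> p)) e else 0)"


section \<open>The cotangent bundle and one-forms\<close>

text \<open>A covector at \<open>p\<close> is a linear functional on the tangent space at \<open>p\<close>.\<close>

datatype ('q, 'e) covec = Covec (cobase: 'q) (pairing: "('q, 'e) tvec \<Rightarrow> real")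

definition cotangent_space ::
  "('q, 'e::real_normed_vector) chart set \<Rightarrow> 'q \<Rightarrow> ('q, 'e) covec set" where
  "cotangent_space A p =
     {\<alpha>. cobase \<alpha> = p \<and> pairing \<alpha> \<in> extensional (tangent_space A p) \<and>
         (\<forall>v\<in>tangent_space A p. \<forall>w\<in>tangent_space A p.
            pairing \<alpha> (tvec_add v w) = pairing \<alpha> v + pairing \<alpha> w) \<and>
         (\<forall>c. \<forall>v\<in>tangent_space A p. pairing \<alpha> (tvec_scale c v) = c * pairing \<alpha> v)}"

definition cotangent_bundle ::
  "('q, 'e::real_normed_vector) chart set \<Rightarrow> ('q, 'e) covec set" where
  "cotangent_bundle A = (\<Union>p\<in>carrier A. cotangent_space A p)"

text \<open>In the induced chart a covector is represented by its values on the coordinate vectors.\<close>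

definition cotangent_chart ::
  "('q, 'e::euclidean_space) chart set \<Rightarrow> ('q, 'e) chart \<Rightarrow> (('q, 'e) covec, 'e \<times> 'e) chart" where
  "cotangent_chart A \<phi> =
     Chart {\<alpha> \<in> cotangent_bundle A. cobase \<alpha> \<in> chart_dom \<phi>}
           (\<lambda>\<alpha>. (chart_map \<phi> (cobase \<alpha>),
                 \<Sum>b\<in>Basis. pairing \<alpha> (chart_vec A \<phi> (cobase \<alpha>) b) *\<^sub>R b))"

definition cotangent_atlas ::
  "('q, 'e::euclidean_space) chart set \<Rightarrow> (('q, 'e) covec, 'e \<times> 'e) chart set" where
  "cotangent_atlas A = cotangent_chart A ` A"

definition one_form ::
  "enat \<Rightarrow> ('q, 'e::euclidean_space) chart set \<Rightarrow> ('q \<Rightarrow> ('q, 'e) covec) \<Rightarrow> bool" where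
  "one_form r A \<theta> \<longleftrightarrow>
     \<theta> \<in> (\<Pi>\<^sub>E p\<in>carrier A. cotangent_space A p) \<and>
     C_map_on r A (carrier A) (cotangent_atlas A) \<theta>"


section \<open>Curves, their velocities, and the second order submanifold\<close>

text \<open>
  The derivative is taken within the parameter set \<open>I\<close>, hence is one-sided at the end points of a
  compact interval.
\<close>

definition velocity ::
  "('q, 'e::real_normed_vector) chart set \<Rightarrow> real set \<Rightarrow> (real \<Rightarrow> 'q) \<Rightarrow> real \<Rightarrow> ('q, 'e) tvec" where
  "velocity A I c t =
     TVec (c t) (\<lambda>\<phi>. if \<phi> \<in> A \<and> c t \<in> chart_dom \<phi>
                     then vector_derivative (chart_map \<phi> \<circ> c) (at t within I) else 0)"

definition second_velocity ::
  "('q, 'e::real_normed_vector) chart set \<Rightarrow> real set \<Rightarrow> (real \<Rightarrow> 'q) \<Rightarrow> real \<Rightarrow>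
   (('q, 'e) tvec, 'e \<times> 'e) tvec" where
  "second_velocity A I c = velocity (tangent_atlas A) I (velocity A I c)"

definition second_order_submanifold ::
  "('q, 'e::real_normed_vector) chart set \<Rightarrow> (('q, 'e) tvec, 'e \<times> 'e) tvec set" where
  "second_order_submanifold A =
     {second_velocity A {a..b} c 0 | a b c. a < 0 \<and> 0 < b \<and> C_map_on 2 std_atlas {a..b} A c}"


section \<open>The action and its variations\<close>

definition action ::
  "('q, 'e::real_normed_vector) chart set \<Rightarrow> (('q, 'e) tvec \<Rightarrow> real) \<Rightarrow> real \<Rightarrow> real \<Rightarrow>
   (real \<Rightarrow> 'q) \<Rightarrow> real" where
  "action A L a b c = integral {a..b} (\<lambda>t. L (velocity A {a..b} c t))"

text \<open>
  \<open>V \<epsilon> t\<close> is \<open>q\<^sub>\<epsilon>(t)\<close>, jointly of class \<open>C\<^sup>2\<close> in \<open>(\<epsilon>, t)\<close> for \<open>\<bar>\<epsilon>\<bar> < \<delta>\<close>; the end points may move.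
\<close>

definition C2_variation ::
  "('q, 'e::real_normed_vector) chart set \<Rightarrow> real \<Rightarrow> real \<Rightarrow> (real \<Rightarrow> 'q) \<Rightarrow>
   (real \<Rightarrow> real \<Rightarrow> 'q) \<Rightarrow> bool" where
  "C2_variation A a b q V \<longleftrightarrow>
     (\<forall>t\<in>{a..b}. V 0 t = q t) \<and>
     (\<exists>\<delta>>0. C_map_on 2 std_atlas ({-\<delta><..<\<delta>} \<times> {a..b}) A (\<lambda>(\<epsilon>, t). V \<epsilon> t))"

definition delta_q ::
  "('q, 'e::real_normed_vector) chart set \<Rightarrow> (real \<Rightarrow> real \<Rightarrow> 'q) \<Rightarrow> real \<Rightarrow> ('q, 'e) tvec" where
  "delta_q A V t = velocity A UNIV (\<lambda>\<epsilon>. V \<epsilon> t) 0"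

definition delta_q_hat ::
  "('q, 'e::real_normed_vector) chart set \<Rightarrow> real \<Rightarrow> real \<Rightarrow> (real \<Rightarrow> real \<Rightarrow> 'q) \<Rightarrow> real \<Rightarrow>
   (('q, 'e) tvec, 'e \<times> 'e) tvec" where
  "delta_q_hat A a b V t =
     velocity (tangent_atlas A) UNIV (\<lambda>\<epsilon>. velocity A {a..b} (V \<epsilon>) t) 0"

text \<open>The identity includes the existence of the derivative of the action at \<open>\<epsilon> = 0\<close>.\<close>

definition first_variation_formula ::
  "('q, 'e::real_normed_vector) chart set \<Rightarrow> (('q, 'e) tvec \<Rightarrow> real) \<Rightarrow>
   ((('q, 'e) tvec, 'e \<times> 'e) tvec \<Rightarrow> ('q, 'e) covec) \<Rightarrow>
   (('q, 'e) tvec \<Rightarrow> (('q, 'e) tvec, 'e \<times> 'e) covec) \<Rightarrow>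
   real \<Rightarrow> real \<Rightarrow> (real \<Rightarrow> 'q) \<Rightarrow> (real \<Rightarrow> real \<Rightarrow> 'q) \<Rightarrow> bool" where
  "first_variation_formula A L D \<theta> a b q V \<longleftrightarrow>
     ((\<lambda>\<epsilon>. action A L a b (V \<epsilon>)) has_real_derivative
        integral {a..b} (\<lambda>t. pairing (D (second_velocity A {a..b} q t)) (delta_q A V t))
        + (pairing (\<theta> (velocity A {a..b} q b)) (delta_q_hat A a b V b)
           - pairing (\<theta> (velocity A {a..b} q a)) (delta_q_hat A a b V a)))
      (at 0)"

end

theory Submission
  imports Defs
begin

text \<open>
  In a chart the Lagrangian is a function \<open>\<Lambda>(x, v)\<close>, a variation is a \<open>C\<^sup>2\<close> map \<open>g(\<epsilon>, t)\<close>, and the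
  first variation is integration by parts: because \<open>\<partial>\<^sub>\<epsilon> \<partial>\<^sub>t g = \<partial>\<^sub>t \<partial>\<^sub>\<epsilon> g\<close>, one has, for every single \<open>t\<close>,
  \<open>\<partial>\<^sub>\<epsilon> \<Lambda>(g, \<partial>\<^sub>t g) = E \<cdot> \<partial>\<^sub>\<epsilon> g + d/dt (\<partial>\<^sub>v \<Lambda> \<cdot> \<partial>\<^sub>\<epsilon> g)\<close>, where \<open>E = \<partial>\<^sub>x \<Lambda> - d/dt \<partial>\<^sub>v \<Lambda>\<close> is
  the Euler-Lagrange expression, with \<open>d/dt\<close> expanded by the chain rule
  (\<open>first_variation_in_coordinates\<close>).

  Existence. Two of the three terms of this pointwise identity make sense without charts: the left hand
  side, and the derivative of \<open>\<theta>\<^sub>L(dq/dt) \<cdot> \<delta>q^\<close>, where \<open>\<theta>\<^sub>L\<close> is the fibre derivative of \<open>L\<close> composed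
  with the projection \<open>TTQ \<rightarrow> TQ\<close>. Hence the third term does not depend on the chart either
  (\<open>euler_lagrange_in_chart_independent\<close>), which defines \<open>D\<^sub>E\<^sub>L L\<close> globally.
  Since the identity holds for each \<open>t\<close> in some chart around \<open>q(t)\<close>, it holds on all of \<open>[a, b]\<close>, and integrating it, with differentiation under the integral sign, gives the
  formula for the whole curve at once (\<open>first_variation\<close>). Smoothness is read off from the coordinate
  expressions.

  Uniqueness. Each second order vector is attained by a curve that is quadratic in a chart, and the
  integral term is tested against variations \<open>\<eta>(t) u\<close> of this curve, where the bump \<open>\<eta>\<close> vanishes to second
  order at both ends so that no boundary terms appear; continuity of \<open>D\<close> then gives the fundamental
  lemma of the calculus of variations (\<open>euler_lagrange_pairing_le\<close>). Once \<open>D\<close> is known, the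
  one-form is recovered at a prescribed vector of \<open>TTQ\<close> from a variation that attains this
  vector at one end and vanishes to second order at the other (\<open>lagrange_form_unique\<close>).
\<close>

section \<open>Calculus of maps of class \<open>C\<^sup>n\<close>\<close>

lemma C_nat_on_imp_continuous_on:
  assumes "C_nat_on n W g"
  shows "continuous_on W g"
proof (cases n)
  case 0
  then show ?thesis using assms by simp
next
  case (Suc m)
  then have "g differentiable (at x)" if "x \<in> W" for x using assms that by simp
  then show ?thesis
    by (meson continuous_at_imp_continuous_on differentiable_imp_continuous_within)
qed

lemma C_nat_on_subset: "C_nat_on n W g \<Longrightarrow> V \<subseteq> W \<Longrightarrow> C_nat_on n V g"
proof (induction n arbitrary: g)
  case 0
  then show ?case using continuous_on_subset by simp blast
next
  case (Suc n)
  have "C_nat_on n V (\<lambda>x. frechet_derivative g (at x) v)" for v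
    by (rule Suc.IH) (use Suc.prems in auto)
  then show ?case using Suc.prems by auto
qed

lemma C_nat_on_Suc_lower: "C_nat_on (Suc n) W g \<Longrightarrow> C_nat_on n W g"
proof (induction n arbitrary: g)
  case 0
  then show ?case using C_nat_on_imp_continuous_on[of "Suc 0" W g] by simp
next
  case (Suc n)
  have "C_nat_on n W (\<lambda>x. frechet_derivative g (at x) v)" for v
    by (rule Suc.IH) (use Suc.prems in simp)
  then show ?case using Suc.prems by simp
qed

lemma C_nat_on_lower:
  assumes "C_nat_on n W g" "m \<le> n"
  shows "C_nat_on m W g"
  using assms(2,1)
proof (induction rule: dec_induct)
  case (step i)
  from step.IH[OF C_nat_on_Suc_lower[OF step.prems]] show ?case .
qed

lemma C_nat_on_has_derivative:
  assumes "C_nat_on n W g" "0 < n" "x \<in> W"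
  shows "(g has_derivative frechet_derivative g (at x)) (at x)"
  using assms by (cases n) (auto simp: frechet_derivative_works[symmetric])

lemma C_nat_on_cong:
  assumes "open W" "\<And>x. x \<in> W \<Longrightarrow> f x = g x" "C_nat_on n W f"
  shows "C_nat_on n W g"
  using assms(2,3)
proof (induction n arbitrary: f g)
  case 0
  show ?case
    using "0.prems"(2) continuous_on_eq[of W f g, OF _ "0.prems"(1)] unfolding C_nat_on.simps by blast
next
  case (Suc n)
  have f: "f differentiable (at x)" if "x \<in> W" for x
    using Suc.prems(2) that unfolding C_nat_on.simps by blast
  show ?case
    unfolding C_nat_on.simps
  proof (intro conjI ballI allI)
    show "g differentiable (at x)" if "x \<in> W" for x
    proof -
      from f[OF that] obtain f' where "(f has_derivative f') (at x)" unfolding differentiable_def by blast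
      from has_derivative_transform_within_open[OF this assms(1) that Suc.prems(1)]
      show ?thesis unfolding differentiable_def by blast
    qed
    show "C_nat_on n W (\<lambda>x. frechet_derivative g (at x) v)" for v
    proof (rule Suc.IH)
      show "frechet_derivative f (at x) v = frechet_derivative g (at x) v" if "x \<in> W" for x
        using frechet_derivative_transform_within_open[OF f[OF that] assms(1) that Suc.prems(1)]
        by (rule fun_cong)
      show "C_nat_on n W (\<lambda>x. frechet_derivative f (at x) v)"
        using Suc.prems(2) unfolding C_nat_on.simps by blast
    qed
  qed
qed

lemma C_nat_on_SucI:
  assumes "open W"
    and der: "\<And>x. x \<in> W \<Longrightarrow> (g has_derivative g' x) (at x)"
    and cont: "\<And>v. C_nat_on n W (\<lambda>x. g' x v)"
  shows "C_nat_on (Suc n) W g"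
proof -
  have eq: "g' x = frechet_derivative g (at x)" if "x \<in> W" for x
    using frechet_derivative_at[OF der[OF that]] .
  have "C_nat_on n W (\<lambda>x. frechet_derivative g (at x) v)" for v
    by (rule C_nat_on_cong[OF assms(1) _ cont[of v]]) (simp add: eq)
  then show ?thesis using der by (auto simp: differentiable_def)
qed

lemma C_nat_on_locally:
  assumes "\<And>x. x \<in> W \<Longrightarrow> \<exists>V. open V \<and> x \<in> V \<and> C_nat_on n V f"
  shows "C_nat_on n W f"
  using assms
proof (induction n arbitrary: f)
  case 0
  then show ?case
    by (auto intro!: continuous_at_imp_continuous_on) (metis continuous_on_interior interior_open)
next
  case (Suc n)
  have "f differentiable (at x)" if "x \<in> W" for x
    using Suc.prems[OF that] by auto
  moreover have "C_nat_on n W (\<lambda>x. frechet_derivative f (at x) v)" for v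
    by (rule Suc.IH) (use Suc.prems in fastforce)
  ultimately show ?case by simp
qed

lemma C_nat_on_const: "C_nat_on n W (\<lambda>x. c)"
  by (induction n arbitrary: c) auto

lemma C_nat_on_bounded_linear:
  assumes "bounded_linear f"
  shows "C_nat_on n W f"
proof (cases n)
  case 0
  then show ?thesis
    by (simp add: assms linear_continuous_on)
next
  case (Suc m)
  have d: "(f has_derivative f) (at x)" for x
    using assms by (rule bounded_linear_imp_has_derivative)
  then have "frechet_derivative f (at x) = f" for x
    using frechet_derivative_at by metis
  then show ?thesis using Suc d C_nat_on_const by (auto simp: differentiable_def)
qed

lemma C_nat_on_add:
  assumes "open W" "C_nat_on n W f" "C_nat_on n W g"
  shows "C_nat_on n W (\<lambda>x. f x + g x)"
  using assms(2,3)
proof (induction n arbitrary: f g)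
  case 0
  then show ?case by (simp add: continuous_on_add)
next
  case (Suc n)
  show ?case
  proof (rule C_nat_on_SucI[OF assms(1)])
    show "((\<lambda>x. f x + g x) has_derivative
        (\<lambda>v. frechet_derivative f (at x) v + frechet_derivative g (at x) v)) (at x)" if "x \<in> W" for x
      using Suc.prems that by (intro derivative_intros C_nat_on_has_derivative) auto
    show "C_nat_on n W (\<lambda>x. frechet_derivative f (at x) v + frechet_derivative g (at x) v)" for v
      using Suc by simp
  qed
qed

lemma C_nat_on_sum:
  assumes "open W" "\<And>i. i \<in> I \<Longrightarrow> C_nat_on n W (f i)"
  shows "C_nat_on n W (\<lambda>x. \<Sum>i\<in>I. f i x)"
  using assms(2)
  by (induction I rule: infinite_finite_induct) (auto intro: C_nat_on_const C_nat_on_add[OF assms(1)])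

lemma C_nat_on_bilinear:
  assumes "open W" "bounded_bilinear mul" "C_nat_on n W f" "C_nat_on n W g"
  shows "C_nat_on n W (\<lambda>x. mul (f x) (g x))"
  using assms(3,4)
proof (induction n arbitrary: f g)
  case 0
  then show ?case using bounded_bilinear.continuous_on[OF assms(2)] by simp
next
  case (Suc n)
  show ?case
  proof (rule C_nat_on_SucI[OF assms(1)])
    show "((\<lambda>x. mul (f x) (g x)) has_derivative
        (\<lambda>v. mul (f x) (frechet_derivative g (at x) v) + mul (frechet_derivative f (at x) v) (g x))) (at x)"
      if "x \<in> W" for x
      using Suc.prems that
      by (intro bounded_bilinear.FDERIV[OF assms(2)] C_nat_on_has_derivative) auto
    show "C_nat_on n W (\<lambda>x. mul (f x) (frechet_derivative g (at x) v) + mul (frechet_derivative f (at x) v) (g x))" for v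
      using Suc C_nat_on_Suc_lower[OF Suc.prems(1)] C_nat_on_Suc_lower[OF Suc.prems(2)]
      by (intro C_nat_on_add[OF assms(1)]) auto
  qed
qed

lemmas C_nat_on_scaleR = C_nat_on_bilinear[OF _ bounded_bilinear_scaleR]

lemma linear_sum_Basis:
  fixes f :: "'a::euclidean_space \<Rightarrow> 'b::real_vector"
  assumes "linear f"
  shows "f v = (\<Sum>b\<in>Basis. (v \<bullet> b) *\<^sub>R f b)"
proof -
  have "f v = f (\<Sum>b\<in>Basis. (v \<bullet> b) *\<^sub>R b)" by (simp add: euclidean_representation)
  also have "\<dots> = (\<Sum>b\<in>Basis. (v \<bullet> b) *\<^sub>R f b)"
    by (simp add: linear_sum[OF assms] linear_scale[OF assms])
  finally show ?thesis .
qed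

lemma frechet_derivative_sum_Basis:
  fixes g :: "'a::euclidean_space \<Rightarrow> 'b::real_normed_vector"
  assumes "g differentiable (at x)"
  shows "frechet_derivative g (at x) v = (\<Sum>b\<in>Basis. (v \<bullet> b) *\<^sub>R frechet_derivative g (at x) b)"
  by (rule linear_sum_Basis) (use assms linear_frechet_derivative in auto)

text \<open>The chain rule evaluates the derivative of \<open>g\<close> in the moving direction \<open>Df(x) v\<close>, whereas \<open>C_nat_on\<close>
  controls derivatives in fixed directions only. Expanding the moving direction in the basis of the
  finite-dimensional intermediate space brings the induction hypothesis into play.\<close>

lemma C_nat_on_compose:
  fixes g :: "'b::euclidean_space \<Rightarrow> 'c::real_normed_vector"
  assumes "open U" "C_nat_on n W g" "C_nat_on n U f" "f ` U \<subseteq> W"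
  shows "C_nat_on n U (\<lambda>x. g (f x))"
  using assms(2,3)
proof (induction n arbitrary: g)
  case 0
  then show ?case using assms(4) continuous_on_compose2 by fastforce
next
  case (Suc n)
  have gd: "g differentiable (at (f x))" if "x \<in> U" for x
    using Suc.prems(1) assms(4) that by auto
  show ?case
  proof (rule C_nat_on_SucI[OF assms(1)])
    show "((\<lambda>x. g (f x)) has_derivative
        (\<lambda>v. \<Sum>b\<in>Basis. (frechet_derivative f (at x) v \<bullet> b) *\<^sub>R frechet_derivative g (at (f x)) b)) (at x)"
      if "x \<in> U" for x
    proof -
      have "((g \<circ> f) has_derivative (frechet_derivative g (at (f x)) \<circ> frechet_derivative f (at x))) (at x)"
        using Suc.prems that assms(4) by (intro diff_chain_at C_nat_on_has_derivative[of "Suc n"]) auto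
      moreover have "frechet_derivative g (at (f x)) \<circ> frechet_derivative f (at x) =
        (\<lambda>v. \<Sum>b\<in>Basis. (frechet_derivative f (at x) v \<bullet> b) *\<^sub>R frechet_derivative g (at (f x)) b)"
        unfolding o_def using frechet_derivative_sum_Basis[OF gd[OF that]] by metis
      ultimately show ?thesis by (simp add: o_def)
    qed
    show "C_nat_on n U (\<lambda>x. \<Sum>b\<in>Basis. (frechet_derivative f (at x) v \<bullet> b) *\<^sub>R frechet_derivative g (at (f x)) b)" for v
    proof (intro C_nat_on_sum C_nat_on_scaleR assms(1))
      fix b :: 'b
      show "C_nat_on n U (\<lambda>x. frechet_derivative g (at (f x)) b)"
        using Suc.IH[of "\<lambda>x. frechet_derivative g (at x) b"] Suc.prems C_nat_on_Suc_lower[OF Suc.prems(2)] by simp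
      have "C_nat_on n U (\<lambda>x. frechet_derivative f (at x) v)" using Suc.prems by simp
      then show "C_nat_on n U (\<lambda>x. frechet_derivative f (at x) v \<bullet> b)"
        by (rule C_nat_on_bilinear[OF assms(1) bounded_bilinear_inner _ C_nat_on_const])
    qed
  qed
qed

lemma C_nat_on_linear_compose:
  fixes f :: "'a::real_normed_vector \<Rightarrow> 'b::euclidean_space"
  assumes "open U" "bounded_linear h" "C_nat_on n U f"
  shows "C_nat_on n U (\<lambda>x. h (f x))"
  by (rule C_nat_on_compose[OF assms(1) C_nat_on_bounded_linear[OF assms(2), of _ UNIV] assms(3)]) simp

lemma C_nat_on_Pair:
  fixes f :: "'a::real_normed_vector \<Rightarrow> 'b::euclidean_space" and g :: "'a \<Rightarrow> 'c::euclidean_space"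
  assumes "open U" "C_nat_on n U f" "C_nat_on n U g"
  shows "C_nat_on n U (\<lambda>x. (f x, g x))"
proof -
  have "C_nat_on n U (\<lambda>x. (f x, 0) + (0, g x))"
  proof (rule C_nat_on_add[OF assms(1)])
    have "bounded_linear (\<lambda>x::'b. (x, 0::'c))" by (intro bounded_linear_intros)
    from C_nat_on_linear_compose[OF assms(1) this assms(2)] show "C_nat_on n U (\<lambda>x. (f x, 0::'c))" .
    have "bounded_linear (\<lambda>x::'c. (0::'b, x))" by (intro bounded_linear_intros)
    from C_nat_on_linear_compose[OF assms(1) this assms(3)] show "C_nat_on n U (\<lambda>x. (0::'b, g x))" .
  qed
  then show ?thesis by simp
qed

lemma C_nat_on_fst: "C_nat_on n U fst" and C_nat_on_snd: "C_nat_on n U snd"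
  by (rule C_nat_on_bounded_linear, rule bounded_linear_fst bounded_linear_snd)+

lemma C_nat_on_ident: "C_nat_on n U (\<lambda>x. x)"
  by (rule C_nat_on_bounded_linear) (rule bounded_linear_ident)

text \<open>The directional derivative is of class \<open>C\<^sup>n\<close> jointly in the point and in the direction, because
  it is linear in the direction.\<close>

lemma C_nat_on_frechet_derivative:
  fixes g :: "'b::euclidean_space \<Rightarrow> 'c::real_normed_vector"
  assumes "open U" "C_nat_on (Suc n) W g" "C_nat_on n U f" "C_nat_on n U h" "f ` U \<subseteq> W"
  shows "C_nat_on n U (\<lambda>x. frechet_derivative g (at (f x)) (h x))"
proof (rule C_nat_on_cong[OF assms(1)])
  show "(\<Sum>b\<in>Basis. (h x \<bullet> b) *\<^sub>R frechet_derivative g (at (f x)) b) = frechet_derivative g (at (f x)) (h x)"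
    if "x \<in> U" for x
    using frechet_derivative_sum_Basis[of g "f x" "h x"] assms(2,5) that by auto
  show "C_nat_on n U (\<lambda>x. \<Sum>b\<in>Basis. (h x \<bullet> b) *\<^sub>R frechet_derivative g (at (f x)) b)"
  proof (intro C_nat_on_sum C_nat_on_scaleR assms(1))
    fix b :: 'b
    show "C_nat_on n U (\<lambda>x. h x \<bullet> b)"
      by (rule C_nat_on_bilinear[OF assms(1) bounded_bilinear_inner assms(4) C_nat_on_const])
    show "C_nat_on n U (\<lambda>x. frechet_derivative g (at (f x)) b)"
      by (rule C_nat_on_compose[OF assms(1) _ assms(3,5)]) (use assms(2) in simp)
  qed
qed

lemma C_nat_on_inv_image_open:
  assumes "open U" "C_nat_on n U f" "open W"
  shows "open (U \<inter> f -` W)"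
  using continuous_open_preimage[OF C_nat_on_imp_continuous_on[OF assms(2)] assms(1,3)] .


lemma C_onD: "C_on r W g \<Longrightarrow> enat n \<le> r \<Longrightarrow> C_nat_on n W g"
  by (simp add: C_on_def)

lemma C_on_subset: "C_on r W g \<Longrightarrow> V \<subseteq> W \<Longrightarrow> C_on r V g"
  unfolding C_on_def using C_nat_on_subset by blast

text \<open>All variations in the theorem are of class \<open>C\<^sup>2\<close>; this passes to the recursive form of that condition.\<close>

lemma C_on_2_iff: "C_on 2 W g \<longleftrightarrow> C_nat_on 2 W g"
proof
  have "enat 2 = 2" by (simp add: numeral_eq_enat)
  then show "C_nat_on 2 W g" if "C_on 2 W g" using C_onD[OF that, of 2] by simp
  show "C_on 2 W g" if "C_nat_on 2 W g"
    unfolding C_on_def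
  proof (intro allI impI)
    fix n assume "enat n \<le> 2"
    then have "n \<le> 2" using \<open>enat 2 = 2\<close> by (metis enat_ord_simps(1))
    then show "C_nat_on n W g" using that C_nat_on_lower by blast
  qed
qed

lemma C_on_compose:
  fixes g :: "'b::euclidean_space \<Rightarrow> 'c::real_normed_vector"
  assumes "open U" "C_on r W g" "C_on r U f" "f ` U \<subseteq> W"
  shows "C_on r U (\<lambda>x. g (f x))"
  using assms C_nat_on_compose unfolding C_on_def by blast

lemma C_on_infinity_imp: "C_on \<infinity> W g \<Longrightarrow> C_on r W g"
  by (simp add: C_on_def)

subsection \<open>Derivatives along curves and in two real variables\<close>

lemma C_nat_on_vector_derivative_compose:
  assumes "C_nat_on n W g" "0 < n" "f x \<in> W" "(f has_vector_derivative d) (at x within S)"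
  shows "((\<lambda>x. g (f x)) has_vector_derivative frechet_derivative g (at (f x)) d) (at x within S)"
proof -
  have g: "(g has_derivative frechet_derivative g (at (f x))) (at (f x))"
    using assms C_nat_on_has_derivative by blast
  show ?thesis
    using vector_derivative_diff_chain_within[OF assms(4) has_derivative_at_withinI[OF g]]
    by (simp add: o_def)
qed

lemma C_nat_on_partial_derivatives:
  fixes g :: "real \<times> real \<Rightarrow> 'b::real_normed_vector"
  assumes "C_nat_on n W g" "0 < n" "(e, t) \<in> W"
  shows "((\<lambda>e. g (e, t)) has_vector_derivative frechet_derivative g (at (e, t)) (1, 0)) (at e within S)"
    and "((\<lambda>t. g (e, t)) has_vector_derivative frechet_derivative g (at (e, t)) (0, 1)) (at t within S)"
proof -
  have 1: "((\<lambda>e. (e, t)) has_vector_derivative (1, 0)) (at e within S)"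
    by (auto intro!: derivative_eq_intros simp: has_vector_derivative_def fun_eq_iff)
  have 2: "((\<lambda>t. (e, t)) has_vector_derivative (0, 1)) (at t within S)"
    by (auto intro!: derivative_eq_intros simp: has_vector_derivative_def fun_eq_iff)
  show "((\<lambda>e. g (e, t)) has_vector_derivative frechet_derivative g (at (e, t)) (1, 0)) (at e within S)"
    by (rule C_nat_on_vector_derivative_compose[OF assms(1,2) _ 1]) (rule assms)
  show "((\<lambda>t. g (e, t)) has_vector_derivative frechet_derivative g (at (e, t)) (0, 1)) (at t within S)"
    by (rule C_nat_on_vector_derivative_compose[OF assms(1,2) _ 2]) (rule assms)
qed

text \<open>Symmetry of the mixed second partial derivatives. Integrating \<open>\<partial>\<^sub>t g\<close> in \<open>t\<close> and differentiating
  under the integral sign shows that \<open>\<partial>\<^sub>\<epsilon> g\<close> is, up to a constant in \<open>t\<close>, an integral of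
  \<open>\<partial>\<^sub>\<epsilon> \<partial>\<^sub>t g\<close>.\<close>

lemma C2_mixed_partials:
  fixes g :: "real \<times> real \<Rightarrow> 'b::euclidean_space"
  assumes "open W" "C_nat_on 2 W g" "(e, t) \<in> W"
  shows "frechet_derivative (\<lambda>z. frechet_derivative g (at z) (0, 1)) (at (e, t)) (1, 0) =
         frechet_derivative (\<lambda>z. frechet_derivative g (at z) (1, 0)) (at (e, t)) (0, 1)"
proof -
  define ge where "ge = (\<lambda>z. frechet_derivative g (at z) (1, 0))"
  define gt where "gt = (\<lambda>z. frechet_derivative g (at z) (0, 1))"
  have ge: "C_nat_on 1 W ge" and gt: "C_nat_on 1 W gt"
    using assms(2) by (simp_all add: ge_def gt_def numeral_2_eq_2)
  define gte where "gte = (\<lambda>z. frechet_derivative gt (at z) (1, 0))"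
  have gte: "continuous_on W gte" using gt by (simp add: gte_def)
  obtain r where r: "r > 0" "cball (e, t) r \<subseteq> W"
    using assms open_contains_cball by blast
  define U where "U = {e - r/2 .. e + r/2}"
  define a where "a = t - r/2"
  define b where "b = t + r/2"
  have box: "U \<times> {a..b} \<subseteq> W"
  proof
    fix z assume z: "z \<in> U \<times> {a..b}"
    obtain x y where xy: "z = (x, y)" by fastforce
    have "dist (e, t) z \<le> dist e x + dist t y"
      unfolding xy dist_Pair_Pair using sqrt_sum_squares_le_sum by auto
    also have "\<dots> \<le> r" using z xy by (auto simp: U_def a_def b_def dist_real_def)
    finally show "z \<in> W" using r(2) by auto
  qed
  have eU: "e \<in> U" using r(1) by (simp add: U_def)
  have ftc: "((\<lambda>s. gt (x, s)) has_integral g (x, s) - g (x, a)) {a..s}" if "x \<in> U" "s \<in> {a..b}" for x s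
    unfolding gt_def
    by (rule fundamental_theorem_of_calculus)
       (use that box assms(2) in \<open>auto intro!: C_nat_on_partial_derivatives(2)[of 2 W]\<close>)
  have leib: "ge (e, s) - ge (e, a) = integral {a..s} (\<lambda>s. gte (e, s))" if s: "s \<in> {a..b}" for s
  proof -
    have leib0: "((\<lambda>x. integral (cbox a s) (\<lambda>s. gt (x, s))) has_vector_derivative
        integral (cbox a s) (\<lambda>s. gte (e, s))) (at e within U)"
    proof (rule leibniz_rule_vector_derivative[where fx = "\<lambda>x s. gte (x, s)", OF _ _ _ eU])
      show "((\<lambda>x. gt (x, t)) has_vector_derivative gte (x, t)) (at x within U)"
        if "x \<in> U" "t \<in> cbox a s" for x t
        unfolding gte_def
        by (rule C_nat_on_partial_derivatives(1)[OF gt]) (use that box s in auto)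
      show "(\<lambda>s. gt (x, s)) integrable_on cbox a s" if "x \<in> U" for x
        using ftc[OF that s] by (auto simp: integrable_on_def)
      show "continuous_on (U \<times> cbox a s) (\<lambda>(x, t). gte (x, t))"
        using continuous_on_subset[OF gte] subset_trans[OF Sigma_mono box] s
        by (simp add: case_prod_unfold)
      show "convex U" by (simp add: U_def)
    qed
    have int_eq: "integral (cbox a s) (\<lambda>s. gt (x, s)) = g (x, s) - g (x, a)" if "x \<in> U" for x
      using ftc[OF that s] by (simp add: integral_unique)
    have 1: "((\<lambda>x. g (x, s) - g (x, a)) has_vector_derivative
        integral {a..s} (\<lambda>s. gte (e, s))) (at e within U)"
      using has_vector_derivative_transform[OF eU int_eq[symmetric] leib0] by simp
    have 2: "((\<lambda>x. g (x, s) - g (x, a)) has_vector_derivative ge (e, s) - ge (e, a)) (at e within U)"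
      unfolding ge_def
      by (intro has_vector_derivative_diff C_nat_on_partial_derivatives(1)[OF assms(2)])
         (use box eU s in auto)
    show ?thesis
      using vector_derivative_unique_within[OF _ 2 1] r(1) by (simp add: U_def at_within_Icc_at)
  qed
  have tab: "t \<in> {a..b}" using r(1) by (simp add: a_def b_def)
  have "((\<lambda>u. integral {a..u} (\<lambda>s. gte (e, s))) has_vector_derivative gte (e, t)) (at t within {a..b})"
  proof (rule integral_has_vector_derivative[OF _ tab])
    show "continuous_on {a..b} (\<lambda>s. gte (e, s))"
      by (rule continuous_on_compose2[OF gte]) (use box eU in \<open>auto intro!: continuous_intros\<close>)
  qed
  then have 1: "((\<lambda>s. ge (e, s) - ge (e, a)) has_vector_derivative gte (e, t)) (at t within {a..b})"
    by (rule has_vector_derivative_transform[OF tab leib, rotated])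
  have 2: "((\<lambda>s. ge (e, s) - ge (e, a)) has_vector_derivative
      frechet_derivative ge (at (e, t)) (0, 1) - 0) (at t within {a..b})"
    by (intro has_vector_derivative_diff C_nat_on_partial_derivatives(2)[OF ge])
       (use assms in auto)
  have "at t within {a..b} \<noteq> bot" using r(1) by (simp add: a_def b_def at_within_Icc_at)
  then show ?thesis
    using vector_derivative_unique_within[OF _ 1 2] by (simp add: gte_def gt_def ge_def)
qed

section \<open>Smooth atlases and their tangent atlases\<close>

abbreviation chart_img :: "('q, 'e) chart \<Rightarrow> 'e set" where
  "chart_img \<phi> \<equiv> chart_map \<phi> ` chart_dom \<phi>"

text \<open>The derivative of the change of charts, by which components of tangent vectors at \<open>p\<close> transform.\<close>

abbreviation dtrans :: "('q, 'e::real_normed_vector) chart \<Rightarrow> ('q, 'e) chart \<Rightarrow> 'q \<Rightarrow> 'e \<Rightarrow> 'e" where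
  "dtrans \<phi> \<psi> p \<equiv> frechet_derivative (transition \<phi> \<psi>) (at (chart_map \<phi> p))"

text \<open>What is left of a smooth manifold when its topology is forgotten. These three properties are inherited
  by the tangent atlas, so everything proved here applies to \<open>Q\<close>, \<open>TQ\<close> and \<open>TTQ\<close> alike.\<close>

locale smooth_atlas =
  fixes A :: "('q, 'e::euclidean_space) chart set"
  assumes inj_chart: "\<phi> \<in> A \<Longrightarrow> inj_on (chart_map \<phi>) (chart_dom \<phi>)"
    and open_overlap: "\<phi> \<in> A \<Longrightarrow> \<psi> \<in> A \<Longrightarrow> open (chart_map \<phi> ` (chart_dom \<phi> \<inter> chart_dom \<psi>))"
    and smooth_transition: "\<phi> \<in> A \<Longrightarrow> \<psi> \<in> A \<Longrightarrow>
      C_on \<infinity> (chart_map \<phi> ` (chart_dom \<phi> \<inter> chart_dom \<psi>)) (transition \<phi> \<psi>)"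

lemma smooth_manifold_imp_smooth_atlas:
  assumes "smooth_manifold X A"
  shows "smooth_atlas A"
proof
  fix \<phi> \<psi> assume \<phi>: "\<phi> \<in> A" and \<psi>: "\<psi> \<in> A"
  have charts: "\<forall>\<phi>\<in>A. openin X (chart_dom \<phi>) \<and> open (chart_img \<phi>) \<and>
      homeomorphic_map (subtopology X (chart_dom \<phi>)) (top_of_set (chart_img \<phi>)) (chart_map \<phi>)"
    and trans: "\<forall>\<phi>\<in>A. \<forall>\<psi>\<in>A.
      C_on \<infinity> (chart_map \<phi> ` (chart_dom \<phi> \<inter> chart_dom \<psi>)) (transition \<phi> \<psi>)"
    using assms unfolding smooth_manifold_def by - (elim conjE, assumption)+
  have hom: "homeomorphic_map (subtopology X (chart_dom \<phi>)) (top_of_set (chart_img \<phi>)) (chart_map \<phi>)"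
    and o: "openin X (chart_dom \<phi>)" "openin X (chart_dom \<psi>)" "open (chart_img \<phi>)"
    using bspec[OF charts \<phi>] bspec[OF charts \<psi>] by - (elim conjE, assumption)+
  have "topspace (subtopology X (chart_dom \<phi>)) = chart_dom \<phi>"
    using o(1) openin_subset by fastforce
  then show "inj_on (chart_map \<phi>) (chart_dom \<phi>)"
    using homeomorphic_imp_injective_map[OF hom] by simp
  have "openin (subtopology X (chart_dom \<phi>)) (chart_dom \<phi> \<inter> chart_dom \<psi>)"
    using o by (simp add: openin_subtopology_Int2)
  then have "openin (top_of_set (chart_img \<phi>)) (chart_map \<phi> ` (chart_dom \<phi> \<inter> chart_dom \<psi>))"
    using homeomorphic_imp_open_map[OF hom] unfolding open_map_def by blast
  then show "open (chart_map \<phi> ` (chart_dom \<phi> \<inter> chart_dom \<psi>))"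
    using o(3) openin_open_trans by blast
  show "C_on \<infinity> (chart_map \<phi> ` (chart_dom \<phi> \<inter> chart_dom \<psi>)) (transition \<phi> \<psi>)"
    using trans \<phi> \<psi> by blast
qed

context smooth_atlas
begin

lemma open_chart_img: "\<phi> \<in> A \<Longrightarrow> open (chart_img \<phi>)"
  using open_overlap[of \<phi> \<phi>] by simp

lemma chart_inv_map: "\<phi> \<in> A \<Longrightarrow> p \<in> chart_dom \<phi> \<Longrightarrow> chart_inv \<phi> (chart_map \<phi> p) = p"
  by (simp add: chart_inv_def inj_chart inv_into_f_f)

lemma chart_inv_in: "x \<in> chart_img \<phi> \<Longrightarrow> chart_inv \<phi> x \<in> chart_dom \<phi>"
  by (simp add: chart_inv_def inv_into_into)

lemma chart_map_inv: "x \<in> chart_img \<phi> \<Longrightarrow> chart_map \<phi> (chart_inv \<phi> x) = x"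
  by (simp add: chart_inv_def f_inv_into_f)

lemma transition_chart: "\<phi> \<in> A \<Longrightarrow> p \<in> chart_dom \<phi> \<Longrightarrow> transition \<phi> \<psi> (chart_map \<phi> p) = chart_map \<psi> p"
  by (simp add: transition_def chart_inv_map)

lemma C_nat_on_transition:
  "\<phi> \<in> A \<Longrightarrow> \<psi> \<in> A \<Longrightarrow> C_nat_on n (chart_map \<phi> ` (chart_dom \<phi> \<inter> chart_dom \<psi>)) (transition \<phi> \<psi>)"
  by (rule C_onD[OF smooth_transition]) auto

lemma transition_has_derivative:
  assumes "\<phi> \<in> A" "\<psi> \<in> A" "p \<in> chart_dom \<phi>" "p \<in> chart_dom \<psi>"
  shows "(transition \<phi> \<psi> has_derivative dtrans \<phi> \<psi> p) (at (chart_map \<phi> p))"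
  by (rule C_nat_on_has_derivative[OF C_nat_on_transition[OF assms(1,2), of 1]]) (use assms in auto)

lemma linear_dtrans:
  assumes "\<phi> \<in> A" "\<psi> \<in> A" "p \<in> chart_dom \<phi>" "p \<in> chart_dom \<psi>"
  shows "linear (dtrans \<phi> \<psi> p)"
  using transition_has_derivative[OF assms] has_derivative_linear by blast

lemma dtrans_self:
  assumes "\<phi> \<in> A" "p \<in> chart_dom \<phi>"
  shows "dtrans \<phi> \<phi> p e = e"
proof -
  have "((\<lambda>x. x) has_derivative (\<lambda>e. e)) (at (chart_map \<phi> p))" by (rule has_derivative_ident)
  then have "(transition \<phi> \<phi> has_derivative (\<lambda>e. e)) (at (chart_map \<phi> p))"
    by (rule has_derivative_transform_within_open[OF _ open_chart_img])
       (use assms transition_chart in auto)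
  then show ?thesis using frechet_derivative_at by metis
qed

lemma dtrans_compose:
  assumes "\<phi> \<in> A" "\<psi> \<in> A" "\<xi> \<in> A" "p \<in> chart_dom \<phi>" "p \<in> chart_dom \<psi>" "p \<in> chart_dom \<xi>"
  shows "dtrans \<psi> \<xi> p (dtrans \<phi> \<psi> p e) = dtrans \<phi> \<xi> p e"
proof -
  have "(transition \<psi> \<xi> has_derivative dtrans \<psi> \<xi> p) (at (transition \<phi> \<psi> (chart_map \<phi> p)))"
    using transition_has_derivative[of \<psi> \<xi> p] assms transition_chart[of \<phi> p \<psi>] by simp
  then have "(transition \<psi> \<xi> \<circ> transition \<phi> \<psi> has_derivative dtrans \<psi> \<xi> p \<circ> dtrans \<phi> \<psi> p)
      (at (chart_map \<phi> p))"
    using transition_has_derivative[of \<phi> \<psi> p] assms diff_chain_at by blast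
  then have "(transition \<phi> \<xi> has_derivative dtrans \<psi> \<xi> p \<circ> dtrans \<phi> \<psi> p) (at (chart_map \<phi> p))"
    by (rule has_derivative_transform_within_open[OF _ open_overlap[of \<phi> \<psi>]])
       (use assms transition_chart in auto)
  then have "dtrans \<psi> \<xi> p \<circ> dtrans \<phi> \<psi> p = dtrans \<phi> \<xi> p"
    by (rule frechet_derivative_at)
  then show ?thesis by (metis comp_apply)
qed

subsection \<open>Tangent vectors given by their component in one chart\<close>

lemma base_chart_vec: "base (chart_vec A \<phi> p e) = p"
  by (simp add: chart_vec_def)

lemma component_chart_vec:
  "\<psi> \<in> A \<Longrightarrow> p \<in> chart_dom \<psi> \<Longrightarrow> component (chart_vec A \<phi> p e) \<psi> = dtrans \<phi> \<psi> p e"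
  by (simp add: chart_vec_def)

lemma component_chart_vec_self:
  "\<phi> \<in> A \<Longrightarrow> p \<in> chart_dom \<phi> \<Longrightarrow> component (chart_vec A \<phi> p e) \<phi> = e"
  by (simp add: component_chart_vec dtrans_self)

lemma chart_vec_in_tangent_space:
  assumes "\<phi> \<in> A" "p \<in> chart_dom \<phi>"
  shows "chart_vec A \<phi> p e \<in> tangent_space A p"
  using assms dtrans_compose[of \<phi>] by (auto simp: tangent_space_def chart_vec_def)

lemma in_carrier: "\<phi> \<in> A \<Longrightarrow> p \<in> chart_dom \<phi> \<Longrightarrow> p \<in> carrier A"
  by (auto simp: carrier_def)

lemma chart_vec_in_tangent_bundle:
  "\<phi> \<in> A \<Longrightarrow> p \<in> chart_dom \<phi> \<Longrightarrow> chart_vec A \<phi> p e \<in> tangent_bundle A"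
  unfolding tangent_bundle_def using chart_vec_in_tangent_space in_carrier by blast

lemma tangent_bundle_iff: "v \<in> tangent_bundle A \<longleftrightarrow> base v \<in> carrier A \<and> v \<in> tangent_space A (base v)"
  by (auto simp: tangent_bundle_def tangent_space_def)

lemma base_tangent_space: "v \<in> tangent_space A p \<Longrightarrow> base v = p"
  by (simp add: tangent_space_def)

lemma tangent_space_eq_chart_vec:
  assumes "v \<in> tangent_space A p" "\<phi> \<in> A" "p \<in> chart_dom \<phi>"
  shows "v = chart_vec A \<phi> p (component v \<phi>)"
proof (rule tvec.expand, intro conjI)
  show "component v = component (chart_vec A \<phi> p (component v \<phi>))"
  proof
    fix \<psi>
    have "component v \<psi> = 0" if "\<not> (\<psi> \<in> A \<and> p \<in> chart_dom \<psi>)"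
      using assms(1) that unfolding tangent_space_def by blast
    moreover have "component v \<psi> = dtrans \<phi> \<psi> p (component v \<phi>)" if "\<psi> \<in> A" "p \<in> chart_dom \<psi>"
      using assms that unfolding tangent_space_def by blast
    ultimately show "component v \<psi> = component (chart_vec A \<phi> p (component v \<phi>)) \<psi>"
      by (simp add: chart_vec_def)
  qed
qed (use assms in \<open>simp add: base_chart_vec base_tangent_space\<close>)

lemma tangent_bundle_eq_chart_vec:
  assumes "v \<in> tangent_bundle A" "\<phi> \<in> A" "base v \<in> chart_dom \<phi>"
  shows "v = chart_vec A \<phi> (base v) (component v \<phi>)"
  using assms tangent_space_eq_chart_vec by (simp add: tangent_bundle_iff)

lemma chart_vec_change:
  assumes "\<phi> \<in> A" "\<psi> \<in> A" "p \<in> chart_dom \<phi>" "p \<in> chart_dom \<psi>"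
  shows "chart_vec A \<phi> p e = chart_vec A \<psi> p (dtrans \<phi> \<psi> p e)"
  using tangent_space_eq_chart_vec[OF chart_vec_in_tangent_space[of \<phi> p e], of \<psi>] assms
  by (simp add: component_chart_vec)

lemma chart_vec_add:
  assumes "\<phi> \<in> A" "p \<in> chart_dom \<phi>"
  shows "tvec_add (chart_vec A \<phi> p e) (chart_vec A \<phi> p e') = chart_vec A \<phi> p (e + e')"
  using assms linear_dtrans[of \<phi>]
  by (auto simp: tvec_add_def chart_vec_def fun_eq_iff linear_add)

lemma chart_vec_scale:
  assumes "\<phi> \<in> A" "p \<in> chart_dom \<phi>"
  shows "tvec_scale c (chart_vec A \<phi> p e) = chart_vec A \<phi> p (c *\<^sub>R e)"
  using assms linear_dtrans[of \<phi>]
  by (auto simp: tvec_scale_def chart_vec_def fun_eq_iff linear_scale)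

lemma component_add:
  "component (tvec_add v w) \<phi> = component v \<phi> + component w \<phi>"
  "component (tvec_scale c v) \<phi> = c *\<^sub>R component v \<phi>"
  by (simp_all add: tvec_add_def tvec_scale_def)

lemma linear_pairing_chart_vec:
  assumes "\<alpha> \<in> cotangent_space A p" "\<phi> \<in> A" "p \<in> chart_dom \<phi>"
  shows "linear (\<lambda>e. pairing \<alpha> (chart_vec A \<phi> p e))"
proof (rule linearI)
  note t = chart_vec_in_tangent_space[OF assms(2,3)]
  have add: "pairing \<alpha> (tvec_add v w) = pairing \<alpha> v + pairing \<alpha> w"
    and scale: "pairing \<alpha> (tvec_scale c v) = c * pairing \<alpha> v"
    if "v \<in> tangent_space A p" "w \<in> tangent_space A p" for v w c
    using assms(1) that by (auto simp: cotangent_space_def)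
  show "pairing \<alpha> (chart_vec A \<phi> p (e + e')) = pairing \<alpha> (chart_vec A \<phi> p e) + pairing \<alpha> (chart_vec A \<phi> p e')" for e e'
    using add[OF t t] by (simp add: chart_vec_add[OF assms(2,3)])
  show "pairing \<alpha> (chart_vec A \<phi> p (r *\<^sub>R e)) = r *\<^sub>R pairing \<alpha> (chart_vec A \<phi> p e)" for r e
    using scale[OF t t] by (simp add: chart_vec_scale[OF assms(2,3)])
qed

text \<open>Linearity in a single chart suffices, since components in that chart determine a tangent vector and
  respect its linear structure. Restricting \<open>F\<close> is the normalisation built into cotangent spaces.\<close>

lemma covec_in_cotangent_space:
  assumes "\<phi> \<in> A" "p \<in> chart_dom \<phi>" "linear f"
    and "\<And>v. v \<in> tangent_space A p \<Longrightarrow> F v = f (component v \<phi>)"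
  shows "Covec p (restrict F (tangent_space A p)) \<in> cotangent_space A p"
proof -
  have "tvec_add v w \<in> tangent_space A p" "tvec_scale c v \<in> tangent_space A p"
    if v: "v \<in> tangent_space A p" and w: "w \<in> tangent_space A p" for v w c
    using chart_vec_in_tangent_space[OF assms(1,2)] chart_vec_add[OF assms(1,2)] chart_vec_scale[OF assms(1,2)]
      tangent_space_eq_chart_vec[OF v assms(1,2)] tangent_space_eq_chart_vec[OF w assms(1,2)]
    by metis+
  then show ?thesis
    using assms(3,4) by (auto simp: cotangent_space_def component_add linear_add linear_scale)
qed

lemma covec_eqI:
  assumes "\<alpha> \<in> cotangent_space A p" "\<beta> \<in> cotangent_space A p"
    and "\<And>v. v \<in> tangent_space A p \<Longrightarrow> pairing \<alpha> v = pairing \<beta> v"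
  shows "\<alpha> = \<beta>"
  using assms by (intro covec.expand conjI extensionalityI[of _ "tangent_space A p"]) (auto simp: cotangent_space_def)

subsection \<open>The tangent atlas is again a smooth atlas\<close>

lemma chart_dom_tangent_chart:
  "chart_dom (tangent_chart A \<phi>) = {v \<in> tangent_bundle A. base v \<in> chart_dom \<phi>}"
  by (simp add: tangent_chart_def)

lemma chart_map_tangent_chart: "chart_map (tangent_chart A \<phi>) v = (chart_map \<phi> (base v), component v \<phi>)"
  by (simp add: tangent_chart_def)

lemma chart_vec_in_tangent_chart:
  "\<phi> \<in> A \<Longrightarrow> p \<in> chart_dom \<phi> \<Longrightarrow> chart_vec A \<phi> p e \<in> chart_dom (tangent_chart A \<phi>)"
  by (simp add: chart_dom_tangent_chart base_chart_vec chart_vec_in_tangent_bundle)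

lemma inj_tangent_chart:
  assumes "\<phi> \<in> A"
  shows "inj_on (chart_map (tangent_chart A \<phi>)) (chart_dom (tangent_chart A \<phi>))"
proof (rule inj_onI)
  fix v w
  assume v: "v \<in> chart_dom (tangent_chart A \<phi>)" and w: "w \<in> chart_dom (tangent_chart A \<phi>)"
    and "chart_map (tangent_chart A \<phi>) v = chart_map (tangent_chart A \<phi>) w"
  then have "base v = base w" "component v \<phi> = component w \<phi>"
    using inj_onD[OF inj_chart[OF assms]] by (auto simp: chart_dom_tangent_chart chart_map_tangent_chart)
  then show "v = w"
    using tangent_bundle_eq_chart_vec[of v \<phi>] tangent_bundle_eq_chart_vec[of w \<phi>] v w assms
    by (simp add: chart_dom_tangent_chart)
qed

lemma tangent_overlap_img:
  assumes "\<phi> \<in> A" "\<psi> \<in> A"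
  shows "chart_map (tangent_chart A \<phi>) ` (chart_dom (tangent_chart A \<phi>) \<inter> chart_dom (tangent_chart A \<psi>)) =
    chart_map \<phi> ` (chart_dom \<phi> \<inter> chart_dom \<psi>) \<times> UNIV" (is "?L = ?R")
proof
  show "?L \<subseteq> ?R" by (auto simp: chart_dom_tangent_chart chart_map_tangent_chart)
  show "?R \<subseteq> ?L"
  proof
    fix z assume "z \<in> ?R"
    then obtain p e where z: "z = (chart_map \<phi> p, e)" and p: "p \<in> chart_dom \<phi> \<inter> chart_dom \<psi>" by auto
    then have "z = chart_map (tangent_chart A \<phi>) (chart_vec A \<phi> p e)"
      using assms by (simp add: chart_map_tangent_chart base_chart_vec component_chart_vec_self)
    moreover have "chart_vec A \<phi> p e \<in> chart_dom (tangent_chart A \<phi>) \<inter> chart_dom (tangent_chart A \<psi>)"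
      using p assms by (simp add: chart_dom_tangent_chart base_chart_vec chart_vec_in_tangent_bundle)
    ultimately show "z \<in> ?L" by blast
  qed
qed

lemma chart_img_tangent_chart: "\<phi> \<in> A \<Longrightarrow> chart_img (tangent_chart A \<phi>) = chart_img \<phi> \<times> UNIV"
  using tangent_overlap_img[of \<phi> \<phi>] by simp

lemma chart_inv_tangent_chart:
  assumes "\<phi> \<in> A" "x \<in> chart_img \<phi>"
  shows "chart_inv (tangent_chart A \<phi>) (x, e) = chart_vec A \<phi> (chart_inv \<phi> x) e"
proof -
  have p: "chart_inv \<phi> x \<in> chart_dom \<phi>" using chart_inv_in assms by simp
  have "(x, e) = chart_map (tangent_chart A \<phi>) (chart_vec A \<phi> (chart_inv \<phi> x) e)"
    using assms p by (simp add: chart_map_tangent_chart base_chart_vec component_chart_vec_self chart_map_inv)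
  then show ?thesis
    unfolding chart_inv_def[of "tangent_chart A \<phi>"]
    using inv_into_f_f[OF inj_tangent_chart[OF assms(1)] chart_vec_in_tangent_chart[OF assms(1) p]] by simp
qed

lemma tangent_transition:
  assumes "\<phi> \<in> A" "\<psi> \<in> A" "x \<in> chart_map \<phi> ` (chart_dom \<phi> \<inter> chart_dom \<psi>)"
  shows "transition (tangent_chart A \<phi>) (tangent_chart A \<psi>) (x, e) =
    (transition \<phi> \<psi> x, frechet_derivative (transition \<phi> \<psi>) (at x) e)"
proof -
  obtain p where p: "x = chart_map \<phi> p" "p \<in> chart_dom \<phi>" "p \<in> chart_dom \<psi>" using assms by auto
  then show ?thesis
    using assms chart_inv_tangent_chart[of \<phi> x e]
    by (simp add: transition_def chart_map_tangent_chart chart_inv_map base_chart_vec component_chart_vec)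
qed

text \<open>A change of tangent charts is \<open>(x, e) \<mapsto> (T x, DT(x) e)\<close> for the underlying change of charts \<open>T\<close>, which is
  smooth in \<open>x\<close> and linear in \<open>e\<close>.\<close>

lemma smooth_atlas_tangent: "smooth_atlas (tangent_atlas A)"
proof
  fix \<Phi> \<Psi> assume "\<Phi> \<in> tangent_atlas A" "\<Psi> \<in> tangent_atlas A"
  then obtain \<phi> \<psi> where \<phi>: "\<phi> \<in> A" "\<Phi> = tangent_chart A \<phi>" and \<psi>: "\<psi> \<in> A" "\<Psi> = tangent_chart A \<psi>"
    by (auto simp: tangent_atlas_def)
  let ?U = "chart_map \<phi> ` (chart_dom \<phi> \<inter> chart_dom \<psi>)"
  show "inj_on (chart_map \<Phi>) (chart_dom \<Phi>)" using inj_tangent_chart \<phi> by simp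
  have img: "chart_map \<Phi> ` (chart_dom \<Phi> \<inter> chart_dom \<Psi>) = ?U \<times> UNIV"
    using tangent_overlap_img \<phi> \<psi> by simp
  have op: "open (?U \<times> (UNIV::'e set))"
    using open_overlap \<phi> \<psi> by (intro open_Times) auto
  show "open (chart_map \<Phi> ` (chart_dom \<Phi> \<inter> chart_dom \<Psi>))" using img op by simp
  have "C_nat_on n (?U \<times> UNIV) (transition \<Phi> \<Psi>)" for n
  proof (rule C_nat_on_cong[OF op])
    show "(transition \<phi> \<psi> (fst z), frechet_derivative (transition \<phi> \<psi>) (at (fst z)) (snd z)) = transition \<Phi> \<Psi> z"
      if "z \<in> ?U \<times> UNIV" for z
      using tangent_transition[of \<phi> \<psi> "fst z" "snd z"] that \<phi> \<psi> by auto
    have f: "C_nat_on n (?U \<times> (UNIV::'e set)) fst" "C_nat_on n (?U \<times> (UNIV::'e set)) snd"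
      by (rule C_nat_on_fst C_nat_on_snd)+
    show "C_nat_on n (?U \<times> UNIV)
        (\<lambda>z. (transition \<phi> \<psi> (fst z), frechet_derivative (transition \<phi> \<psi>) (at (fst z)) (snd z)))"
      by (intro C_nat_on_Pair[OF op] C_nat_on_compose[OF op C_nat_on_transition f(1)]
          C_nat_on_frechet_derivative[OF op C_nat_on_transition f]) (use \<phi> \<psi> in auto)
  qed
  then show "C_on \<infinity> (chart_map \<Phi> ` (chart_dom \<Phi> \<inter> chart_dom \<Psi>)) (transition \<Phi> \<Psi>)"
    using img by (simp add: C_on_def)
qed

lemma tangent_chart_in_atlas: "\<phi> \<in> A \<Longrightarrow> tangent_chart A \<phi> \<in> tangent_atlas A"
  by (simp add: tangent_atlas_def)

lemma carrier_tangent_atlas: "carrier (tangent_atlas A) = tangent_bundle A"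
  by (auto simp: carrier_def tangent_atlas_def chart_dom_tangent_chart tangent_bundle_iff)

subsection \<open>Local representatives in prescribed charts\<close>

text \<open>\<open>C_map_on\<close> only provides some chart around each value of \<open>f\<close>. Composing with a change of charts gives a
  representative in any prescribed chart around that value.\<close>

lemma C_map_on_in_chart:
  fixes f :: "'m::euclidean_space \<Rightarrow> 'q"
  assumes "C_map_on r std_atlas S A f" "s \<in> S" "\<xi> \<in> A" "f s \<in> chart_dom \<xi>"
  obtains W g where "open W" "s \<in> W" "C_on r W g" "g ` W \<subseteq> chart_img \<xi>"
    "\<And>x. x \<in> S \<inter> W \<Longrightarrow> f x \<in> chart_dom \<xi> \<and> chart_map \<xi> (f x) = g x"
proof -
  obtain \<psi> W0 g0 where \<psi>: "\<psi> \<in> A" "f s \<in> chart_dom \<psi>" and W0: "open W0" "s \<in> W0" "C_on r W0 g0"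
    and rep: "\<forall>x\<in>S. x \<in> W0 \<longrightarrow> f x \<in> chart_dom \<psi> \<and> chart_map \<psi> (f x) = g0 x"
    using assms(1,2) unfolding C_map_on_def std_atlas_def by fastforce
  let ?O = "chart_map \<psi> ` (chart_dom \<psi> \<inter> chart_dom \<xi>)"
  define W where "W = W0 \<inter> g0 -` ?O"
  have "C_nat_on 0 W0 g0" by (rule C_onD[OF W0(3)]) (simp add: zero_enat_def[symmetric])
  then have "open W"
    unfolding W_def using C_nat_on_inv_image_open W0(1) open_overlap \<psi>(1) assms(3) by blast
  moreover have "s \<in> W" using W0(2) rep \<psi>(2) assms(2,4) by (force simp: W_def)
  moreover have "C_on r W (\<lambda>x. transition \<psi> \<xi> (g0 x))"
    using \<open>open W\<close> C_on_infinity_imp[OF smooth_transition[OF \<psi>(1) assms(3)]] C_on_subset[OF W0(3), of W]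
    by (rule C_on_compose) (auto simp: W_def)
  moreover have tr: "transition \<psi> \<xi> (chart_map \<psi> p) = chart_map \<xi> p" if "p \<in> chart_dom \<psi>" for p
    using transition_chart \<psi>(1) that by blast
  moreover have "(\<lambda>x. transition \<psi> \<xi> (g0 x)) ` W \<subseteq> chart_img \<xi>"
    using tr by (auto simp: W_def)
  moreover have "f x \<in> chart_dom \<xi> \<and> chart_map \<xi> (f x) = transition \<psi> \<xi> (g0 x)" if "x \<in> S \<inter> W" for x
  proof -
    have x: "f x \<in> chart_dom \<psi>" "chart_map \<psi> (f x) = g0 x" using rep that by (auto simp: W_def)
    have "g0 x \<in> ?O" using that by (simp add: W_def)
    then obtain p where p: "p \<in> chart_dom \<psi>" "p \<in> chart_dom \<xi>" "g0 x = chart_map \<psi> p" by blast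
    then have "f x = p" using x inj_onD[OF inj_chart[OF \<psi>(1)]] by metis
    then show ?thesis using p tr by simp
  qed
  ultimately show ?thesis using that by blast
qed

text \<open>The corresponding freedom on the source side, for functions on the whole manifold: the local
  representatives of \<open>C_map_on\<close> fit together to a single one on the image of a prescribed chart.\<close>

lemma C_on_local_representative:
  fixes f :: "'q \<Rightarrow> 'b::real_normed_vector"
  assumes "C_map_on r A (carrier A) std_atlas f" "\<phi> \<in> A"
  shows "C_on r (chart_img \<phi>) (\<lambda>x. f (chart_inv \<phi> x))"
  unfolding C_on_def
proof (intro allI impI C_nat_on_locally)
  fix n x assume n: "enat n \<le> r" and x: "x \<in> chart_img \<phi>"
  let ?p = "chart_inv \<phi> x"
  have p: "?p \<in> chart_dom \<phi>" "chart_map \<phi> ?p = x" using chart_inv_in[OF x] chart_map_inv[OF x] .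
  then have "?p \<in> carrier A" using in_carrier assms by blast
  then obtain \<psi> W g where \<psi>: "\<psi> \<in> A" "?p \<in> chart_dom \<psi>" and W: "open W" "chart_map \<psi> ?p \<in> W" "C_on r W g"
    and rep: "\<forall>q\<in>carrier A \<inter> chart_dom \<psi>. chart_map \<psi> q \<in> W \<longrightarrow> f q = g (chart_map \<psi> q)"
    using assms(1) unfolding C_map_on_def std_atlas_def by fastforce
  let ?O = "chart_map \<phi> ` (chart_dom \<phi> \<inter> chart_dom \<psi>)"
  have tr: "C_nat_on n ?O (transition \<phi> \<psi>)" using C_nat_on_transition assms(2) \<psi>(1) by blast
  define V where "V = ?O \<inter> transition \<phi> \<psi> -` W"
  have "open V" unfolding V_def
    using C_nat_on_inv_image_open[OF open_overlap tr W(1)] assms(2) \<psi>(1) by blast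
  moreover have "x \<in> V"
    using p \<psi>(2) W(2) transition_chart[OF assms(2) p(1), of \<psi>] by (force simp: V_def)
  moreover have "C_nat_on n V (\<lambda>x. f (chart_inv \<phi> x))"
  proof (rule C_nat_on_cong[OF \<open>open V\<close>])
    show "C_nat_on n V (\<lambda>x. g (transition \<phi> \<psi> x))"
      using \<open>open V\<close> C_onD[OF W(3) n] C_nat_on_subset[OF tr, of V]
      by (rule C_nat_on_compose) (auto simp: V_def)
    show "g (transition \<phi> \<psi> y) = f (chart_inv \<phi> y)" if "y \<in> V" for y
    proof -
      have "y \<in> ?O" using that by (simp add: V_def)
      then obtain q where q: "q \<in> chart_dom \<phi>" "q \<in> chart_dom \<psi>" "y = chart_map \<phi> q" by blast
      then have "transition \<phi> \<psi> y = chart_map \<psi> q" "chart_inv \<phi> y = q"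
        using transition_chart chart_inv_map assms(2) by auto
      then show ?thesis using rep q that in_carrier[OF \<psi>(1) q(2)] by (auto simp: V_def)
    qed
  qed
  ultimately show "\<exists>V. open V \<and> x \<in> V \<and> C_nat_on n V (\<lambda>x. f (chart_inv \<phi> x))" by blast
qed

text \<open>By the chain rule, differentiating a curve in one chart yields its velocity in all charts. The
  curve has to stay in that chart only near \<open>t\<close> and within \<open>J\<close>, and \<open>J\<close> may be a compact interval
  with \<open>t\<close> at its end.\<close>

lemma velocity_eq_chart_vec:
  assumes \<xi>: "\<xi> \<in> A" "c t \<in> chart_dom \<xi>"
    and S: "open S" "t \<in> S" "t \<in> J" "\<And>s. s \<in> J \<inter> S \<Longrightarrow> c s \<in> chart_dom \<xi> \<and> chart_map \<xi> (c s) = g s"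
    and d: "(g has_vector_derivative d) (at t within J)" and nb: "at t within J \<noteq> bot"
  shows "velocity A J c t = chart_vec A \<xi> (c t) d"
proof -
  have "vector_derivative (chart_map \<psi> \<circ> c) (at t within J) = dtrans \<xi> \<psi> (c t) d"
    if \<psi>: "\<psi> \<in> A" "c t \<in> chart_dom \<psi>" for \<psi>
  proof (rule vector_derivative_within[OF nb])
    have gt: "g t = chart_map \<xi> (c t)" using S by simp
    have "((\<lambda>s. transition \<xi> \<psi> (g s)) has_vector_derivative
        frechet_derivative (transition \<xi> \<psi>) (at (g t)) d) (at t within J)"
      by (rule C_nat_on_vector_derivative_compose[OF C_nat_on_transition[OF \<xi>(1) \<psi>(1), of 1] _ _ d])
         (use gt \<xi> \<psi> in auto)
    moreover have "\<forall>\<^sub>F s in nhds t. s \<in> J \<longrightarrow> transition \<xi> \<psi> (g s) = (chart_map \<psi> \<circ> c) s"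
      using eventually_nhds_in_open[OF S(1,2)]
    proof eventually_elim
      case (elim s)
      show ?case
      proof
        assume "s \<in> J"
        then have "c s \<in> chart_dom \<xi>" "g s = chart_map \<xi> (c s)" using S(4)[of s] elim by auto
        then show "transition \<xi> \<psi> (g s) = (chart_map \<psi> \<circ> c) s" using transition_chart[OF \<xi>(1)] by simp
      qed
    qed
    moreover have "transition \<xi> \<psi> (g t) = (chart_map \<psi> \<circ> c) t"
      using gt \<xi> transition_chart by simp
    ultimately show "((chart_map \<psi> \<circ> c) has_vector_derivative dtrans \<xi> \<psi> (c t) d) (at t within J)"
      using has_vector_derivative_cong_ev gt by metis
  qed
  then show ?thesis by (auto simp: velocity_def chart_vec_def)
qed

end

section \<open>The first variation in coordinates\<close>

text \<open>At \<open>z = (x, v)\<close> and for \<open>z' = (v, a)\<close> this is \<open>(\<partial>\<^sub>x \<Lambda> - d/dt \<partial>\<^sub>v \<Lambda>) \<cdot> u\<close>, where \<open>d/dt\<close> is taken along a curve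
  with position \<open>x\<close>, velocity \<open>v\<close> and acceleration \<open>a\<close>: then \<open>z'\<close> is the velocity of \<open>z\<close>.\<close>

definition euler_lagrange :: "('e \<times> 'e \<Rightarrow> real) \<Rightarrow> 'e \<times> 'e \<Rightarrow> 'e \<times> 'e \<Rightarrow> 'e::euclidean_space \<Rightarrow> real" where
  "euler_lagrange \<Lambda> z z' u =
     frechet_derivative \<Lambda> (at z) (u, 0)
     - frechet_derivative (\<lambda>y. frechet_derivative \<Lambda> (at y) (0, u)) (at z) z'"

lemma frechet_derivative_linear_at:
  fixes \<Lambda> :: "'a::real_normed_vector \<Rightarrow> 'b::real_normed_vector"
  assumes "C_nat_on n U \<Lambda>" "0 < n" "z \<in> U"
  shows "linear (frechet_derivative \<Lambda> (at z))"
  using C_nat_on_has_derivative[OF assms] has_derivative_linear by blast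

lemma linear_euler_lagrange:
  fixes \<Lambda> :: "'e::euclidean_space \<times> 'e \<Rightarrow> real"
  assumes "open U" "C_nat_on 2 U \<Lambda>" "z \<in> U"
  shows "linear (euler_lagrange \<Lambda> z z')"
proof -
  let ?M = "\<lambda>u y. frechet_derivative \<Lambda> (at y) (0, u)"
  have lin: "linear (frechet_derivative \<Lambda> (at y))" if "y \<in> U" for y
    using frechet_derivative_linear_at[OF assms(2) _ that] by simp
  have M: "(?M u has_derivative frechet_derivative (?M u) (at z)) (at z)" for u
    by (rule C_nat_on_has_derivative[of 1 U]) (use assms in \<open>simp_all add: numeral_2_eq_2\<close>)
  have "frechet_derivative (?M (u + u')) (at z) z' =
      frechet_derivative (?M u) (at z) z' + frechet_derivative (?M u') (at z) z'" for u u'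
  proof -
    have "((\<lambda>y. ?M u y + ?M u' y) has_derivative
        (\<lambda>h. frechet_derivative (?M u) (at z) h + frechet_derivative (?M u') (at z) h)) (at z)"
      by (intro has_derivative_add M)
    then have "(?M (u + u') has_derivative
        (\<lambda>h. frechet_derivative (?M u) (at z) h + frechet_derivative (?M u') (at z) h)) (at z)"
      by (rule has_derivative_transform_within_open[OF _ assms(1,3)])
         (use linear_add[OF lin, of _ "(0, u)" "(0, u')"] in simp)
    from fun_cong[OF frechet_derivative_at[OF this], of z'] show ?thesis by simp
  qed
  moreover have "frechet_derivative (?M (c *\<^sub>R u)) (at z) z' = c * frechet_derivative (?M u) (at z) z'" for c u
  proof -
    have "((\<lambda>y. c *\<^sub>R ?M u y) has_derivative (\<lambda>h. c *\<^sub>R frechet_derivative (?M u) (at z) h)) (at z)"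
      by (intro has_derivative_scaleR_right M)
    then have "(?M (c *\<^sub>R u) has_derivative (\<lambda>h. c *\<^sub>R frechet_derivative (?M u) (at z) h)) (at z)"
      by (rule has_derivative_transform_within_open[OF _ assms(1,3)])
         (use linear_scale[OF lin, of _ c "(0, u)"] in simp)
    from fun_cong[OF frechet_derivative_at[OF this], of z'] show ?thesis by simp
  qed
  moreover have "frechet_derivative \<Lambda> (at z) (u + u', 0) =
      frechet_derivative \<Lambda> (at z) (u, 0) + frechet_derivative \<Lambda> (at z) (u', 0)" for u u'
    using linear_add[OF lin[OF assms(3)], of "(u, 0)" "(u', 0)"] by simp
  moreover have "frechet_derivative \<Lambda> (at z) (c *\<^sub>R u, 0) = c * frechet_derivative \<Lambda> (at z) (u, 0)" for c u
    using linear_scale[OF lin[OF assms(3)], of c "(u, 0)"] by simp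
  ultimately show ?thesis
    by (intro linearI) (simp_all add: euler_lagrange_def algebra_simps)
qed

lemma C_nat_on_euler_lagrange:
  fixes \<Lambda> :: "'e::euclidean_space \<times> 'e \<Rightarrow> real"
  assumes "open U" "C_nat_on (n + 2) U \<Lambda>"
  shows "C_nat_on n (U \<times> UNIV) (\<lambda>y. euler_lagrange \<Lambda> (fst y) (snd y) u)"
proof -
  have op: "open (U \<times> (UNIV :: ('e \<times> 'e) set))" using assms(1) by (intro open_Times) auto
  have f: "C_nat_on n (U \<times> UNIV) (fst :: ('e \<times> 'e) \<times> ('e \<times> 'e) \<Rightarrow> _)" "C_nat_on n (U \<times> UNIV) (snd :: ('e \<times> 'e) \<times> ('e \<times> 'e) \<Rightarrow> _)"
    by (rule C_nat_on_fst C_nat_on_snd)+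
  have L: "C_nat_on (Suc n) U \<Lambda>" "C_nat_on (Suc n) U (\<lambda>y. frechet_derivative \<Lambda> (at y) (0, u))"
    using assms(2) C_nat_on_Suc_lower[of "Suc n" U \<Lambda>] by (simp_all del: C_nat_on.simps add: C_nat_on.simps(2)[of "Suc n" U \<Lambda>])
  have 1: "C_nat_on n (U \<times> UNIV) (\<lambda>y :: ('e \<times> 'e) \<times> ('e \<times> 'e). frechet_derivative \<Lambda> (at (fst y)) (u, 0))"
    by (rule C_nat_on_frechet_derivative[OF op L(1) f(1) C_nat_on_const]) auto
  have 2: "C_nat_on n (U \<times> UNIV) (\<lambda>y :: ('e \<times> 'e) \<times> ('e \<times> 'e).
      frechet_derivative (\<lambda>y. frechet_derivative \<Lambda> (at y) (0, u)) (at (fst y)) (snd y))"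
    by (rule C_nat_on_frechet_derivative[OF op L(2) f]) auto
  have "C_nat_on n (U \<times> UNIV) (\<lambda>y :: ('e \<times> 'e) \<times> ('e \<times> 'e). frechet_derivative \<Lambda> (at (fst y)) (u, 0)
      + (- 1) *\<^sub>R frechet_derivative (\<lambda>y. frechet_derivative \<Lambda> (at y) (0, u)) (at (fst y)) (snd y))"
    by (intro C_nat_on_add C_nat_on_scaleR C_nat_on_const op 1 2)
  then show ?thesis by (simp add: euler_lagrange_def)
qed

text \<open>The momentum \<open>\<partial>\<^sub>v \<Lambda> \<cdot> y\<close> along a curve. The map \<open>\<Psi>(z, y) = D\<Lambda>(z)(0, y)\<close> is jointly \<open>C\<^sup>1\<close>, so its
  derivative along \<open>(P, y)\<close> is the sum of the two partial derivatives, and the partial derivative in \<open>y\<close> is \<open>\<Psi>\<close>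
  itself by linearity.\<close>

lemma momentum_along_curve:
  fixes \<Lambda> :: "'e::euclidean_space \<times> 'e \<Rightarrow> real" and P :: "real \<Rightarrow> 'e \<times> 'e"
  assumes U: "open U" "C_nat_on 2 U \<Lambda>" "P t \<in> U"
    and P: "(P has_vector_derivative P') (at t within S)"
    and y: "(y has_vector_derivative y') (at t within S)"
  shows "((\<lambda>s. frechet_derivative \<Lambda> (at (P s)) (0, y s)) has_vector_derivative
    frechet_derivative \<Lambda> (at (P t)) (0, y')
    + frechet_derivative (\<lambda>z. frechet_derivative \<Lambda> (at z) (0, y t)) (at (P t)) P') (at t within S)"
proof -
  define \<Psi> where "\<Psi> = (\<lambda>w. frechet_derivative \<Lambda> (at (fst w)) (0, snd w) :: real)"
  have op: "open (U \<times> (UNIV :: 'e set))" using U(1) by (intro open_Times) auto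
  have L: "C_nat_on (Suc 1) U \<Lambda>" using U(2) by (simp add: numeral_2_eq_2)
  have \<Psi>: "C_nat_on 1 (U \<times> UNIV) \<Psi>"
    unfolding \<Psi>_def
    by (rule C_nat_on_frechet_derivative[OF op L C_nat_on_fst C_nat_on_Pair[OF op C_nat_on_const C_nat_on_snd]]) auto
  let ?D = "frechet_derivative \<Psi> (at (P t, y t))"
  have D: "(\<Psi> has_derivative ?D) (at (P t, y t))"
    by (rule C_nat_on_has_derivative[OF \<Psi>]) (use U in auto)
  have curve: "((\<lambda>s. (P s, y s)) has_vector_derivative (P', y')) (at t within S)"
    using P y by (rule has_vector_derivative_Pair)
  have total: "((\<lambda>s. \<Psi> (P s, y s)) has_vector_derivative ?D (P', y')) (at t within S)"
    by (rule C_nat_on_vector_derivative_compose[OF \<Psi> _ _ curve]) (use U in auto)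
  have "((\<lambda>z. (z, y t)) has_derivative (\<lambda>h. (h, 0))) (at (P t))"
    by (auto intro!: derivative_eq_intros)
  from has_derivative_compose[OF this, of \<Psi> ?D]
  have "((\<lambda>z. \<Psi> (z, y t)) has_derivative (\<lambda>h. ?D (h, 0))) (at (P t))"
    using D by simp
  from fun_cong[OF frechet_derivative_at[OF this], of P']
  have 1: "?D (P', 0) = frechet_derivative (\<lambda>z. frechet_derivative \<Lambda> (at z) (0, y t)) (at (P t)) P'"
    by (simp add: \<Psi>_def)
  have lin: "linear (frechet_derivative \<Lambda> (at (P t)))"
    using frechet_derivative_linear_at[OF U(2) _ U(3)] by simp
  have "linear (\<lambda>u. \<Psi> (P t, u))"
    unfolding \<Psi>_def using linear_add[OF lin, of "(0, _)" "(0, _)"] linear_scale[OF lin, of _ "(0, _)"]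
    by (intro linearI) simp_all
  then have "((\<lambda>u. \<Psi> (P t, u)) has_derivative (\<lambda>u. \<Psi> (P t, u))) (at (y t))"
    by (simp add: linear_imp_has_derivative)
  moreover have "((\<lambda>u. (P t, u)) has_derivative (\<lambda>h. (0, h))) (at (y t))"
    by (auto intro!: derivative_eq_intros)
  from has_derivative_compose[OF this, of \<Psi> ?D]
  have "((\<lambda>u. \<Psi> (P t, u)) has_derivative (\<lambda>h. ?D (0, h))) (at (y t))"
    using D by simp
  ultimately have "(\<lambda>u. \<Psi> (P t, u)) = (\<lambda>h. ?D (0, h))" by (rule has_derivative_unique)
  from fun_cong[OF this, of y'] have 2: "?D (0, y') = frechet_derivative \<Lambda> (at (P t)) (0, y')"
    by (simp add: \<Psi>_def)
  have "?D (P', y') = ?D (0, y') + ?D (P', 0)"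
    using linear_add[OF has_derivative_linear[OF D], of "(0, y')" "(P', 0)"] by simp
  then show ?thesis using total 1 2 by (simp add: \<Psi>_def)
qed

text \<open>Integration by parts before integrating. The derivative of the Lagrangian in \<open>\<epsilon>\<close> contains the term
  \<open>\<partial>\<^sub>v \<Lambda> \<cdot> \<partial>\<^sub>\<epsilon> \<partial>\<^sub>t g\<close>, the derivative of the momentum in \<open>t\<close> contains \<open>\<partial>\<^sub>v \<Lambda> \<cdot> \<partial>\<^sub>t \<partial>\<^sub>\<epsilon> g\<close>; the mixed
  partial derivatives agree, and what remains of the difference is the Euler-Lagrange expression.\<close>

lemma first_variation_in_coordinates:
  fixes \<Lambda> :: "'e::euclidean_space \<times> 'e \<Rightarrow> real" and g :: "real \<times> real \<Rightarrow> 'e"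
  assumes U: "open U" "C_nat_on 2 U \<Lambda>"
    and W: "open W" "C_nat_on 2 W g" "(e, t) \<in> W"
  defines "ge \<equiv> \<lambda>z. frechet_derivative g (at z) (1, 0)"
    and "gt \<equiv> \<lambda>z. frechet_derivative g (at z) (0, 1)"
  assumes "(g (e, t), gt (e, t)) \<in> U"
  shows "((\<lambda>e. \<Lambda> (g (e, t), gt (e, t))) has_vector_derivative
      frechet_derivative \<Lambda> (at (g (e, t), gt (e, t))) (ge (e, t), frechet_derivative gt (at (e, t)) (1, 0))) (at e)"
      (is ?first)
    and "((\<lambda>s. frechet_derivative \<Lambda> (at (g (e, s), gt (e, s))) (0, ge (e, s))) has_vector_derivative
      frechet_derivative \<Lambda> (at (g (e, t), gt (e, t))) (ge (e, t), frechet_derivative gt (at (e, t)) (1, 0))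
      - euler_lagrange \<Lambda> (g (e, t), gt (e, t)) (gt (e, t), frechet_derivative gt (at (e, t)) (0, 1)) (ge (e, t)))
      (at t within S)" (is ?second)
proof -
  have ge: "C_nat_on 1 W ge" and gt: "C_nat_on 1 W gt"
    using W(2) by (simp_all add: ge_def gt_def numeral_2_eq_2)
  note dg = C_nat_on_partial_derivatives[OF W(2) _ W(3)]
  note dgt = C_nat_on_partial_derivatives[OF gt _ W(3)]
  note dge = C_nat_on_partial_derivatives[OF ge _ W(3)]
  show ?first
  proof (rule C_nat_on_vector_derivative_compose[OF U(2)])
    show "((\<lambda>e. (g (e, t), gt (e, t))) has_vector_derivative
        (ge (e, t), frechet_derivative gt (at (e, t)) (1, 0))) (at e)"
      unfolding ge_def by (intro has_vector_derivative_Pair dg(1) dgt(1)) auto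
  qed (use assms in auto)
  have lin: "linear (frechet_derivative \<Lambda> (at (g (e, t), gt (e, t))))"
    using frechet_derivative_linear_at[OF U(2)] assms(8) by simp
  have "((\<lambda>s. (g (e, s), gt (e, s))) has_vector_derivative
      (gt (e, t), frechet_derivative gt (at (e, t)) (0, 1))) (at t within S)"
    unfolding gt_def by (intro has_vector_derivative_Pair dg(2) dgt(2)[unfolded gt_def]) auto
  moreover have "((\<lambda>s. ge (e, s)) has_vector_derivative frechet_derivative gt (at (e, t)) (1, 0)) (at t within S)"
    using dge(2) C2_mixed_partials[OF W] by (simp add: ge_def gt_def)
  ultimately have *: "((\<lambda>s. frechet_derivative \<Lambda> (at (g (e, s), gt (e, s))) (0, ge (e, s))) has_vector_derivative
    frechet_derivative \<Lambda> (at (g (e, t), gt (e, t))) (0, frechet_derivative gt (at (e, t)) (1, 0))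
    + frechet_derivative (\<lambda>z. frechet_derivative \<Lambda> (at z) (0, ge (e, t))) (at (g (e, t), gt (e, t)))
       (gt (e, t), frechet_derivative gt (at (e, t)) (0, 1))) (at t within S)"
    using momentum_along_curve[OF U, where P = "\<lambda>s. (g (e, s), gt (e, s))" and y = "\<lambda>s. ge (e, s)"] assms(8)
    by blast
  show ?second
    using * linear_add[OF lin, of "(ge (e, t), 0)" "(0, frechet_derivative gt (at (e, t)) (1, 0))"]
    by (simp add: euler_lagrange_def)
qed

section \<open>Velocities of one-parameter families of curves\<close>

lemma velocity_cong:
  fixes A :: "('q, 'e::real_normed_vector) chart set"
  assumes "\<And>s. s \<in> J \<Longrightarrow> c s = c' s" "t \<in> J"
  shows "velocity A J c t = velocity A J c' t"
proof -
  have "\<forall>\<^sub>F x in nhds t. x \<in> J \<longrightarrow> (chart_map \<phi> \<circ> c) x = (chart_map \<phi> \<circ> c') x" for \<phi> :: "('q, 'e) chart"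
    using assms(1) by (auto intro!: always_eventually)
  then have "vector_derivative (chart_map \<phi> \<circ> c) (at t within J) = vector_derivative (chart_map \<phi> \<circ> c') (at t within J)"
    for \<phi> :: "('q, 'e) chart"
    using vector_derivative_cong_eq[of J "chart_map \<phi> \<circ> c" "chart_map \<phi> \<circ> c'" t t J] assms(2) by blast
  then show ?thesis using assms by (simp add: velocity_def cong: if_cong)
qed

lemma second_velocity_cong:
  assumes "\<And>s. s \<in> J \<Longrightarrow> c s = c' s" "t \<in> J"
  shows "second_velocity A J c t = second_velocity A J c' t"
  unfolding second_velocity_def using velocity_cong[of J c c'] assms
  by (intro velocity_cong) auto

lemma at_within_Icc_neq_bot:
  fixes a b :: real
  assumes "a < b" "t \<in> {a..b}"
  shows "at t within {a..b} \<noteq> bot"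
  using assms islimpt_Icc[of a b t] by (simp add: trivial_limit_within)

context smooth_atlas
begin

abbreviation "TA \<equiv> tangent_atlas A"

text \<open>The vector of \<open>TTQ\<close> with coordinates \<open>((p, v), y)\<close> in the chart induced by \<open>\<phi>\<close>.\<close>

abbreviation tvec2 :: "('q, 'e) chart \<Rightarrow> 'q \<Rightarrow> 'e \<Rightarrow> 'e \<times> 'e \<Rightarrow> (('q, 'e) tvec, 'e \<times> 'e) tvec" where
  "tvec2 \<phi> p v y \<equiv> chart_vec TA (tangent_chart A \<phi>) (chart_vec A \<phi> p v) y"

text \<open>All velocities in the first variation formula are partial derivatives of one local representative \<open>g\<close> of
  the family. The set \<open>W\<close> is open, so \<open>g\<close> has two-sided partial derivatives even when \<open>t\<close> is an end point of
  the interval, and these agree with the one-sided derivatives in the definition of velocities.\<close>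

lemma velocities_in_chart:
  fixes g :: "real \<times> real \<Rightarrow> 'e"
  assumes \<phi>: "\<phi> \<in> A" and ab: "a < b"
    and W: "open W" "C_nat_on 2 W g"
    and rep: "\<And>e t. (e, t) \<in> W \<Longrightarrow> t \<in> {a..b} \<Longrightarrow> V e t \<in> chart_dom \<phi> \<and> chart_map \<phi> (V e t) = g (e, t)"
    and et: "(e, t) \<in> W" "t \<in> {a..b}"
  defines "ge \<equiv> \<lambda>z. frechet_derivative g (at z) (1, 0)"
    and "gt \<equiv> \<lambda>z. frechet_derivative g (at z) (0, 1)"
  shows "velocity A {a..b} (V e) t = chart_vec A \<phi> (V e t) (gt (e, t))"
    and "velocity A UNIV (\<lambda>e. V e t) e = chart_vec A \<phi> (V e t) (ge (e, t))"
    and "second_velocity A {a..b} (V e) t =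
      tvec2 \<phi> (V e t) (gt (e, t)) (gt (e, t), frechet_derivative gt (at (e, t)) (0, 1))"
    and "velocity TA UNIV (\<lambda>e. velocity A {a..b} (V e) t) e =
      tvec2 \<phi> (V e t) (gt (e, t)) (ge (e, t), frechet_derivative gt (at (e, t)) (1, 0))"
proof -
  interpret T: smooth_atlas TA by (rule smooth_atlas_tangent)
  have gt: "C_nat_on 1 W gt" using W(2) by (simp add: gt_def numeral_2_eq_2)
  define St where "St = {s. (e, s) \<in> W}"
  define Se where "Se = {s. (s, t) \<in> W}"
  have slices: "open {s. (e, s) \<in> W}" "open {s. (s, t) \<in> W}" for e t
    using open_vimage[OF W(1), of "\<lambda>s. (e, s)"] open_vimage[OF W(1), of "\<lambda>s. (s, t)"]
    by (simp_all add: vimage_def continuous_on_Pair continuous_on_const continuous_on_id)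
  have St: "open St" "t \<in> St" and Se: "open Se" "e \<in> Se"
    using et slices by (simp_all add: St_def Se_def)
  note nb = at_within_Icc_neq_bot[OF ab]
  note dg = C_nat_on_partial_derivatives[OF W(2)]
  note dgt = C_nat_on_partial_derivatives[OF gt]
  have vel: "velocity A {a..b} (V e) t = chart_vec A \<phi> (V e t) (gt (e, t))"
    if "(e, t) \<in> W" "t \<in> {a..b}" for e t
  proof (rule velocity_eq_chart_vec[where S = "{s. (e, s) \<in> W}" and g = "\<lambda>s. g (e, s)"])
    show "open {s. (e, s) \<in> W}"
      by (rule slices)
    show "((\<lambda>s. g (e, s)) has_vector_derivative gt (e, t)) (at t within {a..b})"
      unfolding gt_def by (rule dg(2)) (use that in auto)
  qed (use that \<phi> rep nb in auto)
  then show 1: "velocity A {a..b} (V e) t = chart_vec A \<phi> (V e t) (gt (e, t))" using et by simp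
  show "velocity A UNIV (\<lambda>e. V e t) e = chart_vec A \<phi> (V e t) (ge (e, t))"
  proof (rule velocity_eq_chart_vec[where S = Se and g = "\<lambda>s. g (s, t)"])
    show "((\<lambda>s. g (s, t)) has_vector_derivative ge (e, t)) (at e within UNIV)"
      unfolding ge_def by (rule dg(1)) (use et in auto)
    show "V s t \<in> chart_dom \<phi> \<and> chart_map \<phi> (V s t) = g (s, t)" if "s \<in> UNIV \<inter> Se" for s
      using rep[of s t] that et by (simp add: Se_def)
  qed (use \<phi> et rep Se in auto)
  have tdom: "velocity A {a..b} (V e) t \<in> chart_dom (tangent_chart A \<phi>) \<and>
      chart_map (tangent_chart A \<phi>) (velocity A {a..b} (V e) t) = (g (e, t), gt (e, t))"
    if "(e, t) \<in> W" "t \<in> {a..b}" for e t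
    using vel[OF that] rep[OF that] \<phi> chart_vec_in_tangent_chart
    by (simp add: chart_map_tangent_chart base_chart_vec component_chart_vec_self)
  show "second_velocity A {a..b} (V e) t =
      tvec2 \<phi> (V e t) (gt (e, t)) (gt (e, t), frechet_derivative gt (at (e, t)) (0, 1))"
    unfolding second_velocity_def 1[symmetric]
  proof (rule T.velocity_eq_chart_vec[where S = St and g = "\<lambda>s. (g (e, s), gt (e, s))"])
    show "((\<lambda>s. (g (e, s), gt (e, s))) has_vector_derivative
        (gt (e, t), frechet_derivative gt (at (e, t)) (0, 1))) (at t within {a..b})"
      unfolding gt_def using et
      by (intro has_vector_derivative_Pair dg(2) dgt(2)[unfolded gt_def]) auto
    show "velocity A {a..b} (V e) s \<in> chart_dom (tangent_chart A \<phi>) \<and>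
        chart_map (tangent_chart A \<phi>) (velocity A {a..b} (V e) s) = (g (e, s), gt (e, s))"
      if "s \<in> {a..b} \<inter> St" for s using tdom that by (simp add: St_def)
  qed (use \<phi> et St nb tdom tangent_chart_in_atlas in auto)
  show "velocity TA UNIV (\<lambda>e. velocity A {a..b} (V e) t) e =
      tvec2 \<phi> (V e t) (gt (e, t)) (ge (e, t), frechet_derivative gt (at (e, t)) (1, 0))"
    unfolding 1[symmetric]
  proof (rule T.velocity_eq_chart_vec[where S = Se and g = "\<lambda>s. (g (s, t), gt (s, t))"])
    show "((\<lambda>s. (g (s, t), gt (s, t))) has_vector_derivative
        (ge (e, t), frechet_derivative gt (at (e, t)) (1, 0))) (at e within UNIV)"
      unfolding ge_def using et
      by (intro has_vector_derivative_Pair dg(1) dgt(1)) auto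
    show "velocity A {a..b} (V s) t \<in> chart_dom (tangent_chart A \<phi>) \<and>
        chart_map (tangent_chart A \<phi>) (velocity A {a..b} (V s) t) = (g (s, t), gt (s, t))"
      if "s \<in> UNIV \<inter> Se" for s using tdom that et by (simp add: Se_def)
  qed (use \<phi> et Se tdom tangent_chart_in_atlas in auto)
qed

text \<open>This provides the hypotheses of \<open>velocities_in_chart\<close> around every point of the strip, in every chart.\<close>

lemma variation_in_chart:
  fixes V :: "real \<Rightarrow> real \<Rightarrow> 'q"
  assumes "C_map_on 2 std_atlas ({-\<delta><..<\<delta>} \<times> {a..b}) A (\<lambda>(e, t). V e t)"
    and "e \<in> {-\<delta><..<\<delta>}" "t \<in> {a..b}" "\<phi> \<in> A" "V e t \<in> chart_dom \<phi>"
  obtains W g where "open W" "(e, t) \<in> W" "W \<subseteq> {-\<delta><..<\<delta>} \<times> UNIV" "C_nat_on 2 W g" "g ` W \<subseteq> chart_img \<phi>"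
    "\<And>e t. (e, t) \<in> W \<Longrightarrow> t \<in> {a..b} \<Longrightarrow> V e t \<in> chart_dom \<phi> \<and> chart_map \<phi> (V e t) = g (e, t)"
proof -
  obtain W g where W: "open W" "(e, t) \<in> W" "C_on 2 W g" "g ` W \<subseteq> chart_img \<phi>"
    and rep: "\<And>x. x \<in> ({-\<delta><..<\<delta>} \<times> {a..b}) \<inter> W \<Longrightarrow>
      (\<lambda>(e, t). V e t) x \<in> chart_dom \<phi> \<and> chart_map \<phi> ((\<lambda>(e, t). V e t) x) = g x"
    using C_map_on_in_chart[OF assms(1), of "(e, t)" \<phi>] assms(2-5) by auto
  show ?thesis
  proof (rule that[of "W \<inter> ({-\<delta><..<\<delta>} \<times> UNIV)" g])
    show "open (W \<inter> ({-\<delta><..<\<delta>} \<times> UNIV))"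
      using W(1) by (intro open_Int open_Times) auto
    show "C_nat_on 2 (W \<inter> ({-\<delta><..<\<delta>} \<times> UNIV)) g"
      using W(3) C_on_2_iff C_nat_on_subset by blast
    show "V e t \<in> chart_dom \<phi> \<and> chart_map \<phi> (V e t) = g (e, t)"
      if "(e, t) \<in> W \<inter> ({-\<delta><..<\<delta>} \<times> UNIV)" "t \<in> {a..b}" for e t
      using rep[of "(e, t)"] that by auto
  qed (use W assms in auto)
qed

text \<open>Variations that are affine in \<open>\<epsilon>\<close> in a fixed chart supply all test variations used below: they prescribe
  \<open>\<delta>q\<close> and its derivative freely along a curve in the chart. By compactness of \<open>[a, b]\<close> the perturbed
  curves remain in the chart for small \<open>\<epsilon>\<close>.\<close>

lemma straight_variation:
  fixes \<gamma> \<zeta> :: "real \<Rightarrow> 'e"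
  assumes \<phi>: "\<phi> \<in> A" and ab: "a < b"
    and smooth: "C_nat_on 2 UNIV \<gamma>" "C_nat_on 2 UNIV \<zeta>"
    and \<gamma>: "\<And>t. (\<gamma> has_vector_derivative \<gamma>' t) (at t)" "\<And>t. (\<gamma>' has_vector_derivative \<gamma>'' t) (at t)"
    and \<zeta>: "\<And>t. (\<zeta> has_vector_derivative \<zeta>' t) (at t)"
    and img: "\<gamma> ` {a..b} \<subseteq> chart_img \<phi>"
  defines "V \<equiv> \<lambda>e t. chart_inv \<phi> (\<gamma> t + e *\<^sub>R \<zeta> t)"
  shows "\<exists>\<delta>>0. C_map_on 2 std_atlas ({-\<delta><..<\<delta>} \<times> {a..b}) A (\<lambda>(e, t). V e t)"
    and "C2_variation A a b (V 0) V"
    and "\<And>t. t \<in> {a..b} \<Longrightarrow> V 0 t \<in> chart_dom \<phi> \<and> chart_map \<phi> (V 0 t) = \<gamma> t"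
    and "\<And>t. t \<in> {a..b} \<Longrightarrow> velocity A {a..b} (V 0) t = chart_vec A \<phi> (V 0 t) (\<gamma>' t)"
    and "\<And>t. t \<in> {a..b} \<Longrightarrow> delta_q A V t = chart_vec A \<phi> (V 0 t) (\<zeta> t)"
    and "\<And>t. t \<in> {a..b} \<Longrightarrow> second_velocity A {a..b} (V 0) t = tvec2 \<phi> (V 0 t) (\<gamma>' t) (\<gamma>' t, \<gamma>'' t)"
    and "\<And>t. t \<in> {a..b} \<Longrightarrow> delta_q_hat A a b V t = tvec2 \<phi> (V 0 t) (\<gamma>' t) (\<zeta> t, \<zeta>' t)"
proof -
  define g where "g = (\<lambda>z :: real \<times> real. \<gamma> (snd z) + fst z *\<^sub>R \<zeta> (snd z))"
  have g: "C_nat_on 2 UNIV g"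
    unfolding g_def
    by (intro C_nat_on_add C_nat_on_scaleR C_nat_on_fst C_nat_on_compose[OF _ smooth(1)]
        C_nat_on_compose[OF _ smooth(2)] C_nat_on_snd) auto
  define U where "U = g -` chart_img \<phi>"
  have "open U"
    using C_nat_on_inv_image_open[OF open_UNIV g open_chart_img[OF \<phi>]] by (simp add: U_def)
  moreover have "{0} \<times> {a..b} \<subseteq> U" using img by (auto simp: U_def g_def)
  ultimately have "\<exists>X0. 0 \<in> X0 \<and> open X0 \<and> X0 \<times> {a..b} \<subseteq> U"
    by (rule Elementary_Topology.tube_lemma[OF compact_Icc])
  then obtain X0 where X0: "0 \<in> X0" "open X0" "X0 \<times> {a..b} \<subseteq> U" by blast
  obtain \<delta> where \<delta>: "\<delta> > 0" "{-\<delta><..<\<delta>} \<subseteq> X0"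
  proof -
    obtain d where "d > 0" "ball 0 d \<subseteq> X0" using X0 open_contains_ball by blast
    moreover have "ball 0 d = {-d<..<d}" by (auto simp: dist_real_def)
    ultimately show ?thesis using that by metis
  qed
  have V: "V e t = chart_inv \<phi> (g (e, t))" for e t by (simp add: V_def g_def)
  have rep: "V e t \<in> chart_dom \<phi> \<and> chart_map \<phi> (V e t) = g (e, t)" if "(e, t) \<in> U" for e t
    using that chart_inv_in[of "g (e, t)" \<phi>] chart_map_inv[of "g (e, t)" \<phi>] by (simp add: V U_def)
  have strip: "{-\<delta><..<\<delta>} \<times> {a..b} \<subseteq> U" using X0 \<delta> by auto
  have "C_map_on 2 std_atlas ({-\<delta><..<\<delta>} \<times> {a..b}) A (\<lambda>(e, t). V e t)"
    unfolding C_map_on_def std_atlas_def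
  proof (intro ballI)
    fix z assume "z \<in> {-\<delta><..<\<delta>} \<times> {a..b}"
    then have "z \<in> U" using strip by blast
    then show "\<exists>\<phi>\<in>{Chart UNIV (\<lambda>x. x)}. \<exists>\<psi>\<in>A. \<exists>W h.
        z \<in> chart_dom \<phi> \<and> (case z of (e, t) \<Rightarrow> V e t) \<in> chart_dom \<psi> \<and>
        open W \<and> chart_map \<phi> z \<in> W \<and> C_on 2 W h \<and>
        (\<forall>x\<in>({-\<delta><..<\<delta>} \<times> {a..b}) \<inter> chart_dom \<phi>. chart_map \<phi> x \<in> W \<longrightarrow>
           (case x of (e, t) \<Rightarrow> V e t) \<in> chart_dom \<psi> \<and>
           chart_map \<psi> (case x of (e, t) \<Rightarrow> V e t) = h (chart_map \<phi> x))"
      using \<phi> \<open>open U\<close> rep g C_nat_on_subset[OF g, of U]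
      by (intro bexI[of _ "Chart UNIV (\<lambda>x. x)"] bexI[of _ \<phi>] exI[of _ U] exI[of _ g])
         (auto simp: C_on_2_iff split: prod.split)
  qed
  then show ex: "\<exists>\<delta>>0. C_map_on 2 std_atlas ({-\<delta><..<\<delta>} \<times> {a..b}) A (\<lambda>(e, t). V e t)"
    using \<delta>(1) by blast
  then show "C2_variation A a b (V 0) V" by (simp add: C2_variation_def)
  fix t assume t: "t \<in> {a..b}"
  have 0: "(0, s) \<in> U" if "s \<in> {a..b}" for s using strip that \<delta>(1) by auto
  show "V 0 t \<in> chart_dom \<phi> \<and> chart_map \<phi> (V 0 t) = \<gamma> t"
    using rep[OF 0[OF t]] by (simp add: g_def)
  note vel = velocities_in_chart[OF \<phi> ab \<open>open U\<close> C_nat_on_subset[OF g subset_UNIV] rep 0[OF t] t]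
  define gt where "gt = (\<lambda>z. frechet_derivative g (at z) (0, 1))"
  note dg = C_nat_on_partial_derivatives[OF g _ UNIV_I, where S = UNIV]
  have gt: "gt (e, s) = \<gamma>' s + e *\<^sub>R \<zeta>' s" for e s
  proof -
    have "((\<lambda>s. g (e, s)) has_vector_derivative \<gamma>' s + e *\<^sub>R \<zeta>' s) (at s)"
      unfolding g_def fst_conv snd_conv
      by (intro has_vector_derivative_add \<gamma>
          bounded_linear.has_vector_derivative[OF bounded_linear_scaleR_right] \<zeta>)
    from vector_derivative_unique_at[OF dg(2) this] show ?thesis by (simp add: gt_def)
  qed
  have ge: "frechet_derivative g (at (0, s)) (1, 0) = \<zeta> s" for s
  proof -
    have "((\<lambda>e. g (e, s)) has_vector_derivative \<zeta> s) (at 0)"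
      unfolding g_def fst_conv snd_conv has_vector_derivative_def
      by (auto intro!: derivative_eq_intros)
    from vector_derivative_unique_at[OF dg(1) this] show ?thesis by simp
  qed
  have gtC: "C_nat_on 1 UNIV gt" using g by (simp add: gt_def numeral_2_eq_2)
  note dgt = C_nat_on_partial_derivatives[OF gtC _ UNIV_I, where S = UNIV]
  have gtt: "frechet_derivative gt (at (0, t)) (0, 1) = \<gamma>'' t"
    using vector_derivative_unique_at[OF dgt(2)[of 0 t]] \<gamma>(2)[of t] by (simp add: gt)
  have gte: "frechet_derivative gt (at (0, t)) (1, 0) = \<zeta>' t"
  proof -
    have "((\<lambda>e. gt (e, t)) has_vector_derivative \<zeta>' t) (at 0)"
      unfolding gt has_vector_derivative_def by (auto intro!: derivative_eq_intros)
    from vector_derivative_unique_at[OF dgt(1) this] show ?thesis by simp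
  qed
  show "velocity A {a..b} (V 0) t = chart_vec A \<phi> (V 0 t) (\<gamma>' t)"
    using vel(1) gt[of 0 t] by (simp add: gt_def)
  show "delta_q A V t = chart_vec A \<phi> (V 0 t) (\<zeta> t)"
    using vel(2) ge by (simp add: delta_q_def)
  show "second_velocity A {a..b} (V 0) t = tvec2 \<phi> (V 0 t) (\<gamma>' t) (\<gamma>' t, \<gamma>'' t)"
    using vel(3) gt[of 0 t] gtt by (simp add: gt_def)
  show "delta_q_hat A a b V t = tvec2 \<phi> (V 0 t) (\<gamma>' t) (\<zeta> t, \<zeta>' t)"
    using vel(4) gt[of 0 t] ge gte by (simp add: delta_q_hat_def gt_def)
qed

end

context smooth_atlas
begin

abbreviation "SO \<equiv> second_order_submanifold A"

text \<open>Viewing a curve as a family that does not depend on \<open>\<epsilon>\<close> makes the lemmas about families available.\<close>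

lemma C_map_on_constant_variation:
  fixes c :: "real \<Rightarrow> 'q"
  assumes "C_map_on 2 std_atlas {a..b} A c"
  shows "C_map_on 2 std_atlas ({-1<..<1::real} \<times> {a..b}) A (\<lambda>(e, t). c t)"
  unfolding C_map_on_def std_atlas_def
proof (intro ballI)
  fix z :: "real \<times> real" assume z: "z \<in> {-1<..<1} \<times> {a..b}"
  then obtain \<psi> W g where \<psi>: "\<psi> \<in> A" "c (snd z) \<in> chart_dom \<psi>" and W: "open W" "snd z \<in> W" "C_on 2 W g"
    and rep: "\<forall>t\<in>{a..b}. t \<in> W \<longrightarrow> c t \<in> chart_dom \<psi> \<and> chart_map \<psi> (c t) = g t"
    using assms unfolding C_map_on_def std_atlas_def by fastforce
  have op: "open (UNIV \<times> W)" using W(1) by (intro open_Times) auto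
  have "C_nat_on 2 (UNIV \<times> W) (\<lambda>z. g (snd z))"
    by (rule C_nat_on_compose[OF op _ C_nat_on_snd]) (use W(3) C_on_2_iff in auto)
  then have g: "C_on 2 (UNIV \<times> W) (\<lambda>z. g (snd z))" by (simp add: C_on_2_iff)
  show "\<exists>\<phi>\<in>{Chart UNIV (\<lambda>x. x)}. \<exists>\<psi>\<in>A. \<exists>W h.
      z \<in> chart_dom \<phi> \<and> (case z of (e, t) \<Rightarrow> c t) \<in> chart_dom \<psi> \<and>
      open W \<and> chart_map \<phi> z \<in> W \<and> C_on 2 W h \<and>
      (\<forall>x\<in>({-1<..<1} \<times> {a..b}) \<inter> chart_dom \<phi>. chart_map \<phi> x \<in> W \<longrightarrow>
         (case x of (e, t) \<Rightarrow> c t) \<in> chart_dom \<psi> \<and>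
         chart_map \<psi> (case x of (e, t) \<Rightarrow> c t) = h (chart_map \<phi> x))"
    by (rule bexI[of _ "Chart UNIV (\<lambda>x. x)"], rule bexI[OF _ \<psi>(1)], rule exI[of _ "UNIV \<times> W"],
        rule exI[of _ "\<lambda>z. g (snd z)"]) (use \<psi> rep z op W(2) g in \<open>auto split: prod.split\<close>)
qed

text \<open>The second order submanifold consists of the vectors with coordinates \<open>((x, v), (v, a))\<close>: such coordinates
  are forced on the second velocity of a curve, and conversely (\<open>tvec2_in_SO\<close>) every such vector is
  attained by the quadratic curve \<open>x + t v + t\<^sup>2 a / 2\<close>.\<close>

lemma second_order_cases:
  assumes "w \<in> SO" "\<phi> \<in> A" "base (base w) \<in> chart_dom \<phi>"
  obtains v y where "w = tvec2 \<phi> (base (base w)) v (v, y)"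
proof -
  obtain a b c where w: "w = second_velocity A {a..b} c 0" and ab: "a < 0" "0 < b"
    and c: "C_map_on 2 std_atlas {a..b} A c"
    using assms(1) unfolding second_order_submanifold_def by blast
  have bw: "base (base w) = c 0" by (simp add: w second_velocity_def velocity_def)
  obtain W g where W: "open W" "(0::real, 0) \<in> W" "C_nat_on 2 W g"
    "\<And>e t. (e, t) \<in> W \<Longrightarrow> t \<in> {a..b} \<Longrightarrow> c t \<in> chart_dom \<phi> \<and> chart_map \<phi> (c t) = g (e, t)"
  proof (rule variation_in_chart[OF C_map_on_constant_variation[OF c], of 0 0 \<phi>])
    fix W g assume "open W" "(0::real, 0) \<in> W" "C_nat_on 2 W g"
      "\<And>e t. (e, t) \<in> W \<Longrightarrow> t \<in> {a..b} \<Longrightarrow> c t \<in> chart_dom \<phi> \<and> chart_map \<phi> (c t) = g (e, t)"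
    then show thesis by (rule that)
  qed (use ab assms(2,3) bw in auto)
  show ?thesis
    using that velocities_in_chart(3)[of \<phi> a b W g "\<lambda>e. c" 0 0] W ab assms(2)
    unfolding w[symmetric] bw[symmetric] by simp
qed

lemma C_nat_on_quadratic: "C_nat_on n UNIV (\<lambda>t. x + t *\<^sub>R v + (t * t) *\<^sub>R y)"
  by (intro C_nat_on_add C_nat_on_scaleR C_nat_on_const C_nat_on_ident
      C_nat_on_bilinear[OF _ bounded_bilinear_mult] open_UNIV)

lemma quadratic_curve_in_chart:
  assumes \<phi>: "\<phi> \<in> A" and p: "p \<in> chart_dom \<phi>"
  obtains R where "R > 0"
    "\<And>r t. 0 < r \<Longrightarrow> r \<le> R \<Longrightarrow> t \<in> {-r..r} \<Longrightarrow> chart_map \<phi> p + t *\<^sub>R v + (t * t) *\<^sub>R (y /\<^sub>R 2) \<in> chart_img \<phi>"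
proof -
  let ?\<gamma> = "\<lambda>t. chart_map \<phi> p + t *\<^sub>R v + (t * t) *\<^sub>R (y /\<^sub>R 2)"
  have "open (?\<gamma> -` chart_img \<phi>)"
    using C_nat_on_inv_image_open[OF open_UNIV C_nat_on_quadratic[of 0 "chart_map \<phi> p" v "y /\<^sub>R 2"] open_chart_img[OF \<phi>]] by simp
  moreover have "0 \<in> ?\<gamma> -` chart_img \<phi>" using p by simp
  ultimately obtain R where "R > 0" "cball 0 R \<subseteq> ?\<gamma> -` chart_img \<phi>"
    using open_contains_cball by blast
  moreover have "t \<in> cball 0 R" if "r \<le> R" "t \<in> {-r..r}" for r t :: real
    using that by (auto simp: dist_real_def)
  ultimately show ?thesis using that by blast
qed

lemma quadratic_has_derivative:
  fixes x v y :: "'e"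
  shows "((\<lambda>t. x + t *\<^sub>R v + (t * t) *\<^sub>R (y /\<^sub>R 2)) has_vector_derivative v + t *\<^sub>R y) (at t)"
    and "((\<lambda>t. v + t *\<^sub>R y) has_vector_derivative y) (at t)"
proof -
  show "((\<lambda>t. x + t *\<^sub>R v + (t * t) *\<^sub>R (y /\<^sub>R 2)) has_vector_derivative v + t *\<^sub>R y) (at t)"
    unfolding has_vector_derivative_def
    by (auto intro!: derivative_eq_intros simp: algebra_simps simp flip: scaleR_add_left)
  show "((\<lambda>t. v + t *\<^sub>R y) has_vector_derivative y) (at t)"
    unfolding has_vector_derivative_def by (auto intro!: derivative_eq_intros)
qed


lemma tvec2_in_SO:
  assumes \<phi>: "\<phi> \<in> A" and p: "p \<in> chart_dom \<phi>"
  shows "tvec2 \<phi> p v (v, y) \<in> SO"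
proof -
  let ?\<gamma> = "\<lambda>t. chart_map \<phi> p + t *\<^sub>R v + (t * t) *\<^sub>R (y /\<^sub>R 2)"
  obtain R where R: "R > 0"
    "\<And>r t. 0 < r \<Longrightarrow> r \<le> R \<Longrightarrow> t \<in> {-r..r} \<Longrightarrow> chart_map \<phi> p + t *\<^sub>R v + (t * t) *\<^sub>R (y /\<^sub>R 2) \<in> chart_img \<phi>"
    using quadratic_curve_in_chart[OF assms] by blast
  have img: "?\<gamma> ` {-R..R} \<subseteq> chart_img \<phi>" using R by blast
  have "-R < R" using R by simp
  note sv = straight_variation[OF \<phi> this C_nat_on_quadratic C_nat_on_const[of 2 UNIV 0]
      quadratic_has_derivative has_vector_derivative_const img]
  let ?c = "\<lambda>t. chart_inv \<phi> (?\<gamma> t)"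
  have "C_map_on 2 std_atlas {-R..R} A ?c"
    unfolding C_map_on_def std_atlas_def
  proof (intro ballI)
    fix t assume t: "t \<in> {-R..R}"
    have rep: "?c s \<in> chart_dom \<phi> \<and> chart_map \<phi> (?c s) = ?\<gamma> s" if "s \<in> {-R..R}" for s
      using sv(3)[OF that] by simp
    show "\<exists>\<phi>\<in>{Chart UNIV (\<lambda>x. x)}. \<exists>\<psi>\<in>A. \<exists>W h.
        t \<in> chart_dom \<phi> \<and> ?c t \<in> chart_dom \<psi> \<and> open W \<and> chart_map \<phi> t \<in> W \<and> C_on 2 W h \<and>
        (\<forall>x\<in>{-R..R} \<inter> chart_dom \<phi>. chart_map \<phi> x \<in> W \<longrightarrow>
           ?c x \<in> chart_dom \<psi> \<and> chart_map \<psi> (?c x) = h (chart_map \<phi> x))"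
      using rep \<phi> t C_nat_on_quadratic[of 2 "chart_map \<phi> p" v "y /\<^sub>R 2"]
      by (intro bexI[of _ "Chart UNIV (\<lambda>x. x)"] bexI[of _ \<phi>] exI[of _ UNIV] exI[of _ ?\<gamma>])
         (auto simp: C_on_2_iff)
  qed
  then have "second_velocity A {-R..R} ?c 0 \<in> SO"
    using R(1) unfolding second_order_submanifold_def by (intro CollectI exI[of _ "-R"] exI[of _ R] exI[of _ ?c]) auto
  moreover have "?c 0 = p" using chart_inv_map[OF \<phi> p] by simp
  ultimately show ?thesis using sv(6)[of 0] R(1) by simp
qed

subsection \<open>The projection \<open>T\<pi> : TTQ \<rightarrow> TQ\<close>\<close>

text \<open>The first component \<open>\<xi>\<close> of the coordinates \<open>((x, v), (\<xi>, \<zeta>))\<close>, in every chart. The value 0 is the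
  normalisation of components in irrelevant charts.\<close>

definition tproj :: "(('q, 'e) tvec, 'e \<times> 'e) tvec \<Rightarrow> ('q, 'e) tvec" where
  "tproj w = TVec (base (base w))
     (\<lambda>\<phi>. if \<phi> \<in> A \<and> base (base w) \<in> chart_dom \<phi> then fst (component w (tangent_chart A \<phi>)) else 0)"

text \<open>The first component of a change of tangent charts is the change of charts of the base, hence so is its
  derivative; thus the first components of a vector of \<open>TTQ\<close> transform like a vector of \<open>TQ\<close>.\<close>

lemma tproj_tvec2:
  assumes \<phi>: "\<phi> \<in> A" "p \<in> chart_dom \<phi>"
  shows "tproj (tvec2 \<phi> p v y) = chart_vec A \<phi> p (fst y)"
proof -
  interpret T: smooth_atlas TA by (rule smooth_atlas_tangent)
  let ?v = "chart_vec A \<phi> p v"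
  have "fst (component (tvec2 \<phi> p v y) (tangent_chart A \<psi>)) = dtrans \<phi> \<psi> p (fst y)"
    if \<psi>: "\<psi> \<in> A" "p \<in> chart_dom \<psi>" for \<psi>
  proof -
    let ?T = "transition (tangent_chart A \<phi>) (tangent_chart A \<psi>)"
    let ?z = "(chart_map \<phi> p, v)"
    have dom: "?v \<in> chart_dom (tangent_chart A \<phi>)" "?v \<in> chart_dom (tangent_chart A \<psi>)"
      using \<phi> \<psi> chart_vec_in_tangent_bundle by (simp_all add: chart_dom_tangent_chart base_chart_vec)
    have z: "chart_map (tangent_chart A \<phi>) ?v = ?z"
      using \<phi> by (simp add: chart_map_tangent_chart base_chart_vec component_chart_vec_self)
    have "(?T has_derivative frechet_derivative ?T (at ?z)) (at ?z)"
      using T.transition_has_derivative[OF tangent_chart_in_atlas tangent_chart_in_atlas dom] \<phi> \<psi> z by simp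
    then have 1: "((\<lambda>z. fst (?T z)) has_derivative (\<lambda>h. fst (frechet_derivative ?T (at ?z) h))) (at ?z)"
      by (rule has_derivative_fst)
    have "(fst has_derivative fst) (at ?z)" by (rule has_derivative_fst[OF has_derivative_ident])
    from has_derivative_compose[OF this, of "transition \<phi> \<psi>" "dtrans \<phi> \<psi> p"]
    have "((\<lambda>z. transition \<phi> \<psi> (fst z)) has_derivative (\<lambda>h. dtrans \<phi> \<psi> p (fst h))) (at ?z)"
      using transition_has_derivative[of \<phi> \<psi> p] \<phi> \<psi> by simp
    moreover have "open (chart_map \<phi> ` (chart_dom \<phi> \<inter> chart_dom \<psi>) \<times> (UNIV :: 'e set))"
      using open_overlap \<phi> \<psi> by (intro open_Times) auto
    ultimately have "((\<lambda>z. fst (?T z)) has_derivative (\<lambda>h. dtrans \<phi> \<psi> p (fst h))) (at ?z)"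
      by (rule has_derivative_transform_within_open) (use \<phi> \<psi> tangent_transition in auto)
    from fun_cong[OF has_derivative_unique[OF 1 this], of y] show ?thesis
      using T.component_chart_vec[OF tangent_chart_in_atlas[OF \<psi>(1)] dom(2)] z by simp
  qed
  then show ?thesis
    using \<phi> by (auto simp: tproj_def chart_vec_def T.base_chart_vec base_chart_vec fun_eq_iff)
qed

end

section \<open>The Lagrange one-form and the Euler-Lagrange map\<close>

locale lagrangian = smooth_atlas A
  for A :: "('q, 'e::euclidean_space) chart set" +
  fixes L :: "('q, 'e) tvec \<Rightarrow> real" and k :: enat
  assumes k: "2 \<le> k"
    and smooth_L: "C_map_on k (tangent_atlas A) (tangent_bundle A) std_atlas L"
begin

definition local_lagrangian :: "('q, 'e) chart \<Rightarrow> 'e \<times> 'e \<Rightarrow> real" where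
  "local_lagrangian \<phi> z = L (chart_inv (tangent_chart A \<phi>) z)"

lemma open_local_lagrangian_domain: "\<phi> \<in> A \<Longrightarrow> open (chart_img \<phi> \<times> (UNIV :: 'e set))"
  using open_chart_img by (intro open_Times) auto

lemma C_on_local_lagrangian: "\<phi> \<in> A \<Longrightarrow> C_on k (chart_img \<phi> \<times> UNIV) (local_lagrangian \<phi>)"
  using smooth_atlas.C_on_local_representative[OF smooth_atlas_tangent, of k L "tangent_chart A \<phi>"]
    smooth_L tangent_chart_in_atlas
  by (simp add: carrier_tangent_atlas chart_img_tangent_chart local_lagrangian_def[abs_def])

lemma C_nat_on_local_lagrangian: "\<phi> \<in> A \<Longrightarrow> enat n \<le> k \<Longrightarrow> C_nat_on n (chart_img \<phi> \<times> UNIV) (local_lagrangian \<phi>)"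
  by (rule C_onD[OF C_on_local_lagrangian])

lemma C2_local_lagrangian: "\<phi> \<in> A \<Longrightarrow> C_nat_on 2 (chart_img \<phi> \<times> UNIV) (local_lagrangian \<phi>)"
  using C_nat_on_local_lagrangian[of \<phi> 2] k by (simp add: numeral_eq_enat)

lemma L_chart_vec:
  assumes "\<phi> \<in> A" "p \<in> chart_dom \<phi>"
  shows "L (chart_vec A \<phi> p e) = local_lagrangian \<phi> (chart_map \<phi> p, e)"
  using chart_inv_tangent_chart[of \<phi> "chart_map \<phi> p" e] assms by (simp add: local_lagrangian_def chart_inv_map)

text \<open>In coordinates \<open>((x, v), (\<xi>, \<zeta>))\<close> of \<open>w\<close> this is \<open>\<partial>\<^sub>v \<Lambda>(x, v) \<cdot> \<xi>\<close>. Written as the derivative of \<open>L\<close> along a line in a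
  fibre of \<open>TQ\<close>, it involves no chart and is therefore defined globally from the start.\<close>

definition lagrange_form :: "('q, 'e) tvec \<Rightarrow> (('q, 'e) tvec, 'e \<times> 'e) covec" where
  "lagrange_form = (\<lambda>v\<in>tangent_bundle A. Covec v
     (\<lambda>w\<in>tangent_space TA v. deriv (\<lambda>s. L (tvec_add v (tvec_scale s (tproj w)))) 0))"

lemma fibre_derivative_in_chart:
  assumes \<phi>: "\<phi> \<in> A" "p \<in> chart_dom \<phi>"
  shows "deriv (\<lambda>s. L (tvec_add (chart_vec A \<phi> p v) (tvec_scale s (tproj (tvec2 \<phi> p v y))))) 0 =
    frechet_derivative (local_lagrangian \<phi>) (at (chart_map \<phi> p, v)) (0, fst y)"
proof (rule DERIV_imp_deriv)
  have "L (tvec_add (chart_vec A \<phi> p v) (tvec_scale s (tproj (tvec2 \<phi> p v y)))) =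
      local_lagrangian \<phi> (chart_map \<phi> p, v + s *\<^sub>R fst y)" for s
    using \<phi> by (simp add: tproj_tvec2 chart_vec_scale chart_vec_add L_chart_vec)
  moreover have "((\<lambda>s. local_lagrangian \<phi> (chart_map \<phi> p, v + s *\<^sub>R fst y)) has_vector_derivative
      frechet_derivative (local_lagrangian \<phi>) (at (chart_map \<phi> p, v + 0 *\<^sub>R fst y)) (0, fst y)) (at 0)"
  proof (rule C_nat_on_vector_derivative_compose[OF C2_local_lagrangian[OF \<phi>(1)]])
    show "((\<lambda>s. (chart_map \<phi> p, v + s *\<^sub>R fst y)) has_vector_derivative (0, fst y)) (at 0)"
      unfolding has_vector_derivative_def by (auto intro!: derivative_eq_intros)
  qed (use \<phi> in auto)
  ultimately show "((\<lambda>s. L (tvec_add (chart_vec A \<phi> p v) (tvec_scale s (tproj (tvec2 \<phi> p v y)))))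
      has_real_derivative frechet_derivative (local_lagrangian \<phi>) (at (chart_map \<phi> p, v)) (0, fst y)) (at 0)"
    by (simp add: has_real_derivative_iff_has_vector_derivative)
qed

lemma pairing_lagrange_form:
  assumes \<phi>: "\<phi> \<in> A" "p \<in> chart_dom \<phi>"
  shows "pairing (lagrange_form (chart_vec A \<phi> p v)) (tvec2 \<phi> p v y) =
    frechet_derivative (local_lagrangian \<phi>) (at (chart_map \<phi> p, v)) (0, fst y)"
proof -
  interpret T: smooth_atlas TA by (rule smooth_atlas_tangent)
  have "tvec2 \<phi> p v y \<in> tangent_space TA (chart_vec A \<phi> p v)"
    using T.chart_vec_in_tangent_space tangent_chart_in_atlas chart_vec_in_tangent_chart \<phi> by blast
  then show ?thesis
    using fibre_derivative_in_chart[OF \<phi>] chart_vec_in_tangent_bundle[OF \<phi>] by (simp add: lagrange_form_def)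
qed

lemma cobase_lagrange_form: "v \<in> tangent_bundle A \<Longrightarrow> cobase (lagrange_form v) = v"
  by (simp add: lagrange_form_def)

lemma lagrange_form_in_cotangent_space:
  assumes "v \<in> tangent_bundle A"
  shows "lagrange_form v \<in> cotangent_space TA v"
proof -
  interpret T: smooth_atlas TA by (rule smooth_atlas_tangent)
  obtain \<phi> where \<phi>: "\<phi> \<in> A" "base v \<in> chart_dom \<phi>"
    using assms by (auto simp: tangent_bundle_iff carrier_def)
  let ?z = "(chart_map \<phi> (base v), component v \<phi>)"
  have v: "v = chart_vec A \<phi> (base v) (component v \<phi>)"
    using tangent_bundle_eq_chart_vec assms \<phi> by blast
  have lin: "linear (frechet_derivative (local_lagrangian \<phi>) (at ?z))"
    by (rule frechet_derivative_linear_at[OF C2_local_lagrangian[OF \<phi>(1)]]) (use \<phi> in auto)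
  have dom: "v \<in> chart_dom (tangent_chart A \<phi>)"
    using assms \<phi> by (simp add: chart_dom_tangent_chart)
  have "Covec v (\<lambda>w\<in>tangent_space TA v. deriv (\<lambda>s. L (tvec_add v (tvec_scale s (tproj w)))) 0)
      \<in> cotangent_space TA v"
  proof (rule T.covec_in_cotangent_space[OF tangent_chart_in_atlas[OF \<phi>(1)] dom])
    show "linear (\<lambda>y. frechet_derivative (local_lagrangian \<phi>) (at ?z) (0, fst y))"
      using linear_add[OF lin, of "(0, _)" "(0, _)"] linear_scale[OF lin, of _ "(0, _)"]
      by (intro linearI) simp_all
    fix w assume "w \<in> tangent_space TA v"
    from T.tangent_space_eq_chart_vec[OF this tangent_chart_in_atlas[OF \<phi>(1)] dom]
    have w: "w = tvec2 \<phi> (base v) (component v \<phi>) (component w (tangent_chart A \<phi>))"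
      using v by simp
    show "deriv (\<lambda>s. L (tvec_add v (tvec_scale s (tproj w)))) 0 =
        frechet_derivative (local_lagrangian \<phi>) (at ?z) (0, fst (component w (tangent_chart A \<phi>)))"
      using fibre_derivative_in_chart[OF \<phi>, of "component v \<phi>" "component w (tangent_chart A \<phi>)"]
        v[symmetric] w[symmetric] by simp
  qed
  then show ?thesis using assms by (simp add: lagrange_form_def)
qed

lemma one_form_lagrange_form: "one_form (k - 1) TA lagrange_form"
  unfolding one_form_def C_map_on_def carrier_tangent_atlas
proof (intro conjI ballI)
  show "lagrange_form \<in> (\<Pi>\<^sub>E v\<in>tangent_bundle A. cotangent_space TA v)"
    using lagrange_form_in_cotangent_space by (auto simp: lagrange_form_def)
  fix v assume v: "v \<in> tangent_bundle A"
  obtain \<phi> where \<phi>: "\<phi> \<in> A" "base v \<in> chart_dom \<phi>"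
    using v by (auto simp: tangent_bundle_iff carrier_def)
  let ?U = "chart_img \<phi> \<times> (UNIV :: 'e set)"
  let ?D = "\<lambda>z (b :: 'e \<times> 'e). frechet_derivative (local_lagrangian \<phi>) (at z) (0, fst b)"
  define g where "g = (\<lambda>z :: 'e \<times> 'e. (z, \<Sum>b\<in>Basis. ?D z b *\<^sub>R b))"
  note op = open_local_lagrangian_domain[OF \<phi>(1)]
  have "C_nat_on n ?U g" if n: "enat n \<le> k - 1" for n
    unfolding g_def
  proof (intro C_nat_on_Pair C_nat_on_ident C_nat_on_sum C_nat_on_scaleR C_nat_on_const op)
    fix b :: "'e \<times> 'e"
    have "enat (Suc n) \<le> k"
      using n k by (cases k) (auto simp: numeral_eq_enat one_enat_def)
    then have "C_nat_on (Suc n) ?U (local_lagrangian \<phi>)" by (rule C_nat_on_local_lagrangian[OF \<phi>(1)])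
    then show "C_nat_on n ?U (\<lambda>z. ?D z b)" by simp
  qed
  then have g: "C_on (k - 1) ?U g" by (simp add: C_on_def)
  have dom: "chart_map (tangent_chart A \<phi>) v \<in> ?U" "v \<in> chart_dom (tangent_chart A \<phi>)"
    using v \<phi> by (auto simp: chart_map_tangent_chart chart_dom_tangent_chart)
  have cd: "lagrange_form x \<in> chart_dom (cotangent_chart TA (tangent_chart A \<phi>))"
    if "x \<in> tangent_bundle A \<inter> chart_dom (tangent_chart A \<phi>)" for x
    using that lagrange_form_in_cotangent_space
    by (auto simp: cotangent_chart_def cotangent_bundle_def carrier_tangent_atlas cobase_lagrange_form)
  have cm: "chart_map (cotangent_chart TA (tangent_chart A \<phi>)) (lagrange_form x) = g (chart_map (tangent_chart A \<phi>) x)"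
    if "x \<in> tangent_bundle A \<inter> chart_dom (tangent_chart A \<phi>)" for x
  proof -
    have x: "x \<in> tangent_bundle A" "base x \<in> chart_dom \<phi>" using that by (auto simp: chart_dom_tangent_chart)
    then have xv: "x = chart_vec A \<phi> (base x) (component x \<phi>)"
      using tangent_bundle_eq_chart_vec \<phi>(1) by blast
    have "pairing (lagrange_form x) (chart_vec TA (tangent_chart A \<phi>) x b) =
        ?D (chart_map (tangent_chart A \<phi>) x) b" for b
      using pairing_lagrange_form[OF \<phi>(1) x(2), of "component x \<phi>" b] xv[symmetric]
      by (simp add: chart_map_tangent_chart)
    then show ?thesis
      using x by (simp add: cotangent_chart_def cobase_lagrange_form g_def)
  qed
  show "\<exists>\<Phi>\<in>TA. \<exists>\<Psi>\<in>cotangent_atlas TA. \<exists>W g.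
      v \<in> chart_dom \<Phi> \<and> lagrange_form v \<in> chart_dom \<Psi> \<and> open W \<and> chart_map \<Phi> v \<in> W \<and> C_on (k - 1) W g \<and>
      (\<forall>x\<in>tangent_bundle A \<inter> chart_dom \<Phi>. chart_map \<Phi> x \<in> W \<longrightarrow>
         lagrange_form x \<in> chart_dom \<Psi> \<and> chart_map \<Psi> (lagrange_form x) = g (chart_map \<Phi> x))"
    using tangent_chart_in_atlas[OF \<phi>(1)] dom g op cd cm v
    by (intro bexI[of _ "tangent_chart A \<phi>"] bexI[of _ "cotangent_chart TA (tangent_chart A \<phi>)"]
        exI[of _ ?U] exI[of _ g]) (auto simp: cotangent_atlas_def)
qed

end

section \<open>Differentiating the action\<close>

text \<open>Continuity in the form in which \<open>C_map_on\<close> expresses regularity on sets that are not open.\<close>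

lemma continuous_on_locally_extendable:
  fixes f :: "'a::t2_space \<Rightarrow> 'b::topological_space"
  assumes "\<And>z. z \<in> S \<Longrightarrow> \<exists>W g. open W \<and> z \<in> W \<and> continuous_on W g \<and> (\<forall>y\<in>S \<inter> W. f y = g y)"
  shows "continuous_on S f"
  unfolding continuous_on_eq_continuous_within
proof
  fix z assume z: "z \<in> S"
  then obtain W g where W: "open W" "z \<in> W" "continuous_on W g" "\<forall>y\<in>S \<inter> W. f y = g y" using assms by blast
  have "continuous_on (S \<inter> W) g" using W(3) continuous_on_subset by blast
  then have "continuous_on (S \<inter> W) f"
    using W(4) continuous_on_eq[of "S \<inter> W" g f] by simp
  then have "continuous (at z within (S \<inter> W)) f" using z W(2) by (simp add: continuous_on_eq_continuous_within)
  moreover have "at z within (S \<inter> W) = at z within S"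
    using at_within_nhd[OF W(2,1), of "S \<inter> W" S] by blast
  ultimately show "continuous (at z within S) f" by simp
qed

text \<open>Differentiation under the integral sign. The local \<open>C\<^sup>1\<close> extensions \<open>G\<close> serve to prove that \<open>F\<close> and its
  derivative in \<open>\<epsilon>\<close> are continuous on the strip.\<close>

lemma leibniz_locally_C1:
  fixes F :: "real \<Rightarrow> real \<Rightarrow> real"
  assumes "\<delta> > 0"
    and loc: "\<And>e t. e \<in> {-\<delta><..<\<delta>} \<Longrightarrow> t \<in> {a..b} \<Longrightarrow>
      \<exists>W G. open W \<and> (e, t) \<in> W \<and> C_nat_on 1 W G \<and> (\<forall>e t. (e, t) \<in> W \<longrightarrow> t \<in> {a..b} \<longrightarrow> F e t = G (e, t))"
  defines "F' \<equiv> \<lambda>t. vector_derivative (\<lambda>e. F e t) (at 0)"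
  shows "((\<lambda>e. integral {a..b} (F e)) has_real_derivative integral {a..b} F') (at 0)"
    and "F' integrable_on {a..b}"
proof -
  define U where "U = {-\<delta><..<\<delta>}"
  define Fe where "Fe = (\<lambda>e t. vector_derivative (\<lambda>e. F e t) (at e))"
  have der: "((\<lambda>e. F e t) has_vector_derivative frechet_derivative G (at (e, t)) (1, 0)) (at e)"
    if W: "open W" "(e, t) \<in> W" "C_nat_on 1 W G" and t: "t \<in> {a..b}"
      and eq: "\<forall>e t. (e, t) \<in> W \<longrightarrow> t \<in> {a..b} \<longrightarrow> F e t = G (e, t)" for W G e t
  proof (rule has_vector_derivative_transform_within_open)
    show "((\<lambda>e. G (e, t)) has_vector_derivative frechet_derivative G (at (e, t)) (1, 0)) (at e)"
      by (rule C_nat_on_partial_derivatives(1)[OF W(3) _ W(2)]) simp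
    show "open {s. (s, t) \<in> W}"
      using open_vimage[OF W(1), of "\<lambda>s. (s, t)"]
      by (simp add: vimage_def continuous_on_Pair continuous_on_const continuous_on_id)
  qed (use W t eq in auto)
  have Fe: "((\<lambda>e. F e t) has_vector_derivative Fe e t) (at e)" if "e \<in> U" "t \<in> {a..b}" for e t
    using loc[OF that[unfolded U_def]] der that(2) vector_derivative_works differentiableI_vector
    unfolding Fe_def by metis
  have cont_Fe: "continuous_on (U \<times> {a..b}) (\<lambda>(e, t). Fe e t)"
  proof (rule continuous_on_locally_extendable)
    fix z assume z: "z \<in> U \<times> {a..b}"
    then obtain W G where W: "open W" "z \<in> W" "C_nat_on 1 W G"
        and eq: "\<forall>e t. (e, t) \<in> W \<longrightarrow> t \<in> {a..b} \<longrightarrow> F e t = G (e, t)"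
      using loc[of "fst z" "snd z"] by (auto simp: U_def)
    have "(case y of (e, t) \<Rightarrow> Fe e t) = frechet_derivative G (at y) (1, 0)" if "y \<in> (U \<times> {a..b}) \<inter> W" for y
      using der[OF W(1) _ W(3) _ eq, of "fst y" "snd y"] that vector_derivative_at
      by (auto simp: Fe_def)
    moreover have "continuous_on W (\<lambda>y. frechet_derivative G (at y) (1, 0))" using W(3) by simp
    ultimately show "\<exists>W g. open W \<and> z \<in> W \<and> continuous_on W g \<and>
        (\<forall>y\<in>(U \<times> {a..b}) \<inter> W. (case y of (e, t) \<Rightarrow> Fe e t) = g y)"
      using W by blast
  qed
  have cont_F: "continuous_on (U \<times> {a..b}) (\<lambda>(e, t). F e t)"
  proof (rule continuous_on_locally_extendable)
    fix z assume z: "z \<in> U \<times> {a..b}"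
    then obtain W G where W: "open W" "z \<in> W" "C_nat_on 1 W G"
        and eq: "\<forall>e t. (e, t) \<in> W \<longrightarrow> t \<in> {a..b} \<longrightarrow> F e t = G (e, t)"
      using loc[of "fst z" "snd z"] by (auto simp: U_def)
    then show "\<exists>W g. open W \<and> z \<in> W \<and> continuous_on W g \<and>
        (\<forall>y\<in>(U \<times> {a..b}) \<inter> W. (case y of (e, t) \<Rightarrow> F e t) = g y)"
      using C_nat_on_imp_continuous_on[OF W(3)] by (intro exI[of _ W] exI[of _ G]) auto
  qed
  have slice: "continuous_on {a..b} (h e)"
    if "continuous_on (U \<times> {a..b}) (\<lambda>(e, t). h e t)" "e \<in> U" for h :: "real \<Rightarrow> real \<Rightarrow> real" and e
  proof -
    have "continuous_on {a..b} (\<lambda>t. (\<lambda>(e, t). h e t) (e, t))"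
      by (rule continuous_on_compose2[OF that(1)]) (use that(2) in \<open>auto intro!: continuous_intros\<close>)
    then show ?thesis by simp
  qed
  have 0: "0 \<in> U" using assms(1) by (simp add: U_def)
  have "((\<lambda>e. integral (cbox a b) (F e)) has_real_derivative integral (cbox a b) (Fe 0)) (at 0 within U)"
  proof (rule leibniz_rule_field_derivative[OF _ _ _ 0])
    show "((\<lambda>e. F e t) has_real_derivative Fe e t) (at e within U)" if "e \<in> U" "t \<in> cbox a b" for e t
      using Fe[of e t] that
      by (simp add: has_real_derivative_iff_has_vector_derivative has_vector_derivative_at_within)
    show "F e integrable_on cbox a b" if "e \<in> U" for e
      using integrable_continuous_real[OF slice[OF cont_F that]] by simp
    show "continuous_on (U \<times> cbox a b) (\<lambda>(e, t). Fe e t)" using cont_Fe by simp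
    show "convex U" by (simp add: U_def)
  qed
  moreover have "at 0 within U = at 0" using 0 by (intro at_within_open) (auto simp: U_def)
  moreover have "Fe 0 = F'" by (simp add: Fe_def F'_def)
  ultimately show "((\<lambda>e. integral {a..b} (F e)) has_real_derivative integral {a..b} F') (at 0)" by simp
  show "F' integrable_on {a..b}"
    using integrable_continuous_real[OF slice[OF cont_Fe 0]] \<open>Fe 0 = F'\<close> by simp
qed

context lagrangian
begin

definition euler_lagrange_in_chart :: "('q, 'e) chart \<Rightarrow> (('q, 'e) tvec, 'e \<times> 'e) tvec \<Rightarrow> ('q, 'e) tvec \<Rightarrow> real" where
  "euler_lagrange_in_chart \<phi> w u = euler_lagrange (local_lagrangian \<phi>) (chart_map (tangent_chart A \<phi>) (base w))
     (component w (tangent_chart A \<phi>)) (component u \<phi>)"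

lemma euler_lagrange_in_chart_tvec2:
  assumes "\<phi> \<in> A" "p \<in> chart_dom \<phi>"
  shows "euler_lagrange_in_chart \<phi> (tvec2 \<phi> p v y) (chart_vec A \<phi> p u) = euler_lagrange (local_lagrangian \<phi>) (chart_map \<phi> p, v) y u"
proof -
  interpret T: smooth_atlas TA by (rule smooth_atlas_tangent)
  show ?thesis
    using assms T.component_chart_vec_self[OF tangent_chart_in_atlas chart_vec_in_tangent_chart]
    by (simp add: euler_lagrange_in_chart_def T.base_chart_vec base_chart_vec chart_map_tangent_chart component_chart_vec_self)
qed

lemma lagrangian_along_variation:
  fixes V :: "real \<Rightarrow> real \<Rightarrow> 'q"
  assumes V: "C_map_on 2 std_atlas ({-\<delta><..<\<delta>} \<times> {a..b}) A (\<lambda>(e, t). V e t)" and ab: "a < b"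
    and et: "e \<in> {-\<delta><..<\<delta>}" "t \<in> {a..b}"
  shows "\<exists>W G. open W \<and> (e, t) \<in> W \<and> C_nat_on 1 W G \<and>
    (\<forall>e t. (e, t) \<in> W \<longrightarrow> t \<in> {a..b} \<longrightarrow> L (velocity A {a..b} (V e) t) = G (e, t))"
proof -
  have "\<exists>\<phi>\<in>A. V e t \<in> chart_dom \<phi>" using V et unfolding C_map_on_def by fastforce
  then obtain \<phi> where \<phi>: "\<phi> \<in> A" "V e t \<in> chart_dom \<phi>" by blast
  obtain W g where W: "open W" "(e, t) \<in> W" "W \<subseteq> {-\<delta><..<\<delta>} \<times> UNIV" "C_nat_on 2 W g" "g ` W \<subseteq> chart_img \<phi>"
    and rep: "\<And>e t. (e, t) \<in> W \<Longrightarrow> t \<in> {a..b} \<Longrightarrow> V e t \<in> chart_dom \<phi> \<and> chart_map \<phi> (V e t) = g (e, t)"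
    by (rule variation_in_chart[OF V et \<phi>]) (rule that)
  let ?G = "\<lambda>z. local_lagrangian \<phi> (g z, frechet_derivative g (at z) (0, 1))"
  have L1: "C_nat_on 1 (chart_img \<phi> \<times> UNIV) (local_lagrangian \<phi>)"
    by (rule C_nat_on_lower[OF C2_local_lagrangian[OF \<phi>(1)]]) simp
  have g1: "C_nat_on 1 W g"
    by (rule C_nat_on_lower[OF W(4)]) simp
  have "C_nat_on 1 W (\<lambda>z. frechet_derivative g (at z) (0, 1))"
    using W(4) by (simp add: numeral_2_eq_2)
  then have "C_nat_on 1 W (\<lambda>z. (g z, frechet_derivative g (at z) (0, 1)))"
    by (rule C_nat_on_Pair[OF W(1) g1])
  then have "C_nat_on 1 W ?G"
    by (rule C_nat_on_compose[OF W(1) L1]) (use W(5) in auto)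
  moreover have "L (velocity A {a..b} (V e) t) = ?G (e, t)" if "(e, t) \<in> W" "t \<in> {a..b}" for e t
    using velocities_in_chart(1)[OF \<phi>(1) ab W(1,4) rep that] rep[OF that] \<phi>(1) by (simp add: L_chart_vec)
  ultimately show ?thesis using W(1,2) by (intro exI[of _ W] exI[of _ ?G]) auto
qed

text \<open>The identity of \<open>first_variation_in_coordinates\<close> on the manifold. The left hand side and the first term on
  the right do not mention \<open>\<phi>\<close>.\<close>

lemma pointwise_first_variation:
  fixes V :: "real \<Rightarrow> real \<Rightarrow> 'q"
  assumes V: "C_map_on 2 std_atlas ({-\<delta><..<\<delta>} \<times> {a..b}) A (\<lambda>(e, t). V e t)" "\<delta> > 0" and ab: "a < b"
    and t: "t \<in> {a..b}" and \<phi>: "\<phi> \<in> A" "V 0 t \<in> chart_dom \<phi>"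
  shows "((\<lambda>s. pairing (lagrange_form (velocity A {a..b} (V 0) s)) (delta_q_hat A a b V s)) has_vector_derivative
      vector_derivative (\<lambda>e. L (velocity A {a..b} (V e) t)) (at 0)
      - euler_lagrange_in_chart \<phi> (second_velocity A {a..b} (V 0) t) (delta_q A V t)) (at t within {a..b})"
proof -
  have 0: "0 \<in> {-\<delta><..<\<delta>}" using V(2) by simp
  obtain W g where W: "open W" "(0, t) \<in> W" "W \<subseteq> {-\<delta><..<\<delta>} \<times> UNIV" "C_nat_on 2 W g" "g ` W \<subseteq> chart_img \<phi>"
    and rep: "\<And>e t. (e, t) \<in> W \<Longrightarrow> t \<in> {a..b} \<Longrightarrow> V e t \<in> chart_dom \<phi> \<and> chart_map \<phi> (V e t) = g (e, t)"
    by (rule variation_in_chart[OF V(1) 0 t \<phi>]) (rule that)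
  let ?ge = "\<lambda>z. frechet_derivative g (at z) (1, 0)"
  let ?gt = "\<lambda>z. frechet_derivative g (at z) (0, 1)"
  note vel = velocities_in_chart[OF \<phi>(1) ab W(1,4) rep]
  have slices: "open {e. (e, t) \<in> W}" "open {s. (0, s) \<in> W}"
    using open_vimage[OF W(1), of "\<lambda>e. (e, t)"] open_vimage[OF W(1), of "\<lambda>s. (0, s)"]
    by (simp_all add: vimage_def continuous_on_Pair continuous_on_const continuous_on_id)
  have "(g (0, t), ?gt (0, t)) \<in> chart_img \<phi> \<times> UNIV" using W(2,5) by auto
  note coord = first_variation_in_coordinates[OF open_local_lagrangian_domain[OF \<phi>(1)] C2_local_lagrangian[OF \<phi>(1)] W(1,4,2), OF this]
  let ?D1 = "frechet_derivative (local_lagrangian \<phi>) (at (g (0, t), ?gt (0, t))) (?ge (0, t), frechet_derivative ?gt (at (0, t)) (1, 0))"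
  have "((\<lambda>e. L (velocity A {a..b} (V e) t)) has_vector_derivative ?D1) (at 0)"
  proof (rule has_vector_derivative_transform_within_open[OF coord(1) slices(1)])
    fix e assume "e \<in> {e. (e, t) \<in> W}"
    then have e: "(e, t) \<in> W" by simp
    show "local_lagrangian \<phi> (g (e, t), ?gt (e, t)) = L (velocity A {a..b} (V e) t)"
      using vel(1)[OF _ _ e t] rep[OF e t] \<phi>(1) by (simp add: L_chart_vec)
  qed (use W(2) in simp)
  then have 1: "vector_derivative (\<lambda>e. L (velocity A {a..b} (V e) t)) (at 0) = ?D1"
    by (rule vector_derivative_at)
  have 2: "euler_lagrange_in_chart \<phi> (second_velocity A {a..b} (V 0) t) (delta_q A V t) =
      euler_lagrange (local_lagrangian \<phi>) (g (0, t), ?gt (0, t)) (?gt (0, t), frechet_derivative ?gt (at (0, t)) (0, 1)) (?ge (0, t))"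
    using vel(2)[OF _ _ W(2) t] vel(3)[OF _ _ W(2) t] rep[OF W(2) t] \<phi>
    by (simp add: delta_q_def euler_lagrange_in_chart_tvec2)
  have h: "frechet_derivative (local_lagrangian \<phi>) (at (g (0, s), ?gt (0, s))) (0, ?ge (0, s)) =
      pairing (lagrange_form (velocity A {a..b} (V 0) s)) (delta_q_hat A a b V s)"
    if "(0, s) \<in> W" "s \<in> {a..b}" for s
    using vel(1)[OF _ _ that] vel(4)[OF _ _ that] rep[OF that] \<phi>(1)
    by (simp add: delta_q_hat_def pairing_lagrange_form)
  have ev: "\<forall>\<^sub>F s in nhds t. s \<in> {a..b} \<longrightarrow> frechet_derivative (local_lagrangian \<phi>) (at (g (0, s), ?gt (0, s))) (0, ?ge (0, s)) =
      pairing (lagrange_form (velocity A {a..b} (V 0) s)) (delta_q_hat A a b V s)"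
    by (rule eventually_mono[OF eventually_nhds_in_open[OF slices(2)]]) (use W(2) h in auto)
  show ?thesis
    using coord(2)[of "{a..b}"] has_vector_derivative_cong_ev[OF ev h[OF W(2) t]] 1 2 by simp
qed

text \<open>Evaluate \<open>pointwise_first_variation\<close> in both charts for one and the same variation that realises \<open>w\<close> and
  \<open>u\<close> at \<open>t = 0\<close>: all other terms are free of charts, so the Euler-Lagrange terms agree.\<close>

lemma euler_lagrange_in_chart_independent:
  assumes w: "w \<in> SO" and \<phi>: "\<phi> \<in> A" "base (base w) \<in> chart_dom \<phi>"
    and \<psi>: "\<psi> \<in> A" "base (base w) \<in> chart_dom \<psi>" and u: "u \<in> tangent_space A (base (base w))"
  shows "euler_lagrange_in_chart \<phi> w u = euler_lagrange_in_chart \<psi> w u"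
proof -
  let ?p = "base (base w)"
  obtain v y where wv: "w = tvec2 \<phi> ?p v (v, y)" using second_order_cases[OF w \<phi>] by blast
  let ?\<gamma> = "\<lambda>t. chart_map \<phi> ?p + t *\<^sub>R v + (t * t) *\<^sub>R (y /\<^sub>R 2)"
  obtain R where R: "R > 0"
    "\<And>r t. 0 < r \<Longrightarrow> r \<le> R \<Longrightarrow> t \<in> {-r..r} \<Longrightarrow> chart_map \<phi> ?p + t *\<^sub>R v + (t * t) *\<^sub>R (y /\<^sub>R 2) \<in> chart_img \<phi>"
    using quadratic_curve_in_chart[OF \<phi>] by blast
  have img: "?\<gamma> ` {-R..R} \<subseteq> chart_img \<phi>" using R by blast
  have RR: "-R < R" and 0: "0 \<in> {-R..R}" using R by auto
  note sv = straight_variation[OF \<phi>(1) RR C_nat_on_quadratic C_nat_on_const[of 2 UNIV "component u \<phi>"]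
      quadratic_has_derivative has_vector_derivative_const img]
  define V where "V = (\<lambda>e t. chart_inv \<phi> (?\<gamma> t + e *\<^sub>R component u \<phi>))"
  obtain \<delta> where \<delta>: "\<delta> > 0" "C_map_on 2 std_atlas ({-\<delta><..<\<delta>} \<times> {-R..R}) A (\<lambda>(e, t). V e t)"
    using sv(1) unfolding V_def by blast
  have p: "V 0 0 = ?p" using chart_inv_map[OF \<phi>] by (simp add: V_def)
  have sw: "second_velocity A {-R..R} (V 0) 0 = w"
    using sv(6)[OF 0] chart_inv_map[OF \<phi>] wv[symmetric] by (simp add: V_def)
  have du: "delta_q A V 0 = u"
    using sv(5)[OF 0] chart_inv_map[OF \<phi>] tangent_space_eq_chart_vec[OF u \<phi>, symmetric]
    by (simp add: V_def)
  have "V 0 0 \<in> chart_dom \<phi>" "V 0 0 \<in> chart_dom \<psi>" using \<phi> \<psi> p by simp_all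
  note pw = pointwise_first_variation[OF \<delta>(2,1) RR 0]
  have nb: "at 0 within {-R..R} \<noteq> bot" by (rule at_within_Icc_neq_bot[OF RR 0])
  from vector_derivative_unique_within[OF nb pw[OF \<phi>(1)] pw[OF \<psi>(1)]] show ?thesis
    using p \<phi> \<psi> sw du by simp
qed

text \<open>The choice of the chart is immaterial by \<open>euler_lagrange_in_chart_independent\<close>.\<close>

definition euler_lagrange_map :: "(('q, 'e) tvec, 'e \<times> 'e) tvec \<Rightarrow> ('q, 'e) covec" where
  "euler_lagrange_map = (\<lambda>w\<in>SO. Covec (base (base w)) (\<lambda>u\<in>tangent_space A (base (base w)).
     euler_lagrange_in_chart (SOME \<phi>. \<phi> \<in> A \<and> base (base w) \<in> chart_dom \<phi>) w u))"

lemma chart_at_second_order: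
  assumes "w \<in> SO"
  obtains \<phi> where "\<phi> \<in> A" "base (base w) \<in> chart_dom \<phi>"
proof -
  obtain a b c where w: "w = second_velocity A {a..b} c 0" and ab: "a < 0" "0 < b"
    and c: "C_map_on 2 std_atlas {a..b} A c"
    using assms(1) unfolding second_order_submanifold_def by blast
  have "base (base w) = c 0" by (simp add: w second_velocity_def velocity_def)
  moreover have "0 \<in> {a..b}" using ab by simp
  ultimately show ?thesis using c that unfolding C_map_on_def by metis
qed

lemma pairing_euler_lagrange_map:
  assumes w: "w \<in> SO" and \<phi>: "\<phi> \<in> A" "base (base w) \<in> chart_dom \<phi>" and u: "u \<in> tangent_space A (base (base w))"
  shows "pairing (euler_lagrange_map w) u = euler_lagrange_in_chart \<phi> w u"
proof -
  let ?\<psi> = "SOME \<phi>. \<phi> \<in> A \<and> base (base w) \<in> chart_dom \<phi>"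
  have "?\<psi> \<in> A \<and> base (base w) \<in> chart_dom ?\<psi>"
    using \<phi> by (intro someI[of "\<lambda>\<phi>. \<phi> \<in> A \<and> base (base w) \<in> chart_dom \<phi>"]) simp
  then show ?thesis using euler_lagrange_in_chart_independent[OF w, of ?\<psi> \<phi> u] w \<phi> u by (simp add: euler_lagrange_map_def)
qed

lemma cobase_euler_lagrange_map: "w \<in> SO \<Longrightarrow> cobase (euler_lagrange_map w) = base (base w)"
  by (simp add: euler_lagrange_map_def)

lemma euler_lagrange_map_in_cotangent_space:
  assumes "w \<in> SO"
  shows "euler_lagrange_map w \<in> cotangent_space A (base (base w))"
proof -
  let ?p = "base (base w)"
  obtain \<phi> where \<phi>: "\<phi> \<in> A" "?p \<in> chart_dom \<phi>" using chart_at_second_order[OF assms] .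
  obtain v y where w: "w = tvec2 \<phi> ?p v (v, y)" using second_order_cases[OF assms \<phi>] by blast
  have "euler_lagrange_in_chart \<phi> w u = euler_lagrange (local_lagrangian \<phi>) (chart_map \<phi> ?p, v) (v, y) (component u \<phi>)"
    if "u \<in> tangent_space A ?p" for u
    using euler_lagrange_in_chart_tvec2[OF \<phi>, of v "(v, y)" "component u \<phi>"] w[symmetric]
      tangent_space_eq_chart_vec[OF that \<phi>, symmetric] by simp
  moreover have "linear (euler_lagrange (local_lagrangian \<phi>) (chart_map \<phi> ?p, v) (v, y))"
    by (rule linear_euler_lagrange[OF open_local_lagrangian_domain[OF \<phi>(1)] C2_local_lagrangian[OF \<phi>(1)]]) (use \<phi> in auto)
  ultimately have "Covec ?p (restrict (euler_lagrange_in_chart \<phi> w) (tangent_space A ?p)) \<in> cotangent_space A ?p"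
    by (intro covec_in_cotangent_space[OF \<phi>]) auto
  moreover have "euler_lagrange_map w = Covec ?p (restrict (euler_lagrange_in_chart \<phi> w) (tangent_space A ?p))"
  proof (rule covec.expand, intro conjI)
    show "pairing (euler_lagrange_map w) = pairing (Covec ?p (restrict (euler_lagrange_in_chart \<phi> w) (tangent_space A ?p)))"
    proof
      fix u show "pairing (euler_lagrange_map w) u = pairing (Covec ?p (restrict (euler_lagrange_in_chart \<phi> w) (tangent_space A ?p))) u"
        using pairing_euler_lagrange_map[OF assms \<phi>, of u] assms by (cases "u \<in> tangent_space A ?p") (simp_all add: euler_lagrange_map_def)
    qed
  qed (simp add: cobase_euler_lagrange_map assms)
  ultimately show ?thesis by simp
qed

lemma C_map_on_euler_lagrange_map: "C_map_on (k - 2) (tangent_atlas TA) SO (cotangent_atlas A) euler_lagrange_map"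
  unfolding C_map_on_def
proof
  interpret T: smooth_atlas TA by (rule smooth_atlas_tangent)
  fix w assume w: "w \<in> SO"
  obtain \<phi> where \<phi>: "\<phi> \<in> A" "base (base w) \<in> chart_dom \<phi>" using chart_at_second_order[OF w] .
  let ?\<Phi> = "tangent_chart TA (tangent_chart A \<phi>)"
  let ?U = "(chart_img \<phi> \<times> (UNIV :: 'e set)) \<times> (UNIV :: ('e \<times> 'e) set)"
  define g where "g = (\<lambda>z :: ('e \<times> 'e) \<times> ('e \<times> 'e).
    (fst (fst z), \<Sum>b\<in>Basis. euler_lagrange (local_lagrangian \<phi>) (fst z) (snd z) b *\<^sub>R b))"
  have op: "open ?U" by (rule open_Times[OF open_local_lagrangian_domain[OF \<phi>(1)] open_UNIV])
  have "C_nat_on n ?U g" if n: "enat n \<le> k - 2" for n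
    unfolding g_def
  proof (intro C_nat_on_Pair C_nat_on_sum C_nat_on_scaleR C_nat_on_const op)
    show "C_nat_on n ?U (\<lambda>z. fst (fst z))"
      by (rule C_nat_on_linear_compose[OF op bounded_linear_fst C_nat_on_fst])
    fix b :: 'e
    have "enat (n + 2) \<le> k"
      using n k by (cases k) (auto simp: numeral_eq_enat)
    then have "C_nat_on (n + 2) (chart_img \<phi> \<times> UNIV) (local_lagrangian \<phi>)" by (rule C_nat_on_local_lagrangian[OF \<phi>(1)])
    then show "C_nat_on n ?U (\<lambda>z. euler_lagrange (local_lagrangian \<phi>) (fst z) (snd z) b)"
      by (rule C_nat_on_euler_lagrange[OF open_local_lagrangian_domain[OF \<phi>(1)]])
  qed
  then have g: "C_on (k - 2) ?U g" by (simp add: C_on_def)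
  have dom: "w \<in> chart_dom ?\<Phi>"
  proof -
    obtain v y where "w = tvec2 \<phi> (base (base w)) v (v, y)" using second_order_cases[OF w \<phi>] by blast
    then show ?thesis
      using T.chart_vec_in_tangent_chart[OF tangent_chart_in_atlas[OF \<phi>(1)] chart_vec_in_tangent_chart[OF \<phi>]] by metis
  qed
  have base: "base (base x) \<in> chart_dom \<phi>" if "x \<in> chart_dom ?\<Phi>" for x
    using that by (simp add: T.chart_dom_tangent_chart chart_dom_tangent_chart)
  have in_U: "chart_map ?\<Phi> x \<in> ?U" if "x \<in> chart_dom ?\<Phi>" for x
    using base[OF that] by (simp add: T.chart_map_tangent_chart chart_map_tangent_chart)
  have cd: "euler_lagrange_map x \<in> chart_dom (cotangent_chart A \<phi>)" if "x \<in> SO \<inter> chart_dom ?\<Phi>" for x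
    using that base[of x] euler_lagrange_map_in_cotangent_space[of x] in_carrier[OF \<phi>(1)]
    by (auto simp: cotangent_chart_def cotangent_bundle_def cobase_euler_lagrange_map)
  have cm: "chart_map (cotangent_chart A \<phi>) (euler_lagrange_map x) = g (chart_map ?\<Phi> x)" if "x \<in> SO \<inter> chart_dom ?\<Phi>" for x
  proof -
    have x: "x \<in> SO" "base (base x) \<in> chart_dom \<phi>" using that base by auto
    have "pairing (euler_lagrange_map x) (chart_vec A \<phi> (base (base x)) b) =
        euler_lagrange (local_lagrangian \<phi>) (fst (chart_map ?\<Phi> x)) (snd (chart_map ?\<Phi> x)) b" for b
      using pairing_euler_lagrange_map[OF x(1) \<phi>(1) x(2) chart_vec_in_tangent_space[OF \<phi>(1) x(2)]] \<phi>(1) x(2)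
      by (simp add: euler_lagrange_in_chart_def component_chart_vec_self T.chart_map_tangent_chart)
    then show ?thesis
      using x(1) by (simp add: cotangent_chart_def cobase_euler_lagrange_map g_def T.chart_map_tangent_chart chart_map_tangent_chart)
  qed
  show "\<exists>\<Phi>\<in>tangent_atlas TA. \<exists>\<Psi>\<in>cotangent_atlas A. \<exists>W g.
      w \<in> chart_dom \<Phi> \<and> euler_lagrange_map w \<in> chart_dom \<Psi> \<and> open W \<and> chart_map \<Phi> w \<in> W \<and> C_on (k - 2) W g \<and>
      (\<forall>x\<in>SO \<inter> chart_dom \<Phi>. chart_map \<Phi> x \<in> W \<longrightarrow>
         euler_lagrange_map x \<in> chart_dom \<Psi> \<and> chart_map \<Psi> (euler_lagrange_map x) = g (chart_map \<Phi> x))"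
    by (rule bexI[of _ ?\<Phi>], rule bexI[of _ "cotangent_chart A \<phi>"], rule exI[of _ ?U], rule exI[of _ g])
       (use dom g op in_U cd cm w \<phi> T.tangent_chart_in_atlas tangent_chart_in_atlas in \<open>simp_all add: cotangent_atlas_def\<close>)
qed

text \<open>The pointwise identity holds at each \<open>t\<close> in a chart around \<open>q(t)\<close>, but each of its terms is a function on
  \<open>[a, b]\<close> defined without charts. So the fundamental theorem of calculus applies to the whole interval, and
  it also shows that the Euler-Lagrange term is integrable.\<close>

theorem first_variation:
  assumes ab: "a < b" and var: "C2_variation A a b q V"
  shows "first_variation_formula A L euler_lagrange_map lagrange_form a b q V"
proof -
  obtain \<delta> where \<delta>: "\<delta> > 0" "C_map_on 2 std_atlas ({-\<delta><..<\<delta>} \<times> {a..b}) A (\<lambda>(e, t). V e t)"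
    and q: "\<And>t. t \<in> {a..b} \<Longrightarrow> V 0 t = q t"
    using var unfolding C2_variation_def by blast
  have vq: "velocity A {a..b} q t = velocity A {a..b} (V 0) t"
    and sq: "second_velocity A {a..b} q t = second_velocity A {a..b} (V 0) t" if "t \<in> {a..b}" for t
    using velocity_cong[of "{a..b}" q "V 0" t A] second_velocity_cong[of "{a..b}" q "V 0" t A] q that by simp_all
  define F where "F = (\<lambda>e t. L (velocity A {a..b} (V e) t))"
  define F' where "F' = (\<lambda>t. vector_derivative (\<lambda>e. F e t) (at 0))"
  define f where "f = (\<lambda>t. pairing (euler_lagrange_map (second_velocity A {a..b} q t)) (delta_q A V t))"
  define h where "h = (\<lambda>t. pairing (lagrange_form (velocity A {a..b} q t)) (delta_q_hat A a b V t))"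
  have leib: "((\<lambda>e. integral {a..b} (F e)) has_real_derivative integral {a..b} F') (at 0)"
      "F' integrable_on {a..b}"
    using leibniz_locally_C1[OF \<delta>(1) lagrangian_along_variation[OF \<delta>(2) ab]]
    unfolding F_def F'_def by blast+
  have "(h has_vector_derivative F' t - f t) (at t within {a..b})" if t: "t \<in> {a..b}" for t
  proof -
    have "\<exists>\<phi>\<in>A. V 0 t \<in> chart_dom \<phi>" using \<delta> t unfolding C_map_on_def by fastforce
    then obtain \<phi> where \<phi>: "\<phi> \<in> A" "V 0 t \<in> chart_dom \<phi>" by blast
    have 0: "0 \<in> {-\<delta><..<\<delta>}" using \<delta>(1) by simp
    obtain W g where W: "open W" "(0, t) \<in> W" "W \<subseteq> {-\<delta><..<\<delta>} \<times> UNIV" "C_nat_on 2 W g" "g ` W \<subseteq> chart_img \<phi>"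
      and rep: "\<And>e t. (e, t) \<in> W \<Longrightarrow> t \<in> {a..b} \<Longrightarrow> V e t \<in> chart_dom \<phi> \<and> chart_map \<phi> (V e t) = g (e, t)"
      by (rule variation_in_chart[OF \<delta>(2) 0 t \<phi>]) (rule that)
    note vel = velocities_in_chart[OF \<phi>(1) ab W(1,4) rep W(2) t]
    have "second_velocity A {a..b} (V 0) t \<in> SO" using vel(3) tvec2_in_SO[OF \<phi>] by simp
    moreover have "base (base (second_velocity A {a..b} (V 0) t)) = V 0 t"
      by (simp add: second_velocity_def velocity_def)
    moreover have "delta_q A V t \<in> tangent_space A (V 0 t)"
      using vel(2) chart_vec_in_tangent_space[OF \<phi>] by (simp add: delta_q_def)
    ultimately have "f t = euler_lagrange_in_chart \<phi> (second_velocity A {a..b} (V 0) t) (delta_q A V t)"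
      using pairing_euler_lagrange_map[of "second_velocity A {a..b} (V 0) t" \<phi>] \<phi> sq[OF t] by (simp add: f_def)
    then have "((\<lambda>s. pairing (lagrange_form (velocity A {a..b} (V 0) s)) (delta_q_hat A a b V s))
        has_vector_derivative F' t - f t) (at t within {a..b})"
      using pointwise_first_variation[OF \<delta>(2,1) ab t \<phi>] by (simp add: F'_def F_def)
    then show ?thesis
      by (rule has_vector_derivative_transform[OF t, rotated]) (simp add: h_def vq)
  qed
  then have "((\<lambda>t. F' t - f t) has_integral h b - h a) {a..b}"
    using ab by (intro fundamental_theorem_of_calculus) auto
  from has_integral_diff[OF integrable_integral[OF leib(2)] this]
  have "(f has_integral integral {a..b} F' - (h b - h a)) {a..b}" by simp
  then have "integral {a..b} F' = integral {a..b} f + (h b - h a)" by (simp add: integral_unique)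
  then show ?thesis
    using leib(1) by (simp add: first_variation_formula_def action_def F_def f_def h_def)
qed

end

section \<open>Uniqueness\<close>

context smooth_atlas
begin

lemma cotangent_bundle_cobase: "\<alpha> \<in> cotangent_bundle A \<Longrightarrow> \<alpha> \<in> cotangent_space A (cobase \<alpha>)"
  by (auto simp: cotangent_bundle_def cotangent_space_def)

lemma pairing_zero_vec:
  assumes "\<alpha> \<in> cotangent_space A p" "\<phi> \<in> A" "p \<in> chart_dom \<phi>"
  shows "pairing \<alpha> (chart_vec A \<phi> p 0) = 0"
  using linear_0[OF linear_pairing_chart_vec[OF assms]] .

lemma pairing_eq_inner:
  assumes "\<alpha> \<in> cotangent_space A p" "\<phi> \<in> A" "p \<in> chart_dom \<phi>"
  shows "pairing \<alpha> (chart_vec A \<phi> p e) = e \<bullet> snd (chart_map (cotangent_chart A \<phi>) \<alpha>)"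
proof -
  have "cobase \<alpha> = p" using assms(1) by (simp add: cotangent_space_def)
  then show ?thesis
    using linear_sum_Basis[OF linear_pairing_chart_vec[OF assms], of e]
    by (simp add: cotangent_chart_def inner_sum_right mult.commute)
qed

text \<open>The smoothness of \<open>D\<close> refers to unknown charts \<open>\<Phi>\<close> and \<open>\<Psi>\<close> around a point and its image. Moving the curve
  into \<open>\<Phi>\<close> and the constant components \<open>u\<close> into the chart under \<open>\<Psi>\<close> by changes of charts writes the
  pairing as an inner product of continuous functions.\<close>

lemma continuous_on_pairing_along_curve:
  fixes \<gamma> \<gamma>' \<gamma>'' :: "real \<Rightarrow> 'e"
  assumes D: "C_map_on r (tangent_atlas TA) SO (cotangent_atlas A) D"
      "\<And>w. w \<in> SO \<Longrightarrow> D w \<in> cotangent_space A (base (base w))"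
    and \<phi>: "\<phi> \<in> A"
    and cont: "continuous_on UNIV \<gamma>" "continuous_on UNIV \<gamma>'" "continuous_on UNIV \<gamma>''"
    and img: "\<gamma> ` S \<subseteq> chart_img \<phi>"
  shows "continuous_on S (\<lambda>t. pairing (D (tvec2 \<phi> (chart_inv \<phi> (\<gamma> t)) (\<gamma>' t) (\<gamma>' t, \<gamma>'' t)))
    (chart_vec A \<phi> (chart_inv \<phi> (\<gamma> t)) u))"
proof (rule continuous_on_locally_extendable)
  interpret T: smooth_atlas TA by (rule smooth_atlas_tangent)
  interpret TTQ: smooth_atlas "tangent_atlas TA" by (rule T.smooth_atlas_tangent)
  define c where "c = (\<lambda>t. chart_inv \<phi> (\<gamma> t))"
  define w where "w = (\<lambda>t. tvec2 \<phi> (c t) (\<gamma>' t) (\<gamma>' t, \<gamma>'' t))"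
  define X where "X = (\<lambda>t. ((\<gamma> t, \<gamma>' t), (\<gamma>' t, \<gamma>'' t)))"
  let ?\<Phi>0 = "tangent_chart TA (tangent_chart A \<phi>)"
  have \<Phi>0: "?\<Phi>0 \<in> tangent_atlas TA" using \<phi> tangent_chart_in_atlas T.tangent_chart_in_atlas by blast
  have c: "c t \<in> chart_dom \<phi>" "chart_map \<phi> (c t) = \<gamma> t" if "t \<in> S" for t
    using that img chart_inv_in[of "\<gamma> t" \<phi>] chart_map_inv[of "\<gamma> t" \<phi>] by (auto simp: c_def)
  have w: "w t \<in> SO" "w t \<in> chart_dom ?\<Phi>0" "chart_map ?\<Phi>0 (w t) = X t" "base (base (w t)) = c t"
    if "t \<in> S" for t
  proof -
    note td = tangent_chart_in_atlas[OF \<phi>] chart_vec_in_tangent_chart[OF \<phi> c(1)[OF that]]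
    show "w t \<in> SO" unfolding w_def using tvec2_in_SO[OF \<phi> c(1)[OF that]] .
    show "w t \<in> chart_dom ?\<Phi>0" unfolding w_def by (rule T.chart_vec_in_tangent_chart[OF td])
    show "chart_map ?\<Phi>0 (w t) = X t"
      unfolding w_def X_def using c[OF that] \<phi>
      by (simp add: T.chart_map_tangent_chart chart_map_tangent_chart T.base_chart_vec base_chart_vec
          T.component_chart_vec_self[OF td] component_chart_vec_self)
    show "base (base (w t)) = c t" by (simp add: w_def T.base_chart_vec base_chart_vec)
  qed
  have X: "continuous_on UNIV X" unfolding X_def using cont by (intro continuous_on_Pair)
  fix t assume t: "t \<in> S"
  have "\<exists>\<Phi>\<in>tangent_atlas TA. \<exists>\<Psi>\<in>cotangent_atlas A. \<exists>W g.
      w t \<in> chart_dom \<Phi> \<and> D (w t) \<in> chart_dom \<Psi> \<and> open W \<and> chart_map \<Phi> (w t) \<in> W \<and> C_on r W g \<and>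
      (\<forall>x\<in>SO \<inter> chart_dom \<Phi>. chart_map \<Phi> x \<in> W \<longrightarrow>
         D x \<in> chart_dom \<Psi> \<and> chart_map \<Psi> (D x) = g (chart_map \<Phi> x))"
    using bspec[OF D(1)[unfolded C_map_on_def] w(1)[OF t]] .
  then obtain \<Phi> \<Psi> W g where \<Phi>: "\<Phi> \<in> tangent_atlas TA" "w t \<in> chart_dom \<Phi>"
    and \<Psi>: "\<Psi> \<in> cotangent_atlas A" "D (w t) \<in> chart_dom \<Psi>"
    and W: "open W" "chart_map \<Phi> (w t) \<in> W" "C_on r W g"
    and rep: "\<And>x. x \<in> SO \<Longrightarrow> x \<in> chart_dom \<Phi> \<Longrightarrow> chart_map \<Phi> x \<in> W \<Longrightarrow> chart_map \<Psi> (D x) = g (chart_map \<Phi> x)"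
    by blast
  obtain \<psi> where \<psi>: "\<psi> \<in> A" "\<Psi> = cotangent_chart A \<psi>" using \<Psi>(1) by (auto simp: cotangent_atlas_def)
  have "cobase (D (w t)) = c t" using D(2)[OF w(1)[OF t]] w(4)[OF t] by (simp add: cotangent_space_def)
  then have ct: "c t \<in> chart_dom \<psi>" using \<Psi>(2) by (simp add: \<psi>(2) cotangent_chart_def)
  have gcont: "continuous_on W g" using C_onD[OF W(3), of 0] by (simp add: zero_enat_def[symmetric])
  let ?O = "chart_map ?\<Phi>0 ` (chart_dom ?\<Phi>0 \<inter> chart_dom \<Phi>)"
  let ?T = "transition ?\<Phi>0 \<Phi>"
  let ?P = "chart_map \<phi> ` (chart_dom \<phi> \<inter> chart_dom \<psi>)"
  have Tcont: "continuous_on ?O ?T"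
    using TTQ.C_nat_on_transition[OF \<Phi>0 \<Phi>(1), of 0] by simp
  have dcont: "continuous_on ?P (\<lambda>x. frechet_derivative (transition \<phi> \<psi>) (at x) u)"
    using C_nat_on_transition[OF \<phi> \<psi>(1), of 1] by simp
  define J where "J = (X -` (?O \<inter> ?T -` W)) \<inter> \<gamma> -` ?P"
  have "open (?O \<inter> ?T -` W)"
    using continuous_open_preimage[OF Tcont TTQ.open_overlap[OF \<Phi>0 \<Phi>(1)] W(1)] .
  then have "open J"
    unfolding J_def
    by (rule open_Int[OF open_vimage[OF _ X] open_vimage[OF open_overlap[OF \<phi> \<psi>(1)] cont(1)]])
  have X_in: "X s \<in> ?O" "?T (X s) = chart_map \<Phi> (w s)" if "s \<in> S" "w s \<in> chart_dom \<Phi>" for s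
    using w[OF that(1)] that TTQ.transition_chart[OF \<Phi>0 w(2)[OF that(1)], of \<Phi>] by (auto intro!: rev_image_eqI)
  have "t \<in> J"
    using X_in[OF t \<Phi>(2)] W(2) c[OF t] ct by (auto simp: J_def intro!: rev_image_eqI)
  define F where "F = (\<lambda>s. frechet_derivative (transition \<phi> \<psi>) (at (\<gamma> s)) u \<bullet> snd (g (?T (X s))))"
  have "continuous_on J F"
    unfolding F_def
    by (intro continuous_on_inner continuous_on_snd continuous_on_compose2[OF dcont, of J \<gamma>]
        continuous_on_compose2[OF gcont, of J "\<lambda>s. ?T (X s)"] continuous_on_compose2[OF Tcont, of J X]
        continuous_on_subset[OF X] continuous_on_subset[OF cont(1)])
      (auto simp: J_def)
  moreover have "pairing (D (w s)) (chart_vec A \<phi> (c s) u) = F s" if s: "s \<in> S \<inter> J" for s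
  proof -
    have sS: "s \<in> S" and "X s \<in> ?O" "?T (X s) \<in> W" "\<gamma> s \<in> ?P" using s by (auto simp: J_def)
    have "w s \<in> chart_dom \<Phi>"
    proof -
      obtain x where x: "x \<in> chart_dom ?\<Phi>0" "x \<in> chart_dom \<Phi>" "X s = chart_map ?\<Phi>0 x" using \<open>X s \<in> ?O\<close> by blast
      have "w s = x"
        using inj_onD[OF TTQ.inj_chart[OF \<Phi>0] _ w(2)[OF sS] x(1)] w(3)[OF sS] x(3) by simp
      then show ?thesis using x(2) by simp
    qed
    have cs: "c s \<in> chart_dom \<psi>"
    proof -
      obtain p where p: "p \<in> chart_dom \<phi>" "p \<in> chart_dom \<psi>" "\<gamma> s = chart_map \<phi> p" using \<open>\<gamma> s \<in> ?P\<close> by blast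
      then show ?thesis using chart_inv_map[OF \<phi> p(1)] by (simp add: c_def)
    qed
    have "chart_map \<Psi> (D (w s)) = g (?T (X s))"
      using rep[OF w(1)[OF sS] \<open>w s \<in> chart_dom \<Phi>\<close>] X_in[OF sS \<open>w s \<in> chart_dom \<Phi>\<close>] \<open>?T (X s) \<in> W\<close> by simp
    moreover have "D (w s) \<in> cotangent_space A (c s)" using D(2)[OF w(1)[OF sS]] w(4)[OF sS] by simp
    ultimately show ?thesis
      using chart_vec_change[OF \<phi> \<psi>(1) c(1)[OF sS] cs, of u] pairing_eq_inner[OF _ \<psi>(1) cs] c(2)[OF sS]
      by (simp add: F_def \<psi>(2))
  qed
  ultimately show "\<exists>W g. open W \<and> t \<in> W \<and> continuous_on W g \<and>
      (\<forall>s\<in>S \<inter> W. pairing (D (tvec2 \<phi> (chart_inv \<phi> (\<gamma> s)) (\<gamma>' s) (\<gamma>' s, \<gamma>'' s)))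
        (chart_vec A \<phi> (chart_inv \<phi> (\<gamma> s)) u) = g s)"
    using \<open>open J\<close> \<open>t \<in> J\<close> unfolding w_def c_def by blast
qed

end

context lagrangian
begin

text \<open>The property that the theorem asserts to have a unique solution.\<close>

definition first_variation_pair ::
  "((('q, 'e) tvec, 'e \<times> 'e) tvec \<Rightarrow> ('q, 'e) covec) \<Rightarrow>
   (('q, 'e) tvec \<Rightarrow> (('q, 'e) tvec, 'e \<times> 'e) covec) \<Rightarrow> bool" where
  "first_variation_pair D \<theta> \<longleftrightarrow>
     D \<in> SO \<rightarrow>\<^sub>E cotangent_bundle A \<and>
     (\<forall>w\<in>SO. cobase (D w) = base (base w)) \<and>
     C_map_on (k - 2) (tangent_atlas TA) SO (cotangent_atlas A) D \<and>
     one_form (k - 1) TA \<theta> \<and>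
     (\<forall>a b q V. a < b \<longrightarrow> C2_variation A a b q V \<longrightarrow> first_variation_formula A L D \<theta> a b q V)"

lemma first_variation_pair_existence: "first_variation_pair euler_lagrange_map lagrange_form"
proof -
  have "euler_lagrange_map w \<in> cotangent_bundle A" if "w \<in> SO" for w
    using euler_lagrange_map_in_cotangent_space[OF that] chart_at_second_order[OF that] in_carrier
    unfolding cotangent_bundle_def by blast
  moreover have "euler_lagrange_map w = undefined" if "w \<notin> SO" for w using that by (simp add: euler_lagrange_map_def)
  ultimately show ?thesis
    unfolding first_variation_pair_def
    using cobase_euler_lagrange_map C_map_on_euler_lagrange_map one_form_lagrange_form first_variation by auto
qed

lemma first_variation_pairD:
  assumes "first_variation_pair D \<theta>"
  shows "w \<in> SO \<Longrightarrow> D w \<in> cotangent_space A (base (base w))"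
    and "v \<in> tangent_bundle A \<Longrightarrow> \<theta> v \<in> cotangent_space TA v"
    and "C_map_on (k - 2) (tangent_atlas TA) SO (cotangent_atlas A) D"
    and "a < b \<Longrightarrow> C2_variation A a b q V \<Longrightarrow> first_variation_formula A L D \<theta> a b q V"
proof -
  show "D w \<in> cotangent_space A (base (base w))" if "w \<in> SO"
  proof -
    have "D w \<in> cotangent_bundle A" "cobase (D w) = base (base w)"
      using assms that by (auto simp: first_variation_pair_def)
    then show ?thesis using cotangent_bundle_cobase by metis
  qed
  show "\<theta> v \<in> cotangent_space TA v" if "v \<in> tangent_bundle A"
    using assms that by (auto simp: first_variation_pair_def one_form_def carrier_tangent_atlas)
qed (use assms in \<open>auto simp: first_variation_pair_def\<close>)

lemma first_variation_pair_compare: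
  assumes "first_variation_pair D \<theta>" "first_variation_pair D' \<theta>'" "a < b" "C2_variation A a b q V"
  shows "integral {a..b} (\<lambda>t. pairing (D (second_velocity A {a..b} q t)) (delta_q A V t))
      + (pairing (\<theta> (velocity A {a..b} q b)) (delta_q_hat A a b V b)
         - pairing (\<theta> (velocity A {a..b} q a)) (delta_q_hat A a b V a))
    = integral {a..b} (\<lambda>t. pairing (D' (second_velocity A {a..b} q t)) (delta_q A V t))
      + (pairing (\<theta>' (velocity A {a..b} q b)) (delta_q_hat A a b V b)
         - pairing (\<theta>' (velocity A {a..b} q a)) (delta_q_hat A a b V a))"
  using first_variation_pairD(4)[OF assms(1,3,4)] first_variation_pairD(4)[OF assms(2,3,4)]
  unfolding first_variation_formula_def by (rule DERIV_unique)

lemma boundary_term_zero: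
  assumes "first_variation_pair D \<theta>" "\<phi> \<in> A" "p \<in> chart_dom \<phi>"
  shows "pairing (\<theta> (chart_vec A \<phi> p v)) (tvec2 \<phi> p v (0, 0)) = 0"
proof -
  interpret T: smooth_atlas TA by (rule smooth_atlas_tangent)
  show ?thesis
    using T.pairing_zero_vec[OF first_variation_pairD(2)[OF assms(1) chart_vec_in_tangent_bundle[OF assms(2,3)]]
      tangent_chart_in_atlas[OF assms(2)] chart_vec_in_tangent_chart[OF assms(2,3)]]
    by (simp add: zero_prod_def)
qed

text \<open>The fundamental lemma of the calculus of variations. If the inequality failed at \<open>w\<close> and \<open>u\<close>, then by
  continuity the difference \<open>H\<close> of the two pairings would be positive along a short quadratic curve through \<open>w\<close>;
  testing with \<open>\<eta> u\<close> for a bump \<open>\<eta>\<close> that kills the boundary terms gives \<open>\<integral> \<eta> H = 0\<close>, which is absurd.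
  An inequality, rather than an equation, is proved because the two pairs enter symmetrically.\<close>

lemma euler_lagrange_pairing_le:
  assumes fvp: "first_variation_pair D \<theta>" "first_variation_pair D' \<theta>'"
    and w: "w \<in> SO" and u: "u \<in> tangent_space A (base (base w))"
  shows "pairing (D w) u \<le> pairing (D' w) u"
proof (rule ccontr)
  assume less: "\<not> pairing (D w) u \<le> pairing (D' w) u"
  let ?p = "base (base w)"
  obtain \<phi> where \<phi>: "\<phi> \<in> A" "?p \<in> chart_dom \<phi>" using chart_at_second_order[OF w] .
  obtain v y where wv: "w = tvec2 \<phi> ?p v (v, y)" using second_order_cases[OF w \<phi>] by blast
  define u0 where "u0 = component u \<phi>"
  have u0: "chart_vec A \<phi> ?p u0 = u" using tangent_space_eq_chart_vec[OF u \<phi>] by (simp add: u0_def)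
  define \<gamma> where "\<gamma> = (\<lambda>t. chart_map \<phi> ?p + t *\<^sub>R v + (t * t) *\<^sub>R (y /\<^sub>R 2))"
  define \<gamma>' where "\<gamma>' = (\<lambda>t. v + t *\<^sub>R y)"
  have \<gamma>: "(\<gamma> has_vector_derivative \<gamma>' t) (at t)" "(\<gamma>' has_vector_derivative y) (at t)" for t
    unfolding \<gamma>_def \<gamma>'_def by (rule quadratic_has_derivative)+
  have \<gamma>C: "C_nat_on 2 UNIV \<gamma>" unfolding \<gamma>_def by (rule C_nat_on_quadratic)
  obtain R where R: "R > 0" "\<And>r t. 0 < r \<Longrightarrow> r \<le> R \<Longrightarrow> t \<in> {-r..r} \<Longrightarrow> \<gamma> t \<in> chart_img \<phi>"
    using quadratic_curve_in_chart[OF \<phi>] unfolding \<gamma>_def by blast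
  define c where "c = (\<lambda>t. chart_inv \<phi> (\<gamma> t))"
  have c0: "c 0 = ?p" using chart_inv_map[OF \<phi>] by (simp add: c_def \<gamma>_def)
  define G where "G = (\<lambda>D t. pairing (D (tvec2 \<phi> (c t) (\<gamma>' t) (\<gamma>' t, y))) (chart_vec A \<phi> (c t) u0))"
  have imgR: "\<gamma> ` {-R..R} \<subseteq> chart_img \<phi>" using R by blast
  have cont: "continuous_on {-R..R} (G E)" if "first_variation_pair E \<eta>" for E \<eta>
    unfolding G_def c_def
  proof (rule continuous_on_pairing_along_curve[OF first_variation_pairD(3)[OF that]
        first_variation_pairD(1)[OF that] \<phi>(1) _ _ continuous_on_const imgR])
    show "continuous_on UNIV \<gamma>" "continuous_on UNIV \<gamma>'"
      using \<gamma> by (auto intro!: continuous_at_imp_continuous_on has_vector_derivative_continuous)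
  qed
  define H where "H = (\<lambda>t. G D t - G D' t)"
  have Hc: "continuous_on {-R..R} H" unfolding H_def by (intro continuous_on_diff cont[OF fvp(1)] cont[OF fvp(2)])
  have H0: "H 0 > 0"
    using less u0 wv[symmetric] c0 by (simp add: H_def G_def \<gamma>'_def)
  obtain d where d: "d > 0" "\<And>t. t \<in> {-R..R} \<Longrightarrow> \<bar>t\<bar> < d \<Longrightarrow> H t > 0"
  proof -
    have "0 \<in> {-R..R}" using R by simp
    then obtain d where "d > 0" "\<forall>t\<in>{-R..R}. dist t 0 < d \<longrightarrow> dist (H t) (H 0) < H 0"
      using Hc H0 unfolding continuous_on_iff by blast
    then show ?thesis using that[of d] by (fastforce simp: dist_real_def)
  qed
  define r where "r = min R (d / 2)"
  have r: "0 < r" "r \<le> R" "r < d" using R d by (auto simp: r_def)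
  have Hpos: "H t > 0" if "t \<in> {-r..r}" for t using d(2)[of t] that r by auto
  \<comment> \<open>\<eta> and its derivative vanish at both ends, as boundary terms involve \<delta>q and its derivative\<close>
  define \<eta> where "\<eta> = (\<lambda>t. ((t + r) * (t + r)) * ((r - t) * (r - t)))"
  define \<eta>' where "\<eta>' = (\<lambda>t. 2 * (t + r) * ((r - t) * (r - t)) - (t + r) * (t + r) * (2 * (r - t)))"
  have \<eta>: "(\<eta> has_vector_derivative \<eta>' t) (at t)" for t
    unfolding \<eta>_def \<eta>'_def has_real_derivative_iff_has_vector_derivative[symmetric]
    by (auto intro!: derivative_eq_intros simp: algebra_simps)
  have lin: "C_nat_on n UNIV (\<lambda>t::real. t + r)" "C_nat_on n UNIV (\<lambda>t::real. r + (-1) *\<^sub>R t)" for n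
    by (intro C_nat_on_add C_nat_on_ident C_nat_on_const C_nat_on_scaleR open_UNIV)+
  have \<zeta>C: "C_nat_on 2 UNIV (\<lambda>t. \<eta> t *\<^sub>R u0)"
    unfolding \<eta>_def using lin(1)[of 2] lin(2)[of 2]
    by (intro C_nat_on_scaleR C_nat_on_const C_nat_on_bilinear[OF _ bounded_bilinear_mult] open_UNIV) simp_all
  have \<zeta>: "((\<lambda>t. \<eta> t *\<^sub>R u0) has_vector_derivative \<eta>' t *\<^sub>R u0) (at t)" for t
    by (rule bounded_linear.has_vector_derivative[OF bounded_linear_scaleR_left \<eta>])
  have rr: "-r < r" using r by simp
  have img: "\<gamma> ` {-r..r} \<subseteq> chart_img \<phi>" using R(2)[OF r(1,2)] by blast
  note sv = straight_variation[OF \<phi>(1) rr \<gamma>C \<zeta>C \<gamma> \<zeta> img]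
  define V where "V = (\<lambda>e t. chart_inv \<phi> (\<gamma> t + e *\<^sub>R \<eta> t *\<^sub>R u0))"
  have var: "C2_variation A (-r) r c V"
    and dom: "\<And>t. t \<in> {-r..r} \<Longrightarrow> c t \<in> chart_dom \<phi>"
    and vel: "\<And>t. t \<in> {-r..r} \<Longrightarrow> velocity A {-r..r} c t = chart_vec A \<phi> (c t) (\<gamma>' t)"
    and del: "\<And>t. t \<in> {-r..r} \<Longrightarrow> delta_q A V t = chart_vec A \<phi> (c t) (\<eta> t *\<^sub>R u0)"
    and sec: "\<And>t. t \<in> {-r..r} \<Longrightarrow> second_velocity A {-r..r} c t = tvec2 \<phi> (c t) (\<gamma>' t) (\<gamma>' t, y)"
    and hat: "\<And>t. t \<in> {-r..r} \<Longrightarrow> delta_q_hat A (-r) r V t = tvec2 \<phi> (c t) (\<gamma>' t) (\<eta> t *\<^sub>R u0, \<eta>' t *\<^sub>R u0)"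
    using sv(2-7) by (simp_all add: V_def c_def)
  have ends: "pairing (\<theta> (velocity A {-r..r} c t)) (delta_q_hat A (-r) r V t) = 0"
    if "first_variation_pair E \<theta>" "t = r \<or> t = -r" for E \<theta> t
    using boundary_term_zero[OF that(1) \<phi>(1) dom] that(2) rr vel[of t] hat[of t]
    by (auto simp: \<eta>_def \<eta>'_def)
  have int: "integral {-r..r} (\<lambda>t. pairing (E (second_velocity A {-r..r} c t)) (delta_q A V t)) =
      integral {-r..r} (\<lambda>t. \<eta> t * G E t)"
    if "first_variation_pair E \<theta>" for E \<theta>
  proof (rule integral_cong)
    fix t assume t: "t \<in> {-r..r}"
    have "tvec2 \<phi> (c t) (\<gamma>' t) (\<gamma>' t, y) \<in> SO" by (rule tvec2_in_SO[OF \<phi>(1) dom[OF t]])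
    then have "E (tvec2 \<phi> (c t) (\<gamma>' t) (\<gamma>' t, y)) \<in> cotangent_space A (c t)"
      using first_variation_pairD(1)[OF that] by (metis base_chart_vec smooth_atlas.base_chart_vec smooth_atlas_tangent)
    from linear_scale[OF linear_pairing_chart_vec[OF this \<phi>(1) dom[OF t]], of "\<eta> t" u0]
    show "pairing (E (second_velocity A {-r..r} c t)) (delta_q A V t) = \<eta> t * G E t"
      using sec[OF t] del[OF t] by (simp add: G_def)
  qed
  have eq: "integral {-r..r} (\<lambda>t. \<eta> t * G D t) = integral {-r..r} (\<lambda>t. \<eta> t * G D' t)"
    using first_variation_pair_compare[OF fvp rr var] int[OF fvp(1)] int[OF fvp(2)] ends[OF fvp(1)] ends[OF fvp(2)]
    by simp
  have \<eta>c: "continuous_on {-r..r} \<eta>" unfolding \<eta>_def by (intro continuous_intros)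
  have Gc: "continuous_on {-r..r} (G E)" if "first_variation_pair E \<theta>" for E \<theta>
    using continuous_on_subset[OF cont[OF that]] r by auto
  have hi: "((\<lambda>t. \<eta> t * G E t) has_integral integral {-r..r} (\<lambda>t. \<eta> t * G E t)) {-r..r}"
    if "first_variation_pair E \<theta>" for E \<theta>
    by (intro integrable_integral integrable_continuous_real continuous_on_mult \<eta>c Gc[OF that])
  have "((\<lambda>t. \<eta> t * H t) has_integral 0) (cbox (-r) r)"
    using has_integral_diff[OF hi[OF fvp(1)] hi[OF fvp(2)]] eq by (simp add: H_def right_diff_distrib)
  moreover have "continuous_on (cbox (-r) r) (\<lambda>t. \<eta> t * H t)"
    using continuous_on_mult[OF \<eta>c continuous_on_subset[OF Hc]] r by auto
  moreover have "0 \<le> \<eta> t * H t" if "t \<in> box (-r) r" for t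
    using Hpos[of t] that by (intro mult_nonneg_nonneg) (auto simp: \<eta>_def)
  ultimately have "\<eta> 0 * H 0 = 0"
    using r by (intro has_integral_0_cbox_imp_0[of "-r" r "\<lambda>t. \<eta> t * H t" 0]) auto
  then show False using H0 r by (simp add: \<eta>_def)
qed

lemma euler_lagrange_map_unique:
  assumes "first_variation_pair D \<theta>" "first_variation_pair D' \<theta>'"
  shows "D = D'"
proof
  fix w show "D w = D' w"
  proof (cases "w \<in> SO")
    case True
    show ?thesis
      using covec_eqI[OF first_variation_pairD(1)[OF assms(1) True] first_variation_pairD(1)[OF assms(2) True]]
        euler_lagrange_pairing_le[OF assms True] euler_lagrange_pairing_le[OF assms(2,1) True] by (simp add: order_antisym)
  next
    case False
    then show ?thesis using assms by (auto simp: first_variation_pair_def PiE_def extensional_def)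
  qed
qed

text \<open>With equal integral terms the boundary terms must agree. The variation field vanishes together with its
  derivative at the left end of \<open>[-r, 0]\<close>, so only the right end contributes; there the curve has velocity \<open>v\<close>
  and the variation of the velocity is \<open>w\<close>.\<close>

lemma lagrange_form_unique:
  assumes fvp: "first_variation_pair D \<theta>" "first_variation_pair D \<theta>'"
  shows "\<theta> = \<theta>'"
proof
  interpret T: smooth_atlas TA by (rule smooth_atlas_tangent)
  fix v show "\<theta> v = \<theta>' v"
  proof (cases "v \<in> tangent_bundle A")
    case False
    then show ?thesis
      using assms by (auto simp: first_variation_pair_def one_form_def carrier_tangent_atlas PiE_def extensional_def)
  next
    case v: True
    obtain \<phi> where \<phi>: "\<phi> \<in> A" "base v \<in> chart_dom \<phi>"
      using v by (auto simp: tangent_bundle_iff carrier_def)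
    define p where "p = base v"
    define v0 where "v0 = component v \<phi>"
    have vv: "chart_vec A \<phi> p v0 = v" using tangent_bundle_eq_chart_vec[OF v \<phi>] by (simp add: p_def v0_def)
    have p: "p \<in> chart_dom \<phi>" using \<phi> by (simp add: p_def)
    show ?thesis
    proof (rule T.covec_eqI[OF first_variation_pairD(2)[OF fvp(1) v] first_variation_pairD(2)[OF fvp(2) v]])
      fix w assume w: "w \<in> tangent_space TA v"
      have vdom: "v \<in> chart_dom (tangent_chart A \<phi>)" using v \<phi> by (simp add: chart_dom_tangent_chart)
      obtain x z where xz: "component w (tangent_chart A \<phi>) = (x, z)" by fastforce
      have ww: "tvec2 \<phi> p v0 (x, z) = w"
        using T.tangent_space_eq_chart_vec[OF w tangent_chart_in_atlas[OF \<phi>(1)] vdom] vv xz by simp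
      define \<gamma> where "\<gamma> = (\<lambda>t. chart_map \<phi> p + t *\<^sub>R v0 + (t * t) *\<^sub>R ((0::'e) /\<^sub>R 2))"
      define \<gamma>' where "\<gamma>' = (\<lambda>t. v0 + t *\<^sub>R (0::'e))"
      have \<gamma>: "(\<gamma> has_vector_derivative \<gamma>' t) (at t)" "(\<gamma>' has_vector_derivative 0) (at t)" for t
        unfolding \<gamma>_def \<gamma>'_def by (rule quadratic_has_derivative)+
      have \<gamma>C: "C_nat_on 2 UNIV \<gamma>" unfolding \<gamma>_def by (rule C_nat_on_quadratic)
      obtain r where r: "r > 0" "\<And>s t. 0 < s \<Longrightarrow> s \<le> r \<Longrightarrow> t \<in> {-s..s} \<Longrightarrow> \<gamma> t \<in> chart_img \<phi>"
        using quadratic_curve_in_chart[OF \<phi>(1) p] unfolding \<gamma>_def by blast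
      have img: "\<gamma> ` {-r..0} \<subseteq> chart_img \<phi>" using r(2)[OF r(1) order_refl] r(1) by fastforce
      \<comment> \<open>\<zeta> vanishes to second order at \<open>-r\<close>; as \<open>\<eta> 0 = 1\<close> and \<open>\<eta>' 0 = 2 / r\<close>, this \<open>y\<close> gives it the value \<open>x\<close> and the derivative \<open>z\<close> at \<open>0\<close>\<close>
      define \<eta> where "\<eta> = (\<lambda>t. ((t + r) * (t + r)) / (r * r))"
      define \<eta>' where "\<eta>' = (\<lambda>t. 2 * (t + r) / (r * r))"
      define y where "y = z - (2 / r) *\<^sub>R x"
      define \<zeta> where "\<zeta> = (\<lambda>t. \<eta> t *\<^sub>R (x + t *\<^sub>R y))"
      define \<zeta>' where "\<zeta>' = (\<lambda>t. \<eta> t *\<^sub>R y + \<eta>' t *\<^sub>R (x + t *\<^sub>R y))"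
      have \<eta>: "(\<eta> has_real_derivative \<eta>' t) (at t)" for t
        unfolding \<eta>_def \<eta>'_def using r(1) by (auto intro!: derivative_eq_intros simp: field_simps)
      have \<zeta>: "(\<zeta> has_vector_derivative \<zeta>' t) (at t)" for t
        unfolding \<zeta>_def \<zeta>'_def
        by (rule has_vector_derivative_scaleR[OF \<eta> quadratic_has_derivative(2)])
      have lin: "C_nat_on 2 UNIV (\<lambda>t::real. t + r)"
        by (intro C_nat_on_add C_nat_on_ident C_nat_on_const open_UNIV)
      have "C_nat_on 2 UNIV (\<lambda>t. (1 / (r * r)) *\<^sub>R ((t + r) * (t + r)))"
        by (intro C_nat_on_scaleR C_nat_on_const C_nat_on_bilinear[OF _ bounded_bilinear_mult] lin open_UNIV)
      then have "C_nat_on 2 UNIV \<eta>" by (simp add: \<eta>_def)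
      then have \<zeta>C: "C_nat_on 2 UNIV \<zeta>"
        unfolding \<zeta>_def by (intro C_nat_on_scaleR C_nat_on_add C_nat_on_const C_nat_on_ident open_UNIV)
      have ends: "\<zeta> 0 = x" "\<zeta>' 0 = z" "\<zeta> (-r) = 0" "\<zeta>' (-r) = 0"
        using r(1) by (simp_all add: \<zeta>_def \<zeta>'_def \<eta>_def \<eta>'_def y_def)
      have rr: "-r < 0" using r by simp
      note sv = straight_variation[OF \<phi>(1) rr \<gamma>C \<zeta>C \<gamma> \<zeta> img]
      define V where "V = (\<lambda>e t. chart_inv \<phi> (\<gamma> t + e *\<^sub>R \<zeta> t))"
      define c where "c = (\<lambda>t. chart_inv \<phi> (\<gamma> t))"
      have var: "C2_variation A (-r) 0 c V"
        and dom: "\<And>t. t \<in> {-r..0} \<Longrightarrow> c t \<in> chart_dom \<phi>"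
        and vel: "\<And>t. t \<in> {-r..0} \<Longrightarrow> velocity A {-r..0} c t = chart_vec A \<phi> (c t) (\<gamma>' t)"
        and hat: "\<And>t. t \<in> {-r..0} \<Longrightarrow> delta_q_hat A (-r) 0 V t = tvec2 \<phi> (c t) (\<gamma>' t) (\<zeta> t, \<zeta>' t)"
        using sv(2,3,4,7) by (simp_all add: V_def c_def)
      have c0: "c 0 = p" using chart_inv_map[OF \<phi>(1) p] by (simp add: c_def \<gamma>_def)
      have right: "velocity A {-r..0} c 0 = v" "delta_q_hat A (-r) 0 V 0 = w"
        using vel[of 0] hat[of 0] r(1) c0 vv ww ends by (simp_all add: \<gamma>'_def)
      have left: "pairing (\<omega> (velocity A {-r..0} c (-r))) (delta_q_hat A (-r) 0 V (-r)) = 0"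
        if "first_variation_pair D \<omega>" for \<omega>
        using boundary_term_zero[OF that \<phi>(1) dom] vel[of "-r"] hat[of "-r"] r(1) ends by simp
      show "pairing (\<theta> v) w = pairing (\<theta>' v) w"
        using first_variation_pair_compare[OF fvp rr var] left[OF fvp(1)] left[OF fvp(2)] right by simp
    qed
  qed
qed

end

theorem theorem2p1:
  fixes X :: "'q topology"
    and A :: "('q, 'e::euclidean_space) chart set"
    and L :: "('q, 'e) tvec \<Rightarrow> real"
    and k :: enat
  assumes "smooth_manifold X A"
    and "2 \<le> k"
    and "C_map_on k (tangent_atlas A) (tangent_bundle A) std_atlas L"
  shows "\<exists>!(D, \<theta>).
           D \<in> second_order_submanifold A \<rightarrow>\<^sub>E cotangent_bundle A \<and>
           (\<forall>w\<in>second_order_submanifold A. cobase (D w) = base (base w)) \<and>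
           C_map_on (k - 2) (tangent_atlas (tangent_atlas A)) (second_order_submanifold A)
             (cotangent_atlas A) D \<and>
           one_form (k - 1) (tangent_atlas A) \<theta> \<and>
           (\<forall>a b q V. a < b \<longrightarrow> C2_variation A a b q V \<longrightarrow>
              first_variation_formula A L D \<theta> a b q V)"
proof -
  interpret smooth_atlas A using assms(1) by (rule smooth_manifold_imp_smooth_atlas)
  interpret lagrangian A L k by unfold_locales (use assms in auto)
  have "\<exists>!(D, \<theta>). first_variation_pair D \<theta>"
  proof (rule ex1I[of _ "(euler_lagrange_map, lagrange_form)"])
    show "case (euler_lagrange_map, lagrange_form) of (D, \<theta>) \<Rightarrow> first_variation_pair D \<theta>"
      using first_variation_pair_existence by simp
    fix z assume "case z of (D, \<theta>) \<Rightarrow> first_variation_pair D \<theta>"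
    then obtain D \<theta> where z: "z = (D, \<theta>)" "first_variation_pair D \<theta>" by auto
    then have "D = euler_lagrange_map" using euler_lagrange_map_unique first_variation_pair_existence by blast
    then show "z = (euler_lagrange_map, lagrange_form)"
      using z lagrange_form_unique first_variation_pair_existence by blast
  qed
  then show ?thesis unfolding first_variation_pair_def .
qed

end
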